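(* For all bipartite states $\rho_{AC_A}$ and $\tilde\rho_{C_BB}$ (density operators on finite-dimensional systems), $$K_{A\leftrightarrow C\leftrightarrow B}(\rho_{AC_A}\otimes\tilde\rho_{C_BB})\le D^\infty_{C\leftrightarrow AB}(\rho_{AC_A}\otimes\tilde\rho_{C_BB}),$$ $$K_{A\leftarrow C\rightarrow B}(\rho_{AC_A}\otimes\tilde\rho_{C_BB})\le D^\infty_{C\rightarrow AB}(\rho_{AC_A}\otimes\tilde\rho_{C_BB}).$$
   Context: All systems are finite-dimensional; $\log$ is base 2. Charlie holds $C=C_AC_B$. $\alpha\approx_\epsilon\beta$ means $\|\alpha-\beta\|_1\le\epsilon$ (trace norm). Private states: an $m$-bit private state $\gamma_m$ is a bipartite state (cut $AA':BB'$), with key systems $A,B$ of dimension $2^m$ and shield systems $A',B'$ of arbitrary finite dimension, of the form $\gamma_m=2^{-m}\sum_{i,j=0}^{2^m-1}|ii\rangle\langle jj|_{AB}\otimes U_i\,\sigma_{A'B'}\,U_j^\dagger$ with $\sigma_{A'B'}$ a state and $U_i$ unitaries on $A'B'$. Quantum key repeater rate: $$K_{A\leftrightarrow C\leftrightarrow B}(\rho_{AC_A}\otimes\tilde\rho_{C_BB})=\inf_{\epsilon>0}\limsup_{n\to\infty}\sup_{\Lambda_n,\gamma_m}\Big\{\tfrac mn:\ \mathrm{Tr}_C\Lambda_n\big((\rho_{AC_A}\otimes\tilde\rho_{C_BB})^{\otimes n}\big)\approx_\epsilon\gamma_m\Big\},$$ where $\Lambda_n$ ranges over all tripartite LOCC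 (local operations and classical communication) protocols among Alice, Bob and Charlie, and $\gamma_m$ over all $m$-bit private states between Alice and Bob. $K_{A\leftarrow C\rightarrow B}$ is defined in the same way, but with all classical communication being one-way from Charlie (to Alice and to Bob). Restricted relative entropy: a POVM $\{M_i\}$ is identified with the map $M:X\mapsto\sum_i(\mathrm{Tr}\,M_iX)|i\rangle\langle i|$. $\mathrm{LOCC}(C:AB)$ denotes the POVMs implementable by LOCC between Charlie and a party holding $A$ and $B$ jointly; $\mathrm{LOCC}(C\to AB)$ those implementable with one-way classical communication from $C$ to $AB$. $\mathrm{SEP}(A:C_A:C_B:B)$ is the set of fully separable states on the four systems. $D(\cdot\|\cdot)$ is the relative entropy. Define $$D_{C\leftrightarrow AB}(\rho_{AC_A}\otimes\tilde\rho_{C_BB})=\inf_{\sigma\in\mathrm{SEP}(A:C_A:C_B:B)}\ \sup_{M\in\mathrm{LOCC}(C:AB)}D\big(M(\rho\otimes\tilde\rho)\,\|\,M(\sigma)\big),$$ and $D_{C\rightarrow AB}$ in the same way with $M\in\mathrm{LOCC}(C\to AB)$. The regularised versions are $D^\infty(\rho\otimes\tilde\rho)=\lim_{n\to\infty}\frac1nD(\rho^{\otimes n}\otimes\tilde\rho^{\otimes n})$ (where $A,C_A,C_B,B$ are replaced by $A^n,C_A^n,C_B^n,B^n$). *)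

theory Defs
  imports
    "HOL-Library.Extended_Real"
    "Jordan_Normal_Form.Schur_Decomposition"
    "Jordan_Normal_Form.Matrix_Kernel"
begin

text \<open>
  Operators on finite-dimensional Hilbert spaces are complex matrices. The basis of a composite
  system with local dimensions \<open>d\<^sub>1, \<dots>, d\<^sub>k\<close> is enumerated lexicographically, so that a composite
  operator is a matrix of dimension \<open>d\<^sub>1 * \<dots> * d\<^sub>k\<close>.
\<close>

definition msum :: "nat \<Rightarrow> 'i set \<Rightarrow> ('i \<Rightarrow> complex mat) \<Rightarrow> complex mat" where
  "msum d I f = mat d d (\<lambda>(r, c). \<Sum>i\<in>I. f i $$ (r, c))"

definition tr :: "complex mat \<Rightarrow> complex" where
  "tr X = (\<Sum>i<dim_row X. X $$ (i, i))"

definition unitary :: "nat \<Rightarrow> complex mat \<Rightarrow> bool" where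
  "unitary d U \<longleftrightarrow>
     U \<in> carrier_mat d d \<and> U * mat_adjoint U = 1\<^sub>m d \<and> mat_adjoint U * U = 1\<^sub>m d"

definition positive :: "nat \<Rightarrow> complex mat \<Rightarrow> bool" where
  "positive d X \<longleftrightarrow>
     X \<in> carrier_mat d d \<and> mat_adjoint X = X \<and>
     (\<forall>v \<in> carrier_vec d. 0 \<le> Re ((X *\<^sub>v v) \<bullet>c v))"

text \<open>The trace condition forces \<open>d > 0\<close>.\<close>

definition density :: "nat \<Rightarrow> complex mat \<Rightarrow> bool" where
  "density d \<rho> \<longleftrightarrow> positive d \<rho> \<and> tr \<rho> = 1"

text \<open>
  Functional calculus for Hermitian matrices: \<open>f(A) = U diag(f(l\<^sub>i)) U\<^sup>*\<close> for a spectral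
  decomposition \<open>A = U diag(l\<^sub>i) U\<^sup>*\<close>; the value does not depend on the decomposition.
\<close>

definition herm_fun :: "(real \<Rightarrow> real) \<Rightarrow> complex mat \<Rightarrow> complex mat" where
  "herm_fun f A = (THE B. \<exists>U l.
     unitary (dim_row A) U \<and>
     A = U * mat_diag (dim_row A) (\<lambda>i. complex_of_real (l i)) * mat_adjoint U \<and>
     B = U * mat_diag (dim_row A) (\<lambda>i. complex_of_real (f (l i))) * mat_adjoint U)"

definition trace_norm :: "complex mat \<Rightarrow> real" where
  "trace_norm X = Re (tr (herm_fun sqrt (mat_adjoint X * X)))"

text \<open>
  The logarithm is taken on the support only. The kernel condition says that the support of
  \<open>\<rho>\<close> is contained in the support of \<open>\<sigma>\<close>.
\<close>

definition mlog :: "complex mat \<Rightarrow> complex mat" where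
  "mlog = herm_fun (\<lambda>x. if 0 < x then log 2 x else 0)"

definition rel_entropy :: "complex mat \<Rightarrow> complex mat \<Rightarrow> ereal" where
  "rel_entropy \<rho> \<sigma> =
     (if mat_kernel \<sigma> \<subseteq> mat_kernel \<rho>
      then ereal (Re (tr (\<rho> * (mlog \<rho> - mlog \<sigma>))))
      else \<infinity>)"

definition tensor_mat :: "complex mat \<Rightarrow> complex mat \<Rightarrow> complex mat"
    (infixl \<open>\<otimes>\<^sub>m\<close> 75) where
  "A \<otimes>\<^sub>m B = mat (dim_row A * dim_row B) (dim_col A * dim_col B)
     (\<lambda>(i, j). A $$ (i div dim_row B, j div dim_col B) * B $$ (i mod dim_row B, j mod dim_col B))"

text \<open>The unitary \<open>|y\<rangle>|z\<rangle> \<mapsto> |z\<rangle>|y\<rangle>\<close>, for \<open>y < b\<close> and \<open>z < c\<close>.\<close>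

definition swap_mat :: "nat \<Rightarrow> nat \<Rightarrow> complex mat" where
  "swap_mat b c =
     mat (c * b) (b * c) (\<lambda>(i, j). if i div b = j mod c \<and> i mod b = j div c then 1 else 0)"

text \<open>
  Rearranges an operator on four systems of dimensions \<open>a, b, c, d\<close> into one on the systems
  of dimensions \<open>a, c, b, d\<close>, in this order.
\<close>

definition swap_middle :: "nat \<Rightarrow> nat \<Rightarrow> nat \<Rightarrow> nat \<Rightarrow> complex mat \<Rightarrow> complex mat" where
  "swap_middle a b c d X =
     (let W = 1\<^sub>m a \<otimes>\<^sub>m swap_mat b c \<otimes>\<^sub>m 1\<^sub>m d in W * X * mat_adjoint W)"

text \<open>
  The \<open>n\<close>-th tensor power of a state of \<open>P Q\<close>, as a state of \<open>P\<^sup>n Q\<^sup>n\<close> (all the copies of \<open>P\<close> first).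
\<close>

primrec bipartite_power :: "nat \<Rightarrow> nat \<Rightarrow> complex mat \<Rightarrow> nat \<Rightarrow> complex mat" where
  "bipartite_power p q \<rho> 0 = 1\<^sub>m 1"
| "bipartite_power p q \<rho> (Suc n) =
     swap_middle (p ^ n) (q ^ n) p q (bipartite_power p q \<rho> n \<otimes>\<^sub>m \<rho>)"

text \<open>
  \<open>n\<close> copies of \<open>\<rho>\<close> on \<open>A C\<^sub>A\<close> and of \<open>\<tau>\<close> on \<open>C\<^sub>B B\<close>, on \<open>A\<^sup>n C\<^sub>A\<^sup>n C\<^sub>B\<^sup>n B\<^sup>n\<close> in this order. In particular,
  Charlie's systems form the middle tensor factor of \<open>A\<^sup>n : C\<^sup>n : B\<^sup>n\<close>.
\<close>

definition copies ::
    "nat \<Rightarrow> nat \<Rightarrow> nat \<Rightarrow> nat \<Rightarrow> complex mat \<Rightarrow> complex mat \<Rightarrow> nat \<Rightarrow> complex mat" where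
  "copies dA dCA dCB dB \<rho> \<tau> n = bipartite_power dA dCA \<rho> n \<otimes>\<^sub>m bipartite_power dCB dB \<tau> n"

definition kraus_map :: "nat \<Rightarrow> complex mat list \<Rightarrow> complex mat \<Rightarrow> complex mat" where
  "kraus_map d' Ks X = msum d' {..<length Ks} (\<lambda>k. Ks ! k * X * mat_adjoint (Ks ! k))"

text \<open>Trace over the second of three systems: \<open>\<Sum>\<^sub>k (1 \<otimes> \<langle>k| \<otimes> 1) X (1 \<otimes> |k\<rangle> \<otimes> 1)\<close>.\<close>

definition trace_middle :: "nat \<Rightarrow> nat \<Rightarrow> nat \<Rightarrow> complex mat \<Rightarrow> complex mat" where
  "trace_middle a c b =
     kraus_map (a * b) (map (\<lambda>k. 1\<^sub>m a \<otimes>\<^sub>m mat_of_row (unit_vec c k) \<otimes>\<^sub>m 1\<^sub>m b) [0..<c])"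

definition separable4 :: "nat \<Rightarrow> nat \<Rightarrow> nat \<Rightarrow> nat \<Rightarrow> complex mat set" where
  "separable4 dA dCA dCB dB =
     {\<sigma>. \<exists>(r::nat) (p :: nat \<Rightarrow> real) \<alpha> \<kappa> \<kappa>' \<beta>.
        (\<forall>k<r. 0 \<le> p k \<and> density dA (\<alpha> k) \<and> density dCA (\<kappa> k) \<and>
               density dCB (\<kappa>' k) \<and> density dB (\<beta> k)) \<and>
        (\<Sum>k<r. p k) = 1 \<and>
        \<sigma> = msum (dA * dCA * dCB * dB) {..<r}
              (\<lambda>k. complex_of_real (p k) \<cdot>\<^sub>m (\<alpha> k \<otimes>\<^sub>m \<kappa> k \<otimes>\<^sub>m \<kappa>' k \<otimes>\<^sub>m \<beta> k))}"

text \<open>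
  A quantum instrument on a \<open>d\<close>-dimensional system, one entry \<open>(d', Ks)\<close> per outcome: the output
  dimension and the Kraus operators of the completely positive map belonging to that outcome. The sum
  of these maps is trace preserving.
\<close>

definition instrument :: "nat \<Rightarrow> (nat \<times> complex mat list) list \<Rightarrow> bool" where
  "instrument d Es \<longleftrightarrow>
     (\<forall>(d', Ks) \<in> set Es. 0 < d' \<and> set Ks \<subseteq> carrier_mat d' d) \<and>
     (let Ks = concat (map snd Es)
      in msum d {..<length Ks} (\<lambda>k. mat_adjoint (Ks ! k) * (Ks ! k)) = 1\<^sub>m d)"

definition on_party :: "nat list \<Rightarrow> nat \<Rightarrow> complex mat \<Rightarrow> complex mat" where
  "on_party ds p K = 1\<^sub>m (prod_list (take p ds)) \<otimes>\<^sub>m K \<otimes>\<^sub>m 1\<^sub>m (prod_list (drop (Suc p) ds))"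

definition local_map :: "nat list \<Rightarrow> nat \<Rightarrow> nat \<times> complex mat list \<Rightarrow> complex mat \<Rightarrow> complex mat" where
  "local_map ds p E = kraus_map (prod_list (ds[p := fst E])) (map (on_party ds p) (snd E))"

text \<open>
  \<open>locc S ds ds' \<Lambda>\<close>: the map \<open>\<Lambda>\<close>, from parties with local dimensions \<open>ds\<close> to parties with local
  dimensions \<open>ds'\<close>, is implemented by a (finite-round) protocol of local operations and classical
  communication in which only the parties in \<open>S\<close> send classical messages. In every step one party \<open>p\<close>
  applies an instrument; if \<open>p \<in> S\<close>, its outcome is announced to all parties and the rest of the
  protocol may depend on it. A party outside \<open>S\<close> applies an instrument with a single outcome, that is
  a channel. All parties may communicate for \<open>S = {..<length ds}\<close>; for \<open>S = {c}\<close> the communication is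
  one-way from \<open>c\<close> to the others.
\<close>

inductive locc ::
    "nat set \<Rightarrow> nat list \<Rightarrow> nat list \<Rightarrow> (complex mat \<Rightarrow> complex mat) \<Rightarrow> bool"
  for S :: "nat set" where
  locc_done: "locc S ds ds (\<lambda>X. X)"
| locc_step:
    "\<lbrakk> p < length ds; instrument (ds ! p) Es; p \<in> S \<or> length Es = 1;
       \<forall>i<length Es. locc S (ds[p := fst (Es ! i)]) ds' (\<Lambda> i) \<rbrakk>
     \<Longrightarrow> locc S ds ds'
           (\<lambda>X. msum (prod_list ds') {..<length Es} (\<lambda>i. \<Lambda> i (local_map ds p (Es ! i) X)))"

definition ketbra :: "nat \<Rightarrow> nat \<Rightarrow> nat \<Rightarrow> complex mat" where
  "ketbra d i j = mat d d (\<lambda>(r, c). if r = i \<and> c = j then 1 else 0)"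

text \<open>
  The \<open>m\<close>-bit private states with shields \<open>A', B'\<close> of dimensions \<open>a, b\<close>. The defining formula
  is for the order \<open>A B A' B'\<close> and is rearranged to \<open>A A' B B'\<close>, so that the factors are
  Alice's system \<open>A A'\<close> and Bob's system \<open>B B'\<close>.
\<close>

definition private_states :: "nat \<Rightarrow> nat \<Rightarrow> nat \<Rightarrow> complex mat set" where
  "private_states m a b =
     {\<gamma>. \<exists>\<sigma> U. density (a * b) \<sigma> \<and> (\<forall>i<2 ^ m. unitary (a * b) (U i)) \<and>
        \<gamma> = swap_middle (2 ^ m) (2 ^ m) a b
              ((1 / 2 ^ m) \<cdot>\<^sub>m msum (2 ^ m * 2 ^ m * a * b) ({..<2 ^ m} \<times> {..<2 ^ m})
                (\<lambda>(i, j). ketbra (2 ^ m) i j \<otimes>\<^sub>m ketbra (2 ^ m) i j \<otimes>\<^sub>m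
                          (U i * \<sigma> * mat_adjoint (U j))))}"

text \<open>The parties are Alice (0), Charlie (1) and Bob (2).\<close>

definition repeater_rate ::
    "nat set \<Rightarrow> nat \<Rightarrow> nat \<Rightarrow> nat \<Rightarrow> nat \<Rightarrow> complex mat \<Rightarrow> complex mat \<Rightarrow> ereal" where
  "repeater_rate S dA dCA dCB dB \<rho> \<tau> =
     (INF \<epsilon>\<in>{0::real<..}. limsup (\<lambda>n. Sup {ereal (real m / real n) |m. \<exists>a b c \<Lambda> \<gamma>.
        locc S [dA ^ n, dCA ^ n * dCB ^ n, dB ^ n] [2 ^ m * a, c, 2 ^ m * b] \<Lambda> \<and>
        \<gamma> \<in> private_states m a b \<and>
        trace_norm
          (trace_middle (2 ^ m * a) c (2 ^ m * b) (\<Lambda> (copies dA dCA dCB dB \<rho> \<tau> n)) - \<gamma>) \<le> \<epsilon>}))"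

definition key_rate_two_way ::
    "nat \<Rightarrow> nat \<Rightarrow> nat \<Rightarrow> nat \<Rightarrow> complex mat \<Rightarrow> complex mat \<Rightarrow> ereal" where
  "key_rate_two_way = repeater_rate {0, 1, 2}"

definition key_rate_one_way ::
    "nat \<Rightarrow> nat \<Rightarrow> nat \<Rightarrow> nat \<Rightarrow> complex mat \<Rightarrow> complex mat \<Rightarrow> ereal" where
  "key_rate_one_way = repeater_rate {1}"

definition povm :: "nat \<Rightarrow> complex mat list \<Rightarrow> bool" where
  "povm d Ms \<longleftrightarrow>
     (\<forall>M \<in> set Ms. positive d M) \<and> msum d {..<length Ms} (\<lambda>i. Ms ! i) = 1\<^sub>m d"

definition measure_map :: "complex mat list \<Rightarrow> complex mat \<Rightarrow> complex mat" where
  "measure_map Ms X = mat_diag (length Ms) (\<lambda>i. tr (Ms ! i * X))"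

text \<open>
  The POVMs on \<open>C : AB\<close> implementable by a protocol between Charlie (0) and the holder of \<open>AB\<close> (1).
  The protocol ends with the outcome in a classical register at \<open>AB\<close>, Charlie's system being discarded.
\<close>

definition locc_povms :: "nat set \<Rightarrow> nat \<Rightarrow> nat \<Rightarrow> complex mat list set" where
  "locc_povms S dC dAB =
     {Ms. povm (dC * dAB) Ms \<and>
        (\<exists>\<Lambda>. locc S [dC, dAB] [1, length Ms] \<Lambda> \<and>
             (\<forall>X \<in> carrier_mat (dC * dAB) (dC * dAB). \<Lambda> X = measure_map Ms X))}"

text \<open>Rearranges an operator on \<open>A C B\<close> into one on \<open>C A B\<close>.\<close>

definition charlie_first :: "nat \<Rightarrow> nat \<Rightarrow> nat \<Rightarrow> complex mat \<Rightarrow> complex mat" where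
  "charlie_first dA dC dB = swap_middle 1 dA dC dB"

definition restricted_rel_entropy ::
    "nat set \<Rightarrow> nat \<Rightarrow> nat \<Rightarrow> nat \<Rightarrow> nat \<Rightarrow> complex mat \<Rightarrow> ereal" where
  "restricted_rel_entropy S dA dCA dCB dB \<omega> =
     (INF \<sigma>\<in>separable4 dA dCA dCB dB. SUP Ms\<in>locc_povms S (dCA * dCB) (dA * dB).
        rel_entropy (measure_map Ms (charlie_first dA (dCA * dCB) dB \<omega>))
                    (measure_map Ms (charlie_first dA (dCA * dCB) dB \<sigma>)))"

definition entropy_rate ::
    "nat set \<Rightarrow> nat \<Rightarrow> nat \<Rightarrow> nat \<Rightarrow> nat \<Rightarrow> complex mat \<Rightarrow> complex mat \<Rightarrow> nat \<Rightarrow> ereal" where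
  "entropy_rate S dA dCA dCB dB \<rho> \<tau> n =
     ereal (1 / real n) *
     restricted_rel_entropy S (dA ^ n) (dCA ^ n) (dCB ^ n) (dB ^ n) (copies dA dCA dCB dB \<rho> \<tau> n)"

text \<open>
  The regularisation is the limit of the entropy rates. Since the existence of this limit is not part
  of the definition, it is written as a limit superior, which is the limit whenever that exists.
\<close>

definition regularised_rel_entropy ::
    "nat set \<Rightarrow> nat \<Rightarrow> nat \<Rightarrow> nat \<Rightarrow> nat \<Rightarrow> complex mat \<Rightarrow> complex mat \<Rightarrow> ereal" where
  "regularised_rel_entropy S dA dCA dCB dB \<rho> \<tau> = limsup (entropy_rate S dA dCA dCB dB \<rho> \<tau>)"

lemma regularised_rel_entropy_eq_lim:
  assumes "entropy_rate S dA dCA dCB dB \<rho> \<tau> \<longlonglongrightarrow> L"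
  shows "regularised_rel_entropy S dA dCA dCB dB \<rho> \<tau> = L"
  unfolding regularised_rel_entropy_def
  using lim_imp_Limsup[OF sequentially_bot assms] .

definition rel_entropy_reg_two_way ::
    "nat \<Rightarrow> nat \<Rightarrow> nat \<Rightarrow> nat \<Rightarrow> complex mat \<Rightarrow> complex mat \<Rightarrow> ereal" where
  "rel_entropy_reg_two_way = regularised_rel_entropy {0, 1}"

definition rel_entropy_reg_one_way ::
    "nat \<Rightarrow> nat \<Rightarrow> nat \<Rightarrow> nat \<Rightarrow> complex mat \<Rightarrow> complex mat \<Rightarrow> ereal" where
  "rel_entropy_reg_one_way = regularised_rel_entropy {0}"

end

(*
  Let a protocol turn n copies into a state close to the m-bit private state gamma = R s R^*, where
  R = 2^(-m/2) sum_i |ii> (x) U_i is an isometry. The projector P = R R^* satisfies tr (P gamma) = 1,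
  so by duality for the trace norm the protocol's output passes the test {P, 1 - P} with probability
  at least 1 - eps. A separable state stays separable between Alice and Bob under LOCC, and by
  Cauchy-Schwarz over the key basis it passes with probability at most 2^(-m). A party holding A and
  B jointly can run Alice's and Bob's parts of the protocol and then perform the test, which makes
  the whole procedure an LOCC measurement between C and AB. The relative entropy of the two binary
  outcome distributions is at least (1 - eps) m - 2, uniformly in the separable state; now divide by
  n and let n grow and eps shrink.
*)

theory Submission
  imports Defs "HOL-Analysis.L2_Norm"
begin

section \<open>Adjoints, tensor products and traces\<close>

text \<open>Two representations carry the proof. States enter in factored form \<open>Y Y^*\<close>
  and maps through Kraus operators, so that every probability is a sum of squared Hilbert-Schmidt
  norms of products \<open>K Y\<close>; the estimates then concern single matrices instead of
  operator inequalities. The obstacle is the inductive \<open>locc\<close>: it grows at its front,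
  yet the test comes at the end, and the POVM must be realised exactly by a protocol on C and AB,
  with the systems in another order. Hence the simulation peels off the first step and carries the
  permutation of the factors past every Kraus operator. Two sets record who may speak: Charlie's
  messages stay Charlie's, those of Alice or Bob become messages of AB, and discarding and testing
  are single-outcome channels that announce nothing. One argument thus serves both inequalities. The
  loss 2 is a crude bound on a binary entropy, obtained from \<open>ln x \<le> x - 1\<close>;
  division by n makes it harmless.\<close>

lemma mat_adjoint_dim [simp]:
  "dim_row (mat_adjoint A) = dim_col A" "dim_col (mat_adjoint A) = dim_row A"
  by (simp_all add: mat_adjoint_def)

lemma mat_adjoint_index [simp]:
  assumes "i < dim_col A" "j < dim_row A"
  shows "mat_adjoint (A :: complex mat) $$ (i, j) = cnj (A $$ (j, i))"
  using assms by (simp add: mat_adjoint_def mat_of_rows_def)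

lemma mat_adjoint_carrier [simp]:
  "A \<in> carrier_mat n m \<Longrightarrow> mat_adjoint A \<in> carrier_mat m n"
  by auto

lemma mat_adjoint_adjoint [simp]: "mat_adjoint (mat_adjoint (A :: complex mat)) = A"
  by (rule eq_matI) auto

lemma mat_adjoint_mult:
  assumes "dim_col A = dim_row (B :: complex mat)"
  shows "mat_adjoint (A * B) = mat_adjoint B * mat_adjoint A"
  using assms by (intro eq_matI) (auto simp: scalar_prod_def mult.commute intro!: sum.cong)

lemma mat_adjoint_minus:
  assumes "A \<in> carrier_mat n m" "B \<in> carrier_mat n m"
  shows "mat_adjoint (A - B :: complex mat) = mat_adjoint A - mat_adjoint B"
  using assms by (intro eq_matI) auto

lemma mat_adjoint_smult: "mat_adjoint (c \<cdot>\<^sub>m A :: complex mat) = cnj c \<cdot>\<^sub>m mat_adjoint A"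
  by (intro eq_matI) auto

lemma mat_adjoint_one [simp]: "mat_adjoint (1\<^sub>m n :: complex mat) = 1\<^sub>m n"
  by (intro eq_matI) auto

lemma tensor_dim [simp]:
  "dim_row (A \<otimes>\<^sub>m B) = dim_row A * dim_row B" "dim_col (A \<otimes>\<^sub>m B) = dim_col A * dim_col B"
  by (simp_all add: tensor_mat_def)

lemma tensor_carrier [simp]:
  assumes "A \<in> carrier_mat a b" "B \<in> carrier_mat c d"
  shows "A \<otimes>\<^sub>m B \<in> carrier_mat (a * c) (b * d)"
  using assms by auto

lemma tensor_index:
  assumes "i < dim_row A * dim_row B" "j < dim_col A * dim_col B"
  shows "(A \<otimes>\<^sub>m B) $$ (i, j)
    = A $$ (i div dim_row B, j div dim_col B) * B $$ (i mod dim_row B, j mod dim_col B)"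
  using assms by (simp add: tensor_mat_def)

lemma div_mod_less_mult:
  assumes "i < a * (b::nat)"
  shows "i div b < a" "i mod b < b"
  using assms by (simp_all add: less_mult_imp_div_less)
    (metis bot_nat_0.not_eq_extremum mod_less_divisor mult_0_right not_less0)

lemma mat_adjoint_tensor: "mat_adjoint (A \<otimes>\<^sub>m B) = mat_adjoint A \<otimes>\<^sub>m mat_adjoint B"
  by (rule eq_matI) (auto simp: tensor_index div_mod_less_mult)

text \<open>Indices of a tensor product are pairs in lexicographic order; this reindexing produces
  the double sums that factorise.\<close>

lemma sum_lessThan_mult:
  fixes f :: "nat \<Rightarrow> 'a::comm_monoid_add"
  shows "(\<Sum>k<m * n. f k) = (\<Sum>i<m. \<Sum>j<n. f (i * n + j))"
proof -
  have "sum f {i * n..<i * n + n} = (\<Sum>j<n. f (i * n + j))" for i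
    using sum.atLeastLessThan_shift_0[of f "i * n" "i * n + n"] by (simp add: atLeast0LessThan)
  then have "(\<Sum>i<m. \<Sum>j<n. f (i * n + j)) = (\<Sum>i<m. sum f {i * n..<i * n + n})"
    by simp
  then show ?thesis
    by (simp add: sum.nat_group)
qed

text \<open>The inner sum runs over pairs of indices and factorises. Only inner dimensions have to
  match, a premise that \<open>simp\<close> can discharge for rectangular factors.\<close>

lemma tensor_mult:
  assumes "dim_col A = dim_row C" "dim_col B = dim_row D"
  shows "(A \<otimes>\<^sub>m B) * (C \<otimes>\<^sub>m D) = (A * C) \<otimes>\<^sub>m (B * D)"
proof (rule eq_matI)
  fix i j assume "i < dim_row ((A * C) \<otimes>\<^sub>m (B * D))" "j < dim_col ((A * C) \<otimes>\<^sub>m (B * D))"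
  then have i: "i < dim_row A * dim_row B" and j: "j < dim_col C * dim_col D" by auto
  note bi = div_mod_less_mult[OF i] and bj = div_mod_less_mult[OF j]
  have "((A \<otimes>\<^sub>m B) * (C \<otimes>\<^sub>m D)) $$ (i, j)
      = (\<Sum>k<dim_row C * dim_row D. (A \<otimes>\<^sub>m B) $$ (i, k) * (C \<otimes>\<^sub>m D) $$ (k, j))"
    using i j assms by (simp add: scalar_prod_def atLeast0LessThan)
  also have "\<dots> = (\<Sum>k<dim_row C * dim_row D. A $$ (i div dim_row B, k div dim_row D)
      * B $$ (i mod dim_row B, k mod dim_row D) * (C $$ (k div dim_row D, j div dim_col D)
      * D $$ (k mod dim_row D, j mod dim_col D)))"
    using i j assms by (intro sum.cong) (auto simp: tensor_index)
  also have "\<dots> = (\<Sum>k<dim_row C. \<Sum>l<dim_row D. A $$ (i div dim_row B, k)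
      * B $$ (i mod dim_row B, l) * (C $$ (k, j div dim_col D) * D $$ (l, j mod dim_col D)))"
    unfolding sum_lessThan_mult by (intro sum.cong refl) auto
  also have "\<dots> = (\<Sum>k<dim_row C. A $$ (i div dim_row B, k) * C $$ (k, j div dim_col D))
      * (\<Sum>l<dim_row D. B $$ (i mod dim_row B, l) * D $$ (l, j mod dim_col D))"
    unfolding sum_product by (intro sum.cong refl) (simp add: algebra_simps)
  also have "\<dots> = ((A * C) \<otimes>\<^sub>m (B * D)) $$ (i, j)"
    using i j bi bj assms by (simp add: tensor_index scalar_prod_def atLeast0LessThan)
  finally show "((A \<otimes>\<^sub>m B) * (C \<otimes>\<^sub>m D)) $$ (i, j) = ((A * C) \<otimes>\<^sub>m (B * D)) $$ (i, j)" .
qed auto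

lemma tensor_assoc: "A \<otimes>\<^sub>m B \<otimes>\<^sub>m C = A \<otimes>\<^sub>m (B \<otimes>\<^sub>m C)"
proof (rule eq_matI)
  fix i j assume "i < dim_row (A \<otimes>\<^sub>m (B \<otimes>\<^sub>m C))" "j < dim_col (A \<otimes>\<^sub>m (B \<otimes>\<^sub>m C))"
  then have i: "i < dim_row A * dim_row B * dim_row C" and j: "j < dim_col A * dim_col B * dim_col C"
    by (auto simp: mult.assoc)
  \<comment> \<open>An index of the triple product has three digits in a mixed radix; both
    bracketings read off the same digits.\<close>
  have eqs: "k div (x * y) = k div y div x" "k mod (x * y) div y = k div y mod x"
      "k mod (x * y) mod y = k mod y" if "k < z * x * y" for k x y z :: nat
  proof -
    have y: "0 < y" using that by (cases y) auto
    show "k div (x * y) = k div y div x" by (metis div_mult2_eq mult.commute)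
    have "k mod (x * y) = y * (k div y mod x) + k mod y"
      by (metis mod_mult2_eq mult.commute)
    then show "k mod (x * y) div y = k div y mod x" "k mod (x * y) mod y = k mod y"
      using y by simp_all
  qed
  show "(A \<otimes>\<^sub>m B \<otimes>\<^sub>m C) $$ (i, j) = (A \<otimes>\<^sub>m (B \<otimes>\<^sub>m C)) $$ (i, j)"
    using i j div_mod_less_mult[OF i] div_mod_less_mult[OF j]
      div_mod_less_mult[OF i[unfolded mult.assoc]] div_mod_less_mult[OF j[unfolded mult.assoc]]
    by (simp add: tensor_index eqs[OF i] eqs[OF j] mult.assoc)
qed auto

lemma one_tensor_one [simp]: "1\<^sub>m a \<otimes>\<^sub>m 1\<^sub>m b = 1\<^sub>m (a * b)"
proof (rule eq_matI)
  fix i j assume "i < dim_row (1\<^sub>m (a * b) :: complex mat)" "j < dim_col (1\<^sub>m (a * b) :: complex mat)"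
  then have ij: "i < a * b" "j < a * b" by auto
  have "i = j \<longleftrightarrow> i div b = j div b \<and> i mod b = j mod b"
    by (metis div_mult_mod_eq)
  then show "(1\<^sub>m a \<otimes>\<^sub>m 1\<^sub>m b) $$ (i, j) = (1\<^sub>m (a * b) :: complex mat) $$ (i, j)"
    using ij div_mod_less_mult[OF ij(1)] div_mod_less_mult[OF ij(2)] by (auto simp: tensor_index)
qed auto

lemma one_one_tensor [simp]: "1\<^sub>m (Suc 0) \<otimes>\<^sub>m A = A" "1\<^sub>m 1 \<otimes>\<^sub>m A = A"
  by (auto intro!: eq_matI simp: tensor_index)

lemma tensor_one_one [simp]: "A \<otimes>\<^sub>m 1\<^sub>m (Suc 0) = A" "A \<otimes>\<^sub>m 1\<^sub>m 1 = A"
  by (auto intro!: eq_matI simp: tensor_index)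

lemma tensor_add_left:
  assumes "A \<in> carrier_mat n m" "B \<in> carrier_mat n m"
  shows "(A + B) \<otimes>\<^sub>m C = A \<otimes>\<^sub>m C + B \<otimes>\<^sub>m C"
  using assms by (intro eq_matI) (auto simp: tensor_index div_mod_less_mult algebra_simps)

lemma tensor_add_right:
  assumes "B \<in> carrier_mat n m" "C \<in> carrier_mat n m"
  shows "A \<otimes>\<^sub>m (B + C) = A \<otimes>\<^sub>m B + A \<otimes>\<^sub>m C"
  using assms by (intro eq_matI) (auto simp: tensor_index div_mod_less_mult algebra_simps)

lemma zero_tensor [simp]: "0\<^sub>m n m \<otimes>\<^sub>m C = 0\<^sub>m (n * dim_row C) (m * dim_col C)"
  by (intro eq_matI) (auto simp: tensor_index div_mod_less_mult)

lemma tensor_zero [simp]: "C \<otimes>\<^sub>m 0\<^sub>m n m = 0\<^sub>m (dim_row C * n) (dim_col C * m)"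
  by (intro eq_matI) (auto simp: tensor_index div_mod_less_mult)

section \<open>The swap of two tensor factors\<close>

lemma swap_mat_carrier [simp]: "swap_mat b c \<in> carrier_mat (c * b) (b * c)"
  by (simp add: swap_mat_def)

lemma swap_mat_dim [simp]: "dim_row (swap_mat b c) = c * b" "dim_col (swap_mat b c) = b * c"
  by (simp_all add: swap_mat_def)

lemma index_lt_mult: "x < a \<Longrightarrow> y < b \<Longrightarrow> x * b + y < a * (b::nat)"
proof -
  assume "x < a" "y < b"
  then have "Suc x * b \<le> a * b" by (intro mult_le_mono1) simp
  with \<open>y < b\<close> show "x * b + y < a * b" by simp
qed

lemma div_mod_eq_iff:
  assumes "v < (c::nat)"
  shows "u = k div c \<and> v = k mod c \<longleftrightarrow> k = u * c + v"
  using assms by (auto simp: div_mult_mod_eq)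

text \<open>Naturality of the swap. Each row and each column of a swap matrix has a single 1, so
  both products collapse to one entry. \<open>K\<close> and \<open>L\<close> may be rectangular,
  which is why two different swaps occur.\<close>

lemma swap_mat_tensor:
  assumes "K \<in> carrier_mat b' b" "L \<in> carrier_mat c' c"
  shows "swap_mat b' c' * (K \<otimes>\<^sub>m L) = (L \<otimes>\<^sub>m K) * swap_mat b c"
proof (rule eq_matI)
  fix i j assume "i < dim_row ((L \<otimes>\<^sub>m K) * swap_mat b c)" "j < dim_col ((L \<otimes>\<^sub>m K) * swap_mat b c)"
  then have i: "i < c' * b'" and j: "j < b * c" using assms by auto
  note bi = div_mod_less_mult[OF i] and bj = div_mod_less_mult[OF j]
  \<comment> \<open>\<open>?k\<close> is the column of the 1 in row \<open>i\<close> of the left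
    swap, \<open>?l\<close> the row of the 1 in column \<open>j\<close> of the right one: the two
    digits exchanged.\<close>
  let ?k = "i mod b' * c' + i div b'" and ?l = "j mod c * b + j div c"
  have k: "?k < b' * c'" and l: "?l < c * b" using bi bj by (auto intro: index_lt_mult)
  have "(swap_mat b' c' * (K \<otimes>\<^sub>m L)) $$ (i, j)
      = (\<Sum>k<b' * c'. swap_mat b' c' $$ (i, k) * (K \<otimes>\<^sub>m L) $$ (k, j))"
    using i j assms by (simp add: scalar_prod_def atLeast0LessThan)
  also have "\<dots> = (\<Sum>k<b' * c'. if k = ?k then (K \<otimes>\<^sub>m L) $$ (k, j) else 0)"
  proof (rule sum.cong)
    fix k assume "k \<in> {..<b' * c'}"
    then have kk: "k < b' * c'" by simp
    have "i div b' = k mod c' \<and> i mod b' = k div c' \<longleftrightarrow> k = ?k"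
      using div_mod_eq_iff[OF bi(1), of "i mod b'" k] by auto
    then show "swap_mat b' c' $$ (i, k) * (K \<otimes>\<^sub>m L) $$ (k, j)
        = (if k = ?k then (K \<otimes>\<^sub>m L) $$ (k, j) else 0)"
      using i kk by (simp add: swap_mat_def)
  qed simp
  also have "\<dots> = (K \<otimes>\<^sub>m L) $$ (?k, j)" using k by simp
  also have "\<dots> = L $$ (i div b', j mod c) * K $$ (i mod b', j div c)"
    using k j bi assms by (simp add: tensor_index)
  also have "\<dots> = (L \<otimes>\<^sub>m K) $$ (i, ?l)"
    using l i bj assms by (simp add: tensor_index)
  also have "\<dots> = (\<Sum>k<c * b. if k = ?l then (L \<otimes>\<^sub>m K) $$ (i, k) else 0)" using l by simp
  also have "\<dots> = (\<Sum>k<c * b. (L \<otimes>\<^sub>m K) $$ (i, k) * swap_mat b c $$ (k, j))"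
  proof (rule sum.cong)
    fix k assume "k \<in> {..<c * b}"
    then have kk: "k < c * b" by simp
    have "k div b = j mod c \<and> k mod b = j div c \<longleftrightarrow> k = ?l"
      using div_mod_eq_iff[OF bj(1), of "j mod c" k] by auto
    then show "(if k = ?l then (L \<otimes>\<^sub>m K) $$ (i, k) else 0)
       = (L \<otimes>\<^sub>m K) $$ (i, k) * swap_mat b c $$ (k, j)"
      using j kk by (simp add: swap_mat_def)
  qed simp
  also have "\<dots> = ((L \<otimes>\<^sub>m K) * swap_mat b c) $$ (i, j)"
    using i j assms by (simp add: scalar_prod_def atLeast0LessThan)
  finally show "(swap_mat b' c' * (K \<otimes>\<^sub>m L)) $$ (i, j) = ((L \<otimes>\<^sub>m K) * swap_mat b c) $$ (i, j)" .
qed (use assms in auto)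

lemma swap_mat_one_left [simp]: "swap_mat (Suc 0) c = 1\<^sub>m c"
  by (rule eq_matI) (auto simp: swap_mat_def)

lemma swap_mat_one_right [simp]: "swap_mat b (Suc 0) = 1\<^sub>m b"
  by (rule eq_matI) (auto simp: swap_mat_def)

lemma mat_adjoint_swap [simp]: "mat_adjoint (swap_mat b c) = swap_mat c b"
  by (rule eq_matI) (auto simp: swap_mat_def)

lemma swap_mat_unitary: "swap_mat c b * swap_mat b c = 1\<^sub>m (b * c)"
proof (rule eq_matI)
  fix i j assume "i < dim_row (1\<^sub>m (b * c) :: complex mat)" "j < dim_col (1\<^sub>m (b * c) :: complex mat)"
  then have i: "i < b * c" and j: "j < b * c" by auto
  note bi = div_mod_less_mult[OF i] and bj = div_mod_less_mult[OF j]
  let ?l = "j mod c * b + j div c"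
  have l: "?l < c * b" using bj by (auto intro: index_lt_mult)
  have "(swap_mat c b * swap_mat b c) $$ (i, j)
      = (\<Sum>k<c * b. swap_mat c b $$ (i, k) * swap_mat b c $$ (k, j))"
    using i j by (simp add: scalar_prod_def atLeast0LessThan)
  also have "\<dots> = (\<Sum>k<c * b. if k = ?l then swap_mat c b $$ (i, k) else 0)"
  proof (rule sum.cong)
    fix k assume "k \<in> {..<c * b}"
    then have kk: "k < c * b" by simp
    have "k div b = j mod c \<and> k mod b = j div c \<longleftrightarrow> k = ?l"
      using div_mod_eq_iff[OF bj(1), of "j mod c" k] by auto
    then show "swap_mat c b $$ (i, k) * swap_mat b c $$ (k, j) = (if k = ?l then swap_mat c b $$ (i, k) else 0)"
      using j kk by (simp add: swap_mat_def)
  qed simp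
  also have "\<dots> = swap_mat c b $$ (i, ?l)" using l by simp
  also have "\<dots> = (if i div c = j div c \<and> i mod c = j mod c then 1 else 0)"
    using i l bj by (simp add: swap_mat_def)
  also have "\<dots> = (if i = j then 1 else 0)" by (metis div_mult_mod_eq)
  finally show "(swap_mat c b * swap_mat b c) $$ (i, j) = (1\<^sub>m (b * c) :: complex mat) $$ (i, j)"
    using i j by simp
qed auto

section \<open>Traces\<close>

lemma tr_add:
  assumes "A \<in> carrier_mat n n" "B \<in> carrier_mat n n"
  shows "tr (A + B) = tr A + tr B"
  using assms by (auto simp: tr_def sum.distrib)

lemma tr_minus:
  assumes "A \<in> carrier_mat n n" "B \<in> carrier_mat n n"
  shows "tr (A - B) = tr A - tr B"
  using assms by (auto simp: tr_def sum_subtractf)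

lemma tr_mult_commute:
  assumes "A \<in> carrier_mat n m" "B \<in> carrier_mat m n"
  shows "tr (A * B) = tr (B * A)"
proof -
  have "tr (A * B) = (\<Sum>i<n. \<Sum>j<m. A $$ (i, j) * B $$ (j, i))"
    using assms by (auto simp: tr_def scalar_prod_def atLeast0LessThan intro!: sum.cong)
  also have "\<dots> = (\<Sum>j<m. \<Sum>i<n. B $$ (j, i) * A $$ (i, j))"
    by (subst sum.swap) (simp add: mult.commute)
  also have "\<dots> = tr (B * A)"
    using assms by (auto simp: tr_def scalar_prod_def atLeast0LessThan intro!: sum.cong)
  finally show ?thesis .
qed

lemma tr_tensor:
  assumes "A \<in> carrier_mat n n" "B \<in> carrier_mat m m"
  shows "tr (A \<otimes>\<^sub>m B) = tr A * tr B"
proof -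
  have "tr (A \<otimes>\<^sub>m B) = (\<Sum>i<n * m. A $$ (i div m, i div m) * B $$ (i mod m, i mod m))"
    using assms by (auto simp: tr_def tensor_index intro!: sum.cong)
  also have "\<dots> = tr A * tr B"
    using assms unfolding sum_lessThan_mult by (simp add: tr_def sum_product)
  finally show ?thesis .
qed

section \<open>Kraus operators\<close>

text \<open>The premises are equations between dimensions instead of carrier memberships: no
  intermediate dimension has to be guessed, so \<open>simp\<close> can reassociate long
  products.\<close>

lemma mult_mat_assoc:
  fixes A B C :: "complex mat"
  assumes "dim_col A = dim_row B" "dim_col B = dim_row C"
  shows "A * B * C = A * (B * C)"
  by (rule assoc_mult_mat) (use assms in auto)

lemma mult_mat_add_left:
  fixes A B C :: "complex mat"
  assumes "dim_col A = dim_row B" "dim_row B = dim_row C" "dim_col B = dim_col C"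
  shows "A * (B + C) = A * B + A * C"
  by (rule mult_add_distrib_mat) (use assms in auto)

lemma mult_mat_add_right:
  fixes A B C :: "complex mat"
  assumes "dim_col A = dim_row C" "dim_row A = dim_row B" "dim_col A = dim_col B"
  shows "(A + B) * C = A * C + B * C"
  by (rule add_mult_distrib_mat) (use assms in auto)

lemma conj_conj:
  fixes L K X :: "complex mat"
  assumes "dim_col L = dim_row K" "dim_col K = dim_row X" "dim_col K = dim_col X"
  shows "L * (K * X * mat_adjoint K) * mat_adjoint L = L * K * X * mat_adjoint (L * K)"
  using assms by (simp add: mat_adjoint_mult mult_mat_assoc)

lemma msum_carrier [simp]: "msum d I f \<in> carrier_mat d d"
  by (simp add: msum_def)

lemma msum_dim [simp]: "dim_row (msum d I f) = d" "dim_col (msum d I f) = d"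
  by (simp_all add: msum_def)

lemma msum_index [simp]:
  "r < d \<Longrightarrow> c < d \<Longrightarrow> msum d I f $$ (r, c) = (\<Sum>i\<in>I. f i $$ (r, c))"
  by (simp add: msum_def)

lemma msum_cong: "(\<And>i. i \<in> I \<Longrightarrow> f i = g i) \<Longrightarrow> msum d I f = msum d I g"
  by (auto simp: msum_def intro!: cong_mat sum.cong)

lemma msum_empty [simp]: "msum d {} f = 0\<^sub>m d d"
  by (rule eq_matI) auto

lemma msum_insert:
  assumes "finite I" "i \<notin> I" "f i \<in> carrier_mat d d"
  shows "msum d (insert i I) f = f i + msum d I f"
  using assms by (intro eq_matI) auto

lemma msum_lessThan_Suc_shift:
  assumes "f 0 \<in> carrier_mat d d"
  shows "msum d {..<Suc n} f = f 0 + msum d {..<n} (\<lambda>i. f (Suc i))"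
  using assms by (intro eq_matI) (auto simp: sum.lessThan_Suc_shift simp del: sum.lessThan_Suc)

lemma mult_msum_mult:
  assumes "finite I" "K \<in> carrier_mat e d" "L \<in> carrier_mat d e"
    and "\<And>i. i \<in> I \<Longrightarrow> f i \<in> carrier_mat d d"
  shows "K * msum d I f * L = msum e I (\<lambda>i. K * f i * L)"
  using assms(1,4)
proof (induction I rule: finite_induct)
  case empty
  then show ?case using assms(2,3) by (simp add: left_mult_zero_mat[OF assms(3)])
next
  case (insert i I)
  have fi: "f i \<in> carrier_mat d d" using insert by simp
  have "K * msum d (insert i I) f * L = (K * f i + K * msum d I f) * L"
    using insert fi assms by (simp add: msum_insert mult_add_distrib_mat[of _ _ d _ d])
  also have "\<dots> = K * f i * L + K * msum d I f * L"
    using fi assms by (intro add_mult_distrib_mat[of _ e d]) auto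
  also have "\<dots> = msum e (insert i I) (\<lambda>i. K * f i * L)"
    using insert fi assms by (subst msum_insert) auto
  finally show ?case .
qed

lemma tr_msum: "tr (msum d I f) = (\<Sum>i\<in>I. \<Sum>r<d. f i $$ (r, r))"
  by (simp add: tr_def sum.swap[of _ _ I])

lemma kraus_map_carrier [simp]: "kraus_map d' Ks X \<in> carrier_mat d' d'"
  by (simp add: kraus_map_def)

lemma kraus_map_dim [simp]:
  "dim_row (kraus_map d' Ks X) = d'" "dim_col (kraus_map d' Ks X) = d'"
  by (simp_all add: kraus_map_def)

lemma kraus_map_Nil [simp]: "kraus_map d' [] X = 0\<^sub>m d' d'"
  by (simp add: kraus_map_def)

lemma kraus_map_Cons:
  assumes "K \<in> carrier_mat d' d"
  shows "kraus_map d' (K # Ks) X = K * X * mat_adjoint K + kraus_map d' Ks X"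
  using assms unfolding kraus_map_def length_Cons
  by (subst msum_lessThan_Suc_shift) auto

lemma kraus_map_append:
  assumes "set Ks \<subseteq> carrier_mat d' d" "X \<in> carrier_mat d d"
  shows "kraus_map d' (Ks @ Ls) X = kraus_map d' Ks X + kraus_map d' Ls X"
  using assms(1)
proof (induction Ks)
  case (Cons K Ks)
  then have K: "K \<in> carrier_mat d' d" by simp
  have "K * X * mat_adjoint K \<in> carrier_mat d' d'" using K assms(2) by auto
  with Cons show ?case
    by (simp add: kraus_map_Cons[OF K] assoc_add_mat[of _ d' d'])
qed simp

lemma kraus_map_add:
  assumes "set Ks \<subseteq> carrier_mat d' d" "X \<in> carrier_mat d d" "Y \<in> carrier_mat d d"
  shows "kraus_map d' Ks (X + Y) = kraus_map d' Ks X + kraus_map d' Ks Y"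
  using assms(1)
proof (induction Ks)
  case (Cons K Ks)
  then have K: "K \<in> carrier_mat d' d" by simp
  have c: "K * Z * mat_adjoint K \<in> carrier_mat d' d'" if "Z \<in> carrier_mat d d" for Z
    using K that by auto
  have e: "K * (X + Y) * mat_adjoint K = K * X * mat_adjoint K + K * Y * mat_adjoint K"
    using K assms by (simp add: mult_mat_add_left mult_mat_add_right)
  show ?case
    using Cons c[OF assms(2)] c[OF assms(3)]
    unfolding kraus_map_Cons[OF K] e
    by (intro eq_matI) auto
qed simp

lemma kraus_map_zero:
  assumes "set Ks \<subseteq> carrier_mat d' d"
  shows "kraus_map d' Ks (0\<^sub>m d d) = 0\<^sub>m d' d'"
  using assms
proof (induction Ks)
  case (Cons K Ks)
  then have K: "K \<in> carrier_mat d' d" by simp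
  show ?case
    using Cons K by (simp add: kraus_map_Cons[OF K] left_mult_zero_mat[of _ d])
qed simp

lemma kraus_map_msum:
  assumes "finite I" "set Ks \<subseteq> carrier_mat d' d" "\<And>i. i \<in> I \<Longrightarrow> f i \<in> carrier_mat d d"
  shows "kraus_map d' Ks (msum d I f) = msum d' I (\<lambda>i. kraus_map d' Ks (f i))"
  using assms(1,3)
  by (induction I rule: finite_induct)
    (auto simp: kraus_map_zero[OF assms(2)] msum_insert kraus_map_add[OF assms(2)])

lemma kraus_map_conj:
  assumes "set Ks \<subseteq> carrier_mat e d" "K \<in> carrier_mat d d'" "X \<in> carrier_mat d' d'"
  shows "kraus_map e Ks (K * X * mat_adjoint K) = kraus_map e (map (\<lambda>L. L * K) Ks) X"
  using assms(1)
proof (induction Ks)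
  case (Cons L Ks)
  then have L: "L \<in> carrier_mat e d" by simp
  have "L * (K * X * mat_adjoint K) * mat_adjoint L = L * K * X * mat_adjoint (L * K)"
    using L assms by (intro conj_conj) auto
  with Cons L assms show ?case
    by (simp add: kraus_map_Cons[OF L] kraus_map_Cons[of "L * K" e d'])
qed simp

lemma conj_kraus_map:
  assumes "set Ks \<subseteq> carrier_mat d' d" "K \<in> carrier_mat e d'" "X \<in> carrier_mat d d"
  shows "K * kraus_map d' Ks X * mat_adjoint K = kraus_map e (map (\<lambda>L. K * L) Ks) X"
  using assms(1)
proof (induction Ks)
  case Nil
  then show ?case using assms by (simp add: left_mult_zero_mat[of _ d'])
next
  case (Cons L Ks)
  then have L: "L \<in> carrier_mat d' d" by simp
  have "K * (L * X * mat_adjoint L) * mat_adjoint K = K * L * X * mat_adjoint (K * L)"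
    using L assms by (intro conj_conj) auto
  then show ?case
    using Cons carrier_matD[OF L] carrier_matD[OF assms(2)]
      kraus_map_Cons[OF mult_carrier_mat[OF assms(2) L], of "map ((*) K) Ks" X]
    by (simp add: kraus_map_Cons[OF L] mult_mat_add_left mult_mat_add_right)
qed

definition kraus_comp :: "complex mat list \<Rightarrow> complex mat list \<Rightarrow> complex mat list" where
  "kraus_comp Ls Ks = concat (map (\<lambda>K. map (\<lambda>L. L * K) Ls) Ks)"

lemma set_kraus_comp: "set (kraus_comp Ls Ks) = {L * K | L K. L \<in> set Ls \<and> K \<in> set Ks}"
  by (auto simp: kraus_comp_def)

lemma kraus_map_kraus_comp:
  assumes "set Ls \<subseteq> carrier_mat e d'" "set Ks \<subseteq> carrier_mat d' d" "X \<in> carrier_mat d d"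
  shows "kraus_map e (kraus_comp Ls Ks) X = kraus_map e Ls (kraus_map d' Ks X)"
  using assms(2)
proof (induction Ks)
  case Nil
  then show ?case by (simp add: kraus_comp_def kraus_map_zero[OF assms(1)])
next
  case (Cons K Ks)
  then have K: "K \<in> carrier_mat d' d" by simp
  have "K * X * mat_adjoint K \<in> carrier_mat d' d'" using K assms(3) by auto
  moreover have "set (map (\<lambda>L. L * K) Ls) \<subseteq> carrier_mat e d" using K assms(1) by auto
  ultimately show ?case
    using Cons
    by (simp add: kraus_comp_def kraus_map_append[of _ e d] assms kraus_map_Cons[OF K]
        kraus_map_add[OF assms(1)] kraus_map_conj[OF assms(1) K])
qed

lemma kraus_map_concat:
  assumes "\<And>i. i < n \<Longrightarrow> set (Ls i) \<subseteq> carrier_mat d' d" "X \<in> carrier_mat d d"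
  shows "kraus_map d' (concat (map Ls [0..<n])) X = msum d' {..<n} (\<lambda>i. kraus_map d' (Ls i) X)"
  using assms(1)
proof (induction n)
  case (Suc n)
  have "set (concat (map Ls [0..<n])) \<subseteq> carrier_mat d' d"
    using Suc.prems by (simp add: UN_subset_iff)
  moreover have "kraus_map d' (concat (map Ls [0..<n])) X = msum d' {..<n} (\<lambda>i. kraus_map d' (Ls i) X)"
    using Suc.prems by (intro Suc.IH) simp
  ultimately show ?case
    by (simp add: kraus_map_append[OF _ assms(2)] lessThan_Suc msum_insert comm_add_mat[of _ d' d'])
qed simp

text \<open>The image of the identity under the adjoint (Heisenberg) map.
  \<open>gram d Ks = 1\<^sub>m d\<close> is trace preservation; for the Kraus operators of one
  outcome, it is the effect belonging to that outcome.\<close>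

definition gram :: "nat \<Rightarrow> complex mat list \<Rightarrow> complex mat" where
  "gram d Ks = msum d {..<length Ks} (\<lambda>k. mat_adjoint (Ks ! k) * (Ks ! k))"

lemma instrument_iff_gram:
  "instrument d Es \<longleftrightarrow> (\<forall>(d', Ks) \<in> set Es. 0 < d' \<and> set Ks \<subseteq> carrier_mat d' d)
    \<and> gram d (concat (map snd Es)) = 1\<^sub>m d"
  by (simp add: instrument_def gram_def Let_def)

lemma gram_eq_kraus_map:
  assumes "set Ks \<subseteq> carrier_mat e d"
  shows "gram d Ks = kraus_map d (map mat_adjoint Ks) (1\<^sub>m e)"
  unfolding gram_def kraus_map_def length_map
proof (rule msum_cong)
  fix i assume "i \<in> {..<length Ks}"
  then have "Ks ! i \<in> carrier_mat e d" using assms by auto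
  then show "mat_adjoint (Ks ! i) * Ks ! i = map mat_adjoint Ks ! i * 1\<^sub>m e * mat_adjoint (map mat_adjoint Ks ! i)"
    using \<open>i \<in> _\<close> by (simp add: right_mult_one_mat[of _ d e])
qed

lemma gram_carrier [simp]: "gram d Ks \<in> carrier_mat d d"
  by (simp add: gram_def)

lemma gram_dim [simp]: "dim_row (gram d Ks) = d" "dim_col (gram d Ks) = d"
  by (simp_all add: gram_def)

lemma gram_Nil [simp]: "gram d [] = 0\<^sub>m d d"
  by (simp add: gram_def)

lemma gram_Cons:
  assumes "K \<in> carrier_mat e d"
  shows "gram d (K # Ks) = mat_adjoint K * K + gram d Ks"
  using assms unfolding gram_def length_Cons by (subst msum_lessThan_Suc_shift) auto

lemma gram_append:
  assumes "\<And>K. K \<in> set Ks \<Longrightarrow> dim_col K = d"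
  shows "gram d (Ks @ Ls) = gram d Ks + gram d Ls"
  using assms
proof (induction Ks)
  case (Cons K Ks)
  obtain e where K: "K \<in> carrier_mat e d" using Cons.prems by (intro that[of "dim_row K"]) auto
  then have "mat_adjoint K * K \<in> carrier_mat d d" by auto
  with Cons show ?case
    by (simp add: gram_Cons[OF K] assoc_add_mat[of _ d d])
qed simp

lemma gram_concat:
  assumes "\<And>i K. i < n \<Longrightarrow> K \<in> set (Ls i) \<Longrightarrow> dim_col K = d"
  shows "gram d (concat (map Ls [0..<n])) = msum d {..<n} (\<lambda>i. gram d (Ls i))"
  using assms
proof (induction n)
  case (Suc n)
  have lt: "dim_col K = d" if "i < n" "K \<in> set (Ls i)" for i K
    using Suc.prems[of i K] that by simp
  have "gram d (concat (map Ls [0..<n]) @ Ls n) = gram d (concat (map Ls [0..<n])) + gram d (Ls n)"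
    by (rule gram_append) (auto dest: lt)
  moreover have "gram d (concat (map Ls [0..<n])) = msum d {..<n} (\<lambda>i. gram d (Ls i))"
    using lt by (rule Suc.IH)
  ultimately show ?case
    by (simp add: lessThan_Suc msum_insert comm_add_mat[of _ d d])
qed simp

lemma gram_map_mult_right:
  assumes "set Ls \<subseteq> carrier_mat e d'" "K \<in> carrier_mat d' d"
  shows "gram d (map (\<lambda>L. L * K) Ls) = mat_adjoint K * gram d' Ls * K"
  using assms(1)
proof (induction Ls)
  case Nil
  then show ?case using assms by (simp add: right_mult_zero_mat[of _ d d'] left_mult_zero_mat[of _ d'])
next
  case (Cons L Ls)
  then have L: "L \<in> carrier_mat e d'" by simp
  have LK: "L * K \<in> carrier_mat e d" using L assms by auto
  have "mat_adjoint (L * K) * (L * K) = mat_adjoint K * (mat_adjoint L * L) * K"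
    using L assms by (simp add: mat_adjoint_mult mult_mat_assoc)
  then show ?case
    using Cons L assms
    by (simp add: gram_Cons[OF L] gram_Cons[OF LK]
        mult_mat_add_left mult_mat_add_right)
qed

text \<open>A trace-preserving map applied afterwards drops out: the sum of
  \<open>K^* L^* L K\<close> over all \<open>L\<close> is \<open>K^* K\<close>.\<close>

lemma gram_kraus_comp:
  assumes "set Ls \<subseteq> carrier_mat e d'" "gram d' Ls = 1\<^sub>m d'" "set Ks \<subseteq> carrier_mat d' d"
  shows "gram d (kraus_comp Ls Ks) = gram d Ks"
  using assms(3)
proof (induction Ks)
  case (Cons K Ks)
  then have K: "K \<in> carrier_mat d' d" by simp
  have "gram d (map (\<lambda>L. L * K) Ls @ kraus_comp Ls Ks)
      = gram d (map (\<lambda>L. L * K) Ls) + gram d (kraus_comp Ls Ks)"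
    by (rule gram_append) (use K in auto)
  with Cons K show ?case
    by (simp add: kraus_comp_def gram_map_mult_right[OF assms(1) K] assms(2) gram_Cons[OF K]
        right_mult_one_mat[of _ d d'])
qed (simp add: kraus_comp_def)

lemma tr_kraus_map:
  assumes "set Ks \<subseteq> carrier_mat d' d" "X \<in> carrier_mat d d"
  shows "tr (kraus_map d' Ks X) = tr (gram d Ks * X)"
  using assms(1)
proof (induction Ks)
  case Nil
  then show ?case using assms by (simp add: tr_def left_mult_zero_mat[of _ d])
next
  case (Cons K Ks)
  then have K: "K \<in> carrier_mat d' d" by simp
  have "tr (K * X * mat_adjoint K) = tr (mat_adjoint K * (K * X))"
    using K assms by (intro tr_mult_commute[of _ d' d]) auto
  also have "\<dots> = tr (mat_adjoint K * K * X)"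
    using K assms by (simp add: assoc_mult_mat[of _ d d' _ d])
  finally have e: "tr (K * X * mat_adjoint K) = tr (mat_adjoint K * K * X)" .
  have c: "mat_adjoint K * K \<in> carrier_mat d d" "K * X * mat_adjoint K \<in> carrier_mat d' d'"
    using K assms by auto
  have "tr (kraus_map d' (K # Ks) X) = tr (mat_adjoint K * K * X) + tr (gram d Ks * X)"
    using Cons c by (simp add: kraus_map_Cons[OF K] tr_add[of _ d'] e)
  also have "\<dots> = tr (mat_adjoint K * K * X + gram d Ks * X)"
    using c assms by (intro tr_add[symmetric, of _ d]) auto
  also have "\<dots> = tr (gram d (K # Ks) * X)"
    using c assms by (simp add: gram_Cons[OF K] add_mult_distrib_mat[of _ d d _ _ d])
  finally show ?case .
qed

section \<open>Operators acting on one party\<close>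

lemma prod_list_split:
  assumes "p < length (ds :: nat list)"
  shows "prod_list ds = prod_list (take p ds) * ds ! p * prod_list (drop (Suc p) ds)"
  by (subst id_take_nth_drop[OF assms]) (simp add: mult.assoc)

lemma prod_list_update:
  assumes "p < length (ds :: nat list)"
  shows "prod_list (ds[p := d]) = prod_list (take p ds) * d * prod_list (drop (Suc p) ds)"
  using assms by (simp add: upd_conv_take_nth_drop mult.assoc)

lemma on_party_carrier:
  assumes "p < length ds" "L \<in> carrier_mat d' (ds ! p)"
  shows "on_party ds p L \<in> carrier_mat (prod_list (ds[p := d'])) (prod_list ds)"
  using assms unfolding on_party_def prod_list_update[OF assms(1)] prod_list_split[OF assms(1)]
  by (intro tensor_carrier) auto

lemma gram_tensor_one:
  assumes "set Ks \<subseteq> carrier_mat d' d"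
  shows "gram (d * b) (map (\<lambda>K. K \<otimes>\<^sub>m 1\<^sub>m b) Ks) = gram d Ks \<otimes>\<^sub>m 1\<^sub>m b"
  using assms
proof (induction Ks)
  case (Cons K Ks)
  then have K: "K \<in> carrier_mat d' d" by simp
  have "mat_adjoint K * K \<in> carrier_mat d d" using K by auto
  moreover have "K \<otimes>\<^sub>m 1\<^sub>m b \<in> carrier_mat (d' * b) (d * b)" using K by auto
  ultimately show ?case
    using Cons K by (simp add: gram_Cons[of _ "d' * b" "d * b"] gram_Cons[OF K] tensor_add_left[of _ d d]
        mat_adjoint_tensor tensor_mult)
qed simp

lemma gram_one_tensor:
  assumes "set Ks \<subseteq> carrier_mat d' d"
  shows "gram (a * d) (map (\<lambda>K. 1\<^sub>m a \<otimes>\<^sub>m K) Ks) = 1\<^sub>m a \<otimes>\<^sub>m gram d Ks"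
  using assms
proof (induction Ks)
  case (Cons K Ks)
  then have K: "K \<in> carrier_mat d' d" by simp
  have "mat_adjoint K * K \<in> carrier_mat d d" using K by auto
  moreover have "1\<^sub>m a \<otimes>\<^sub>m K \<in> carrier_mat (a * d') (a * d)" using K by auto
  ultimately show ?case
    using Cons K by (simp add: gram_Cons[of _ "a * d'" "a * d"] gram_Cons[OF K] tensor_add_right[of _ d d]
        mat_adjoint_tensor tensor_mult)
qed simp

text \<open>Turns the normalisation of a local instrument into that of its extension to all parties.
  Only the column dimension is fixed, because the outcomes of an instrument may have different
  output dimensions.\<close>

lemma gram_on_party:
  assumes p: "p < length ds"
    and Ks: "\<And>K. K \<in> set Ks \<Longrightarrow> dim_col K = ds ! p"
  shows "gram (prod_list ds) (map (on_party ds p) Ks)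
    = 1\<^sub>m (prod_list (take p ds)) \<otimes>\<^sub>m gram (ds ! p) Ks \<otimes>\<^sub>m 1\<^sub>m (prod_list (drop (Suc p) ds))"
  using Ks
proof (induction Ks)
  case Nil
  then show ?case by (simp add: prod_list_split[OF p])
next
  case (Cons K Ks)
  let ?t = "prod_list (take p ds)" and ?d = "prod_list (drop (Suc p) ds)" and ?n = "ds ! p"
  obtain e where K: "K \<in> carrier_mat e ?n" using Cons.prems by (intro that[of "dim_row K"]) auto
  have c: "mat_adjoint K * K \<in> carrier_mat ?n ?n" using K by auto
  have "mat_adjoint (on_party ds p K) * on_party ds p K = 1\<^sub>m ?t \<otimes>\<^sub>m (mat_adjoint K * K) \<otimes>\<^sub>m 1\<^sub>m ?d"
    using K by (simp add: on_party_def mat_adjoint_tensor tensor_mult)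
  then show ?case
    using Cons c
    by (simp add: gram_Cons[OF on_party_carrier[OF p K]] gram_Cons[OF K] tensor_add_right[of _ ?n ?n]
        tensor_add_left[of _ "?t * ?n" "?t * ?n"])
qed

section \<open>Kraus operators of LOCC protocols\<close>

text \<open>The Kraus operators of a single branch of a protocol, with the communication forgotten.
  As in \<open>locc\<close>, the first step is peeled off, so it stands rightmost in the
  product.\<close>

inductive local_op :: "nat list \<Rightarrow> nat list \<Rightarrow> complex mat \<Rightarrow> bool" where
  local_op_one: "local_op ds ds (1\<^sub>m (prod_list ds))"
| local_op_step:
    "\<lbrakk> p < length ds; L \<in> carrier_mat d' (ds ! p); local_op (ds[p := d']) ds' K \<rbrakk>
     \<Longrightarrow> local_op ds ds' (K * on_party ds p L)"

lemma local_op_carrier: "local_op ds ds' K \<Longrightarrow> K \<in> carrier_mat (prod_list ds') (prod_list ds)"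
  by (induction rule: local_op.induct) (auto dest: on_party_carrier)

lemma local_map_carrier [simp]:
  "local_map ds p E X \<in> carrier_mat (prod_list (ds[p := fst E])) (prod_list (ds[p := fst E]))"
  by (simp add: local_map_def)

lemma instrument_nth:
  assumes "instrument d Es" "i < length Es"
  shows "0 < fst (Es ! i)" "set (snd (Es ! i)) \<subseteq> carrier_mat (fst (Es ! i)) d"
  using assms nth_mem[OF assms(2)] by (auto simp: instrument_def case_prod_beta)

lemma instrument_dim_col:
  assumes "instrument d Es" "(d', Ks) \<in> set Es" "K \<in> set Ks"
  shows "dim_col K = d"
proof -
  have "K \<in> carrier_mat d' d" using assms unfolding instrument_def by blast
  then show ?thesis by simp
qed

lemma concat_map_snd_nth: "concat (map (\<lambda>i. f (snd (Es ! i))) [0..<length Es]) = concat (map (\<lambda>E. f (snd E)) Es)"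
proof -
  have "map (\<lambda>i. f (snd (Es ! i))) [0..<length Es] = map (\<lambda>E. f (snd E)) Es"
    by (rule nth_equalityI) auto
  then show ?thesis by simp
qed

text \<open>Linearity, trace preservation and the action on separable states are all drawn from this
  form, since \<open>locc\<close> itself only speaks of functions on matrices.\<close>

lemma locc_kraus:
  assumes "locc S ds ds' \<Lambda>"
  shows "\<exists>Ks. (\<forall>K\<in>set Ks. local_op ds ds' K) \<and> gram (prod_list ds) Ks = 1\<^sub>m (prod_list ds)
    \<and> (\<forall>X\<in>carrier_mat (prod_list ds) (prod_list ds). \<Lambda> X = kraus_map (prod_list ds') Ks X)"
  using assms
proof (induction rule: locc.induct)
  case (locc_done ds)
  let ?d = "prod_list ds"
  have 1: "1\<^sub>m ?d \<in> carrier_mat ?d ?d" by simp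
  show ?case
    by (rule exI[of _ "[1\<^sub>m ?d]"])
      (auto simp: local_op_one gram_Cons[OF 1] kraus_map_Cons[OF 1] right_mult_one_mat[of _ ?d ?d]
        left_mult_one_mat[of _ ?d ?d])
next
  case (locc_step p ds Es ds' \<Lambda>)
  let ?n = "length Es" and ?d = "prod_list ds" and ?d' = "prod_list ds'"
  let ?ds = "\<lambda>i. ds[p := fst (Es ! i)]" and ?L = "\<lambda>i. map (on_party ds p) (snd (Es ! i))"
  note p = locc_step(1) and inst = locc_step(2)
  obtain Kss where Kss: "\<And>i. i < ?n \<Longrightarrow> (\<forall>K\<in>set (Kss i). local_op (?ds i) ds' K)
      \<and> gram (prod_list (?ds i)) (Kss i) = 1\<^sub>m (prod_list (?ds i))
      \<and> (\<forall>X\<in>carrier_mat (prod_list (?ds i)) (prod_list (?ds i)). \<Lambda> i X = kraus_map ?d' (Kss i) X)"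
    using locc_step(4) by metis
  have Kc: "set (Kss i) \<subseteq> carrier_mat ?d' (prod_list (?ds i))" if "i < ?n" for i
    using Kss[OF that] local_op_carrier by blast
  have Lc: "set (?L i) \<subseteq> carrier_mat (prod_list (?ds i)) ?d" if "i < ?n" for i
    using instrument_nth(2)[OF inst that] on_party_carrier[OF p] by auto
  have Cc: "set (kraus_comp (Kss i) (?L i)) \<subseteq> carrier_mat ?d' ?d" if "i < ?n" for i
    using Kc[OF that] Lc[OF that] by (force simp: set_kraus_comp)
  \<comment> \<open>In branch \<open>i\<close> the instrument's operators for outcome
    \<open>i\<close> act first, then those of the rest of the protocol.\<close>
  define Ks where "Ks = concat (map (\<lambda>i. kraus_comp (Kss i) (?L i)) [0..<?n])"
  have "local_op ds ds' K" if KKs: "K \<in> set Ks" for K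
  proof -
    obtain i M L where i: "i < ?n" and M: "M \<in> set (Kss i)" and L: "L \<in> set (snd (Es ! i))"
      and K: "K = M * on_party ds p L"
      using KKs by (auto simp: Ks_def set_kraus_comp)
    have "L \<in> carrier_mat (fst (Es ! i)) (ds ! p)" using instrument_nth(2)[OF inst i] L by auto
    moreover have "local_op (?ds i) ds' M" using Kss[OF i] M by auto
    ultimately show ?thesis using p K by (auto intro: local_op_step)
  qed
  moreover have "gram ?d Ks = 1\<^sub>m ?d"
  proof -
    have "gram ?d Ks = msum ?d {..<?n} (\<lambda>i. gram ?d (kraus_comp (Kss i) (?L i)))"
      unfolding Ks_def using Cc by (intro gram_concat) blast
    \<comment> \<open>The rest of the protocol preserves the trace in each branch, so only the first
      instrument is left.\<close>
    also have "\<dots> = msum ?d {..<?n} (\<lambda>i. gram ?d (?L i))"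
      using Kss by (intro msum_cong) (auto intro!: gram_kraus_comp[OF Kc _ Lc])
    also have "\<dots> = gram ?d (concat (map ?L [0..<?n]))"
      using Lc by (intro gram_concat[symmetric]) blast
    also have "concat (map ?L [0..<?n]) = map (on_party ds p) (concat (map snd Es))"
      by (simp add: concat_map_snd_nth[of "map (on_party ds p)"] map_concat comp_def)
    also have "gram ?d \<dots> = 1\<^sub>m ?d"
      using inst
      by (subst gram_on_party[OF p])
        (auto simp: instrument_iff_gram prod_list_split[OF p] dest: instrument_dim_col[OF inst])
    finally show ?thesis .
  qed
  moreover have "msum ?d' {..<?n} (\<lambda>i. \<Lambda> i (local_map ds p (Es ! i) X)) = kraus_map ?d' Ks X"
    if X: "X \<in> carrier_mat ?d ?d" for X
  proof -
    have "kraus_map ?d' Ks X = msum ?d' {..<?n} (\<lambda>i. kraus_map ?d' (kraus_comp (Kss i) (?L i)) X)"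
      unfolding Ks_def using Cc X by (intro kraus_map_concat) blast
    also have "\<dots> = msum ?d' {..<?n} (\<lambda>i. \<Lambda> i (local_map ds p (Es ! i) X))"
      using Kss by (intro msum_cong) (auto simp: kraus_map_kraus_comp[OF Kc Lc X] local_map_def)
    finally show ?thesis by simp
  qed
  ultimately show ?case by blast
qed

lemma on_party_three:
  "on_party [a, c, b] 0 L = L \<otimes>\<^sub>m 1\<^sub>m c \<otimes>\<^sub>m 1\<^sub>m b"
  "on_party [a, c, b] (Suc 0) L = 1\<^sub>m a \<otimes>\<^sub>m L \<otimes>\<^sub>m 1\<^sub>m b"
  "on_party [a, c, b] 2 L = 1\<^sub>m a \<otimes>\<^sub>m 1\<^sub>m c \<otimes>\<^sub>m L"
  by (simp_all add: on_party_def tensor_assoc numeral_2_eq_2)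

text \<open>Each step multiplies a single tensor factor. The input dimensions are generalised in the
  induction since a step may change that of the acting party, while the output dimensions stay
  fixed.\<close>

lemma local_op_three:
  assumes "local_op ds ds' K" "ds = [a, c, b]" "ds' = [a', c', b']"
  shows "\<exists>A\<in>carrier_mat a' a. \<exists>C\<in>carrier_mat c' c. \<exists>B\<in>carrier_mat b' b. K = A \<otimes>\<^sub>m C \<otimes>\<^sub>m B"
  using assms
proof (induction arbitrary: a c b rule: local_op.induct)
  case (local_op_one ds)
  then show ?case
    by (intro bexI[of _ "1\<^sub>m a"] bexI[of _ "1\<^sub>m c"] bexI[of _ "1\<^sub>m b"]) (auto simp: mult.assoc)
next
  case (local_op_step p ds L d' ds' K)
  note ds = local_op_step.prems(1)
  have "p = 0 \<or> p = Suc 0 \<or> p = 2" using local_op_step(1) ds by auto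
  then show ?case
  proof (elim disjE)
    assume p: "p = 0"
    have L: "L \<in> carrier_mat d' a" using local_op_step(2) ds p by simp
    obtain A C B where K: "A \<in> carrier_mat a' d'" "C \<in> carrier_mat c' c" "B \<in> carrier_mat b' b"
        "K = A \<otimes>\<^sub>m C \<otimes>\<^sub>m B"
      using local_op_step.IH[of d' c b] local_op_step.prems p by auto
    have "K * on_party ds p L = (A * L) \<otimes>\<^sub>m C \<otimes>\<^sub>m B"
      using K L by (simp add: ds p on_party_three tensor_mult right_mult_one_mat[of _ c' c]
          right_mult_one_mat[of _ b' b])
    then show ?thesis using K L by (intro bexI[of _ "A * L"] bexI[of _ C] bexI[of _ B]) auto
  next
    assume p: "p = Suc 0"
    have L: "L \<in> carrier_mat d' c" using local_op_step(2) ds p by simp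
    obtain A C B where K: "A \<in> carrier_mat a' a" "C \<in> carrier_mat c' d'" "B \<in> carrier_mat b' b"
        "K = A \<otimes>\<^sub>m C \<otimes>\<^sub>m B"
      using local_op_step.IH[of a d' b] local_op_step.prems p by auto
    have "K * on_party ds p L = A \<otimes>\<^sub>m (C * L) \<otimes>\<^sub>m B"
      using K L by (simp add: ds p on_party_three tensor_mult right_mult_one_mat[of _ a' a]
          right_mult_one_mat[of _ b' b])
    then show ?thesis using K L by (intro bexI[of _ A] bexI[of _ "C * L"] bexI[of _ B]) auto
  next
    assume p: "p = 2"
    have L: "L \<in> carrier_mat d' b" using local_op_step(2) ds p by simp
    obtain A C B where K: "A \<in> carrier_mat a' a" "C \<in> carrier_mat c' c" "B \<in> carrier_mat b' d'"
        "K = A \<otimes>\<^sub>m C \<otimes>\<^sub>m B"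
      using local_op_step.IH[of a c d'] local_op_step.prems p by auto
    have "K * on_party ds p L = A \<otimes>\<^sub>m C \<otimes>\<^sub>m (B * L)"
      using K L by (simp add: ds p on_party_three tensor_mult right_mult_one_mat[of _ a' a]
          right_mult_one_mat[of _ c' c] del: one_tensor_one)
    then show ?thesis using K L by (intro bexI[of _ A] bexI[of _ C] bexI[of _ "B * L"]) auto
  qed
qed

section \<open>Frobenius norm\<close>

text \<open>The Hilbert-Schmidt norm. For a state \<open>Y Y^*\<close>, the trace of
  \<open>K Y Y^* K^*\<close> is the square of \<open>fnorm (K * Y)\<close>, so probabilities become
  squared norms.\<close>

definition fnorm :: "complex mat \<Rightarrow> real" where
  "fnorm X = L2_set (\<lambda>(i, j). cmod (X $$ (i, j))) ({..<dim_row X} \<times> {..<dim_col X})"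

lemma fnorm_nonneg [simp]: "0 \<le> fnorm X"
  by (simp add: fnorm_def)

lemma fnorm_power2: "(fnorm X)\<^sup>2 = (\<Sum>i<dim_row X. \<Sum>j<dim_col X. (cmod (X $$ (i, j)))\<^sup>2)"
  by (simp add: fnorm_def L2_set_def sum_nonneg case_prod_beta sum.cartesian_product)

lemma tr_adjoint_mult:
  assumes "A \<in> carrier_mat n m" "B \<in> carrier_mat n m"
  shows "tr (mat_adjoint A * B) = (\<Sum>i<n. \<Sum>j<m. cnj (A $$ (i, j)) * B $$ (i, j))"
proof -
  have "tr (mat_adjoint A * B) = (\<Sum>j<m. \<Sum>i<n. cnj (A $$ (i, j)) * B $$ (i, j))"
    using assms by (auto simp: tr_def scalar_prod_def atLeast0LessThan intro!: sum.cong)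
  then show ?thesis by (simp add: sum.swap[of _ "{..<n}"])
qed

lemma tr_adjoint_mult_self: "tr (mat_adjoint A * A) = complex_of_real ((fnorm A)\<^sup>2)"
proof -
  have "tr (mat_adjoint A * A)
      = (\<Sum>i<dim_row A. \<Sum>j<dim_col A. cnj (A $$ (i, j)) * A $$ (i, j))"
    by (rule tr_adjoint_mult) auto
  also have "\<dots> = complex_of_real ((fnorm A)\<^sup>2)"
    by (simp only: fnorm_power2 of_real_sum)
      (intro sum.cong refl, metis complex_norm_square mult.commute)
  finally show ?thesis .
qed

lemma tr_mult_adjoint_self: "tr (A * mat_adjoint A) = complex_of_real ((fnorm A)\<^sup>2)"
proof -
  have "tr (A * mat_adjoint A) = tr (mat_adjoint A * A)"
    by (rule tr_mult_commute[of _ "dim_row A" "dim_col A"]) auto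
  then show ?thesis by (simp add: tr_adjoint_mult_self)
qed

text \<open>Cauchy-Schwarz for the Hilbert-Schmidt inner product.\<close>

lemma cmod_tr_adjoint_mult_le:
  assumes "A \<in> carrier_mat n m" "B \<in> carrier_mat n m"
  shows "cmod (tr (mat_adjoint A * B)) \<le> fnorm A * fnorm B"
proof -
  let ?I = "{..<n} \<times> {..<m}"
  have "cmod (tr (mat_adjoint A * B)) = cmod (\<Sum>(i, j)\<in>?I. cnj (A $$ (i, j)) * B $$ (i, j))"
    by (simp add: tr_adjoint_mult[OF assms] sum.cartesian_product)
  also have "\<dots> \<le> (\<Sum>x\<in>?I. \<bar>(\<lambda>(i, j). cmod (A $$ (i, j))) x\<bar> * \<bar>(\<lambda>(i, j). cmod (B $$ (i, j))) x\<bar>)"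
    by (rule sum_norm_le) (auto simp: norm_mult)
  also have "\<dots> \<le> fnorm A * fnorm B"
    using L2_set_mult_ineq[of "\<lambda>(i, j). cmod (A $$ (i, j))" "\<lambda>(i, j). cmod (B $$ (i, j))" ?I] assms
    by (simp add: fnorm_def)
  finally show ?thesis .
qed

lemma fnorm_mult_isometry:
  assumes "mat_adjoint U * U = 1\<^sub>m n" "dim_col U = n" "dim_row X = n"
  shows "fnorm (U * X) = fnorm X"
proof -
  have "mat_adjoint (U * X) * (U * X) = mat_adjoint X * (mat_adjoint U * U * X)"
    using assms(2,3) by (simp add: mat_adjoint_mult mult_mat_assoc)
  also have "\<dots> = mat_adjoint X * X"
    using assms by (simp add: left_mult_one_mat[of _ n "dim_col X"])
  finally have "(fnorm (U * X))\<^sup>2 = (fnorm X)\<^sup>2"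
    by (metis tr_adjoint_mult_self of_real_eq_iff)
  then show ?thesis by simp
qed

lemma fnorm_tensor: "fnorm (A \<otimes>\<^sub>m B) = fnorm A * fnorm B"
proof -
  have "complex_of_real ((fnorm (A \<otimes>\<^sub>m B))\<^sup>2) = complex_of_real ((fnorm A * fnorm B)\<^sup>2)"
    by (simp only: tr_adjoint_mult_self[symmetric] mat_adjoint_tensor power_mult_distrib of_real_mult)
      (simp add: tensor_mult, intro tr_tensor[of _ "dim_col A" _ "dim_col B"], auto)
  then show ?thesis by (simp only: of_real_eq_iff power2_eq_iff_nonneg fnorm_nonneg mult_nonneg_nonneg)
qed

lemma fnorm_smult: "fnorm (c \<cdot>\<^sub>m A) = cmod c * fnorm A"
proof -
  have "(fnorm (c \<cdot>\<^sub>m A))\<^sup>2 = (cmod c * fnorm A)\<^sup>2"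
    by (simp add: fnorm_power2 norm_mult power_mult_distrib sum_distrib_left)
  then show ?thesis by (simp only: power2_eq_iff_nonneg fnorm_nonneg mult_nonneg_nonneg norm_ge_zero)
qed

lemma tr_kraus_map_gram:
  assumes "set Ks \<subseteq> carrier_mat d' d" "Y \<in> carrier_mat d k"
  shows "tr (kraus_map d' Ks (Y * mat_adjoint Y)) = complex_of_real (\<Sum>K\<leftarrow>Ks. (fnorm (K * Y))\<^sup>2)"
  using assms(1)
proof (induction Ks)
  case Nil
  then show ?case by (simp add: tr_def)
next
  case (Cons K Ks)
  then have K: "K \<in> carrier_mat d' d" by simp
  have e: "K * (Y * mat_adjoint Y) * mat_adjoint K = K * Y * mat_adjoint (K * Y)"
    using carrier_matD[OF K] carrier_matD[OF assms(2)] by (simp add: mat_adjoint_mult mult_mat_assoc)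
  have c: "K * Y * mat_adjoint (K * Y) \<in> carrier_mat d' d'" using K assms by auto
  show ?case
    using Cons by (simp add: kraus_map_Cons[OF K] e tr_add[OF c] tr_mult_adjoint_self)
qed

text \<open>Basis vectors are one-column matrices, so that the lemmas on adjoints, products and
  tensor products apply to them; their adjoints serve as Kraus operators that read out a
  basis.\<close>

definition ket :: "nat \<Rightarrow> nat \<Rightarrow> complex mat" where
  "ket n i = mat n 1 (\<lambda>(r, c). if r = i then 1 else 0)"

lemma ket_carrier [simp]: "ket n i \<in> carrier_mat n 1" "ket n i \<in> carrier_mat n (Suc 0)"
  by (simp_all add: ket_def)

lemma ket_dim [simp]: "dim_row (ket n i) = n" "dim_col (ket n i) = 1"
  by (simp_all add: ket_def)

lemma ket_index [simp]: "r < n \<Longrightarrow> ket n i $$ (r, 0) = (if r = i then 1 else 0)"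
  by (simp add: ket_def)

lemma mult_ket_index:
  assumes "i < dim_col A" "r < dim_row A"
  shows "(A * ket (dim_col A) i) $$ (r, 0) = A $$ (r, i)"
proof -
  have "(A * ket (dim_col A) i) $$ (r, 0) = (\<Sum>k<dim_col A. A $$ (r, k) * (if k = i then 1 else 0))"
    using assms by (simp add: scalar_prod_def atLeast0LessThan ket_def)
  also have "\<dots> = A $$ (r, i)" using assms by (simp add: if_distrib cong: if_cong)
  finally show ?thesis .
qed

lemma ket_adjoint_mult:
  assumes "i < n" "M \<in> carrier_mat n n"
  shows "tr (mat_adjoint (ket n i) * (M * ket n i)) = M $$ (i, i)"
proof -
  have M: "dim_row M = n" "dim_col M = n" using assms by auto
  have "tr (mat_adjoint (ket n i) * (M * ket n i))
      = (\<Sum>k<n. (if k = i then 1 else 0) * (M * ket n i) $$ (k, 0))"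
    using tr_adjoint_mult[of "ket n i" n 1 "M * ket n i"] assms
    by (simp del: index_mult_mat(1)) (intro sum.cong refl, simp del: index_mult_mat(1))
  also have "\<dots> = (\<Sum>k<n. if k = i then (M * ket n i) $$ (k, 0) else 0)" by (intro sum.cong) auto
  also have "\<dots> = (M * ket n i) $$ (i, 0)" using assms by simp
  also have "\<dots> = M $$ (i, i)" using mult_ket_index[of i M i] M assms by simp
  finally show ?thesis .
qed

lemma tr_eq_sum_ket:
  assumes "M \<in> carrier_mat n n"
  shows "tr M = (\<Sum>i<n. tr (mat_adjoint (ket n i) * (M * ket n i)))"
proof -
  have "(\<Sum>i<n. tr (mat_adjoint (ket n i) * (M * ket n i))) = (\<Sum>i<n. M $$ (i, i))"
    by (intro sum.cong refl ket_adjoint_mult assms) simp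
  then show ?thesis using assms by (simp add: tr_def)
qed

lemma fnorm_ket: "i < n \<Longrightarrow> fnorm (ket n i) = 1"
proof -
  assume "i < n"
  have "(fnorm (ket n i))\<^sup>2 = (\<Sum>r<n. if r = i then 1 else 0)"
    unfolding fnorm_power2 ket_dim by (intro sum.cong) auto
  with \<open>i < n\<close> have "(fnorm (ket n i))\<^sup>2 = 1" by simp
  then show ?thesis using fnorm_nonneg[of "ket n i"] by (simp add: power2_eq_1_iff)
qed

section \<open>Spectral theorem and trace norm\<close>

lemma unitaryD:
  assumes "unitary n U"
  shows "U \<in> carrier_mat n n" "U * mat_adjoint U = 1\<^sub>m n" "mat_adjoint U * U = 1\<^sub>m n"
    "dim_row U = n" "dim_col U = n"
  using assms by (auto simp: unitary_def)

lemma conj_diag_index: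
  assumes "U \<in> carrier_mat n n" "i < n" "j < n"
  shows "(U * mat_diag n f * mat_adjoint U) $$ (i, j) = (\<Sum>k<n. U $$ (i, k) * f k * cnj (U $$ (j, k)))"
  using assms by (subst mat_diag_mult_right[of _ n]) (auto simp: scalar_prod_def atLeast0LessThan)

lemma tr_unitary_conj:
  assumes "unitary n U" "X \<in> carrier_mat n n"
  shows "tr (U * X * mat_adjoint U) = tr X"
proof -
  note [simp] = unitaryD(4,5)[OF assms(1)]
  have "tr (U * X * mat_adjoint U) = tr (mat_adjoint U * (U * X))"
    using assms unitaryD[OF assms(1)] by (intro tr_mult_commute[of _ n n]) auto
  also have "mat_adjoint U * (U * X) = X"
    using assms(2) by (simp add: mult_mat_assoc[symmetric] unitaryD[OF assms(1)] left_mult_one_mat[of _ n n])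
  finally show ?thesis .
qed

lemma tr_diag: "tr (mat_diag n f) = (\<Sum>i<n. f i)"
  by (simp add: tr_def mat_diag_def)

text \<open>Gram-Schmidt, applied to a basis that starts with \<open>v\<close>, keeps
  \<open>v\<close> as its first vector; normalising the vectors gives the columns, and
  \<open>c\<close> is the inverse length of \<open>v\<close>.\<close>

lemma unitary_with_first_column:
  assumes v: "v \<in> carrier_vec n" and v0: "v \<noteq> 0\<^sub>v n" and n: "n \<noteq> 0"
  shows "\<exists>W c. unitary n W \<and> (\<forall>i<n. W $$ (i, 0) = c * v $ i)"
proof -
  interpret cof_vec_space n "TYPE(complex)" .
  define b where "b = basis_completion v"
  define ws where "ws = gram_schmidt n b"
  from basis_completion[OF v v0, folded b_def]
  have b: "distinct b" "\<not> lin_dep (set b)" "set b \<subseteq> carrier_vec n" "hd b = v" "length b = n"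
    by auto
  from b n obtain vs where bv: "b = v # vs" by (cases b) auto
  from gram_schmidt_result[OF b(3,1,2) refl, folded ws_def]
  have ws: "set ws \<subseteq> carrier_vec n" "corthogonal ws" "length ws = n"
    by (auto simp: b(5))
  from gram_schmidt_hd[OF v, of vs, folded bv] have hdws: "hd ws = v" unfolding ws_def .
  have ws0: "ws ! 0 = v" using hdws ws(3) n by (metis hd_conv_nth list.size(3))
  have wsc: "ws ! j \<in> carrier_vec n" if "j < n" for j using that ws by auto
  have inner: "ws ! i \<bullet>c ws ! j = (\<Sum>k<n. ws ! i $ k * cnj (ws ! j $ k))" if "i < n" "j < n" for i j
    using wsc[OF that(1)] wsc[OF that(2)] by (simp add: scalar_prod_def atLeast0LessThan)
  define s where "s j = (\<Sum>k<n. (cmod (ws ! j $ k))\<^sup>2)" for j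
  have s: "ws ! j \<bullet>c ws ! j = complex_of_real (s j)" if "j < n" for j
    by (simp only: inner[OF that that] s_def of_real_sum complex_norm_square)
  have s_pos: "0 < s j" if j: "j < n" for j
  proof -
    have "ws ! j \<bullet>c ws ! j \<noteq> 0" using corthogonalD[OF ws(2), of j j] j ws(3) by simp
    then have "s j \<noteq> 0" using s[OF j] by simp
    moreover have "0 \<le> s j" by (simp add: s_def sum_nonneg)
    ultimately show ?thesis by simp
  qed
  define W where "W = mat n n (\<lambda>(i, j). ws ! j $ i / complex_of_real (sqrt (s j)))"
  have W: "W \<in> carrier_mat n n" by (simp add: W_def)
  have WW: "mat_adjoint W * W = 1\<^sub>m n"
  proof (rule eq_matI)
    fix i j assume "i < dim_row (1\<^sub>m n :: complex mat)" "j < dim_col (1\<^sub>m n :: complex mat)"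
    then have i: "i < n" and j: "j < n" by auto
    have "(mat_adjoint W * W) $$ (i, j) = (\<Sum>k<n. cnj (W $$ (k, i)) * W $$ (k, j))"
      using i j W by (simp add: scalar_prod_def atLeast0LessThan)
    also have "\<dots> = (ws ! j \<bullet>c ws ! i) / (complex_of_real (sqrt (s i)) * complex_of_real (sqrt (s j)))"
      using i j by (simp add: W_def inner sum_divide_distrib mult.commute)
    also have "\<dots> = (if i = j then 1 else 0)"
    proof (cases "i = j")
      case True
      then show ?thesis using s_pos[OF j] by (simp add: s[OF j] flip: of_real_mult)
    next
      case False
      then show ?thesis using corthogonalD[OF ws(2), of j i] i j ws(3) by simp
    qed
    finally show "(mat_adjoint W * W) $$ (i, j) = (1\<^sub>m n :: complex mat) $$ (i, j)" using i j by simp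
  qed (use W in auto)
  have "unitary n W"
    using W WW mat_mult_left_right_inverse[OF mat_adjoint_carrier[OF W] W WW] by (simp add: unitary_def)
  moreover have "\<forall>i<n. W $$ (i, 0) = (1 / complex_of_real (sqrt (s 0))) * v $ i"
    using n by (simp add: W_def ws0)
  ultimately show ?thesis by blast
qed

lemma hermitian_index:
  assumes "A \<in> carrier_mat n n" "mat_adjoint A = A" "i < n" "j < n"
  shows "A $$ (i, j) = cnj (A $$ (j, i))"
  using assms mat_adjoint_index[of i A j] by simp

text \<open>Deflation: in an orthonormal basis that starts with an eigenvector, the first column of
  the matrix is a multiple of the first unit vector, hence by hermiticity the first row is too. A
  hermitian block of size \<open>m\<close> remains for the induction.\<close>

theorem hermitian_spectral:
  assumes "A \<in> carrier_mat n n" "mat_adjoint A = A"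
  shows "\<exists>U l. unitary n U \<and> A = U * mat_diag n (\<lambda>i. complex_of_real (l i)) * mat_adjoint U"
  using assms
proof (induction n arbitrary: A)
  case 0
  then show ?case
    by (intro exI[of _ "1\<^sub>m 0"]) (auto simp: unitary_def intro!: eq_matI)
next
  case (Suc m A)
  let ?n = "Suc m"
  note A = Suc.prems(1)
  obtain as where as: "char_poly A = (\<Prod>a\<leftarrow>as. [:- a, 1:])" "length as = ?n"
    using char_poly_factorized[OF A] by blast
  then obtain e where "poly (char_poly A) e = 0" by (cases as) auto
  then have "eigenvalue A e" by (simp add: eigenvalue_root_char_poly[OF A])
  then obtain v where v: "v \<in> carrier_vec ?n" "v \<noteq> 0\<^sub>v ?n" "A *\<^sub>v v = e \<cdot>\<^sub>v v"
    using A by (auto simp: eigenvalue_def eigenvector_def)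
  obtain W c where W: "unitary ?n W" and col: "\<And>i. i < ?n \<Longrightarrow> W $$ (i, 0) = c * v $ i"
    using unitary_with_first_column[OF v(1,2)] by blast
  note Wd = unitaryD[OF W]
  define B where "B = mat_adjoint W * A * W"
  have B: "B \<in> carrier_mat ?n ?n" using Wd A by (auto simp: B_def)
  have Bh: "mat_adjoint B = B"
    using A Wd Suc.prems(2) carrier_matD[OF A] by (simp add: B_def mat_adjoint_mult mult_mat_assoc)
  have AB: "W * B * mat_adjoint W = A"
  proof -
    have "W * B * mat_adjoint W = (W * mat_adjoint W) * A * (W * mat_adjoint W)"
      using Wd(4,5) carrier_matD[OF A] by (simp add: B_def mult_mat_assoc)
    then show ?thesis
      using A by (simp add: Wd left_mult_one_mat[of _ ?n ?n] right_mult_one_mat[of _ ?n ?n])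
  qed
  have AW: "(A * W) $$ (i, 0) = e * W $$ (i, 0)" if i: "i < ?n" for i
  proof -
    have "(A * W) $$ (i, 0) = (\<Sum>k<?n. A $$ (i, k) * (c * v $ k))"
      using i A Wd(4,5) col by (auto simp: scalar_prod_def atLeast0LessThan intro!: sum.cong)
    also have "\<dots> = c * (A *\<^sub>v v) $ i"
      using i A v(1) by (auto simp: scalar_prod_def atLeast0LessThan sum_distrib_left ac_simps
          simp del: sum.lessThan_Suc intro!: sum.cong)
    also have "\<dots> = e * W $$ (i, 0)" using i v by (simp add: col)
    finally show ?thesis .
  qed
  have B0: "B $$ (i, 0) = (if i = 0 then e else 0)" if i: "i < ?n" for i
  proof -
    have "B $$ (i, 0) = (mat_adjoint W * (A * W)) $$ (i, 0)"
      using Wd(4,5) carrier_matD[OF A] by (simp add: B_def mult_mat_assoc)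
    also have "\<dots> = (\<Sum>k<?n. cnj (W $$ (k, i)) * (A * W) $$ (k, 0))"
      using i A Wd(4,5) by (auto simp: scalar_prod_def atLeast0LessThan simp del: sum.lessThan_Suc intro!: sum.cong)
    also have "\<dots> = e * (\<Sum>k<?n. cnj (W $$ (k, i)) * W $$ (k, 0))"
      by (auto simp: AW sum_distrib_left ac_simps simp del: sum.lessThan_Suc intro!: sum.cong)
    also have "(\<Sum>k<?n. cnj (W $$ (k, i)) * W $$ (k, 0)) = (mat_adjoint W * W) $$ (i, 0)"
      using i Wd(4,5) by (auto simp: scalar_prod_def atLeast0LessThan simp del: sum.lessThan_Suc intro!: sum.cong)
    also have "\<dots> = (if i = 0 then 1 else 0)" using i by (simp add: Wd(3))
    finally show ?thesis by simp
  qed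
  \<comment> \<open>The eigenvalue is a diagonal entry of the hermitian matrix \<open>B\<close>,
    hence real.\<close>
  have e_real: "cnj e = e" using hermitian_index[OF B Bh, of 0 0] B0[of 0] by simp
  have B0': "B $$ (0, j) = (if j = 0 then e else 0)" if "j < ?n" for j
    using hermitian_index[OF B Bh, of 0 j] B0[OF that] that e_real by auto
  define A3 where "A3 = mat m m (\<lambda>(i, j). B $$ (Suc i, Suc j))"
  have "mat_adjoint A3 = A3"
    by (rule eq_matI) (auto simp: A3_def intro!: hermitian_index[OF B Bh, symmetric])
  then obtain U3 l3 where U3: "unitary m U3"
    and A3: "A3 = U3 * mat_diag m (\<lambda>i. complex_of_real (l3 i)) * mat_adjoint U3"
    using Suc.IH[of A3] by (auto simp: A3_def)
  note U3d = unitaryD[OF U3]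
  \<comment> \<open>The block sum of 1 and \<open>U3\<close>, which diagonalises
    \<open>B\<close>.\<close>
  define V where "V = mat ?n ?n (\<lambda>(i, j). if i = 0 \<or> j = 0 then (if i = j then 1 else 0)
    else U3 $$ (i - 1, j - 1))"
  define l where "l i = (if i = 0 then Re e else l3 (i - 1))" for i
  have V: "V \<in> carrier_mat ?n ?n" by (simp add: V_def)
  have sum_V: "(\<Sum>k<?n. V $$ (i, k) * f k * cnj (V $$ (j, k)))
      = (if i = 0 \<or> j = 0 then (if i = j then f 0 else 0)
         else \<Sum>k<m. U3 $$ (i - 1, k) * f (Suc k) * cnj (U3 $$ (j - 1, k)))"
    if "i < ?n" "j < ?n" for i j and f :: "nat \<Rightarrow> complex"
    using that by (auto simp: sum.lessThan_Suc_shift V_def simp del: sum.lessThan_Suc)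
  have VB: "V * mat_diag ?n (\<lambda>i. complex_of_real (l i)) * mat_adjoint V = B"
  proof (rule eq_matI)
    fix i j assume "i < dim_row B" "j < dim_col B"
    then have i: "i < ?n" and j: "j < ?n" using B by auto
    show "(V * mat_diag ?n (\<lambda>i. complex_of_real (l i)) * mat_adjoint V) $$ (i, j) = B $$ (i, j)"
    proof (cases "i = 0 \<or> j = 0")
      case True
      moreover have "complex_of_real (Re e) = e" using e_real by (simp add: complex_eq_iff)
      ultimately show ?thesis
        using i j by (auto simp: conj_diag_index[OF V] sum_V B0 B0' l_def simp del: sum.lessThan_Suc)
    next
      case False
      then obtain i' j' where ij: "i = Suc i'" "j = Suc j'" by (metis not0_implies_Suc)
      then have "B $$ (i, j) = A3 $$ (i', j')" using i j by (simp add: A3_def)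
      also have "\<dots> = (\<Sum>k<m. U3 $$ (i', k) * complex_of_real (l3 k) * cnj (U3 $$ (j', k)))"
        using i j ij by (subst A3, subst conj_diag_index[OF U3d(1)]) auto
      finally show ?thesis
        using i j False ij by (simp add: conj_diag_index[OF V] sum_V l_def del: sum.lessThan_Suc)
    qed
  qed (use V B in auto)
  have "V * mat_adjoint V = 1\<^sub>m ?n"
  proof (rule eq_matI)
    fix i j assume "i < dim_row (1\<^sub>m ?n :: complex mat)" "j < dim_col (1\<^sub>m ?n :: complex mat)"
    then have i: "i < ?n" and j: "j < ?n" by auto
    have "(V * mat_adjoint V) $$ (i, j) = (\<Sum>k<?n. V $$ (i, k) * 1 * cnj (V $$ (j, k)))"
      using i j V by (auto simp: scalar_prod_def atLeast0LessThan simp del: sum.lessThan_Suc intro!: sum.cong)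
    also have "\<dots> = (1\<^sub>m ?n :: complex mat) $$ (i, j)"
    proof (cases "i = 0 \<or> j = 0")
      case True
      then show ?thesis using i j by (subst sum_V) auto
    next
      case False
      then obtain i' j' where ij: "i = Suc i'" "j = Suc j'" by (metis not0_implies_Suc)
      have "(\<Sum>k<m. U3 $$ (i', k) * 1 * cnj (U3 $$ (j', k))) = (U3 * mat_adjoint U3) $$ (i', j')"
        using i j ij U3d(4,5) by (auto simp: scalar_prod_def atLeast0LessThan intro!: sum.cong)
      then show ?thesis using i j ij by (subst sum_V) (auto simp: U3d(2))
    qed
    finally show "(V * mat_adjoint V) $$ (i, j) = (1\<^sub>m ?n :: complex mat) $$ (i, j)" .
  qed (use V in auto)
  then have Vu: "unitary ?n V"
    using V mat_mult_left_right_inverse[OF V mat_adjoint_carrier[OF V]] by (simp add: unitary_def)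
  note Vd = unitaryD[OF Vu]
  have "unitary ?n (W * V)"
  proof -
    have "W * V * mat_adjoint (W * V) = W * (V * mat_adjoint V) * mat_adjoint W"
      "mat_adjoint (W * V) * (W * V) = mat_adjoint V * (mat_adjoint W * W) * V"
      using Wd(4,5) Vd(4,5) by (simp_all add: mat_adjoint_mult mult_mat_assoc)
    then show ?thesis
      using Wd Vd by (simp add: unitary_def right_mult_one_mat[of _ ?n ?n])
  qed
  moreover have "A = W * V * mat_diag ?n (\<lambda>i. complex_of_real (l i)) * mat_adjoint (W * V)"
  proof -
    have "W * V * mat_diag ?n (\<lambda>i. complex_of_real (l i)) * mat_adjoint (W * V)
      = W * (V * mat_diag ?n (\<lambda>i. complex_of_real (l i)) * mat_adjoint V) * mat_adjoint W"
      using Wd(4,5) Vd(4,5) by (simp add: mat_adjoint_mult mult_mat_assoc mat_diag_def)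
    then show ?thesis by (simp only: VB AB)
  qed
  ultimately show ?case by blast
qed

text \<open>The unitary \<open>W = V^* U\<close> intertwines the two diagonal matrices, so an entry
  \<open>W $$ (i, j)\<close> can be nonzero only if \<open>k i = l j\<close>. Then \<open>W\<close>
  also intertwines their images under \<open>f\<close>. This makes the \<open>THE\<close> in
  \<open>herm_fun\<close> well defined.\<close>

lemma spectral_functional_unique:
  fixes l k :: "nat \<Rightarrow> real"
  assumes U: "unitary n U" and V: "unitary n V"
    and eq: "U * mat_diag n (\<lambda>i. complex_of_real (l i)) * mat_adjoint U
      = V * mat_diag n (\<lambda>i. complex_of_real (k i)) * mat_adjoint V"
  shows "U * mat_diag n (\<lambda>i. complex_of_real (f (l i))) * mat_adjoint U
    = V * mat_diag n (\<lambda>i. complex_of_real (f (k i))) * mat_adjoint V"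
proof -
  note Ud = unitaryD[OF U] and Vd = unitaryD[OF V]
  let ?D = "\<lambda>g. mat_diag n (\<lambda>i. complex_of_real (g i))"
  have D: "dim_row (?D g) = n" "dim_col (?D g) = n" for g by (simp_all add: mat_diag_def)
  define W where "W = mat_adjoint V * U"
  have W: "W \<in> carrier_mat n n" using Ud Vd by (auto simp: W_def)
  have VW: "V * W = U"
    using Ud Vd by (simp add: W_def mult_mat_assoc[symmetric] left_mult_one_mat[of _ n n])
  have WU: "W * mat_adjoint U = mat_adjoint V"
    using Ud Vd by (simp add: W_def mult_mat_assoc right_mult_one_mat[of _ n n])
  have "?D k * W = mat_adjoint V * (V * ?D k * mat_adjoint V) * U"
    using Ud(4,5) Vd D
    by (simp add: W_def mult_mat_assoc[symmetric] left_mult_one_mat[of _ n n])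
  also have "\<dots> = W * ?D l"
    unfolding eq[symmetric] using Ud Vd(4,5) D
    by (simp add: W_def mult_mat_assoc right_mult_one_mat[of _ n n])
  finally have DW: "?D k * W = W * ?D l" .
  have entry: "complex_of_real (f (k i)) * W $$ (i, j) = W $$ (i, j) * complex_of_real (f (l j))"
    if "i < n" "j < n" for i j
  proof -
    have "complex_of_real (k i) * W $$ (i, j) = W $$ (i, j) * complex_of_real (l j)"
      using arg_cong[OF DW, of "\<lambda>M. M $$ (i, j)"] that W
      by (simp add: mat_diag_mult_left[of _ n n] mat_diag_mult_right[of _ n n])
    then have "W $$ (i, j) = 0 \<or> k i = l j" by simp
    then show ?thesis by auto
  qed
  have DfW: "?D (\<lambda>i. f (k i)) * W = W * ?D (\<lambda>i. f (l i))"
    unfolding mat_diag_mult_left[OF W] mat_diag_mult_right[OF W]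
    by (intro cong_mat refl) (simp only: split entry)
  have "U * ?D (\<lambda>i. f (l i)) * mat_adjoint U = V * (W * ?D (\<lambda>i. f (l i))) * mat_adjoint U"
    using Ud(4,5) Vd(4,5) D W by (subst VW[symmetric]) (simp add: mult_mat_assoc)
  also have "\<dots> = V * ?D (\<lambda>i. f (k i)) * (W * mat_adjoint U)"
    unfolding DfW[symmetric] using Ud(4,5) Vd(4,5) D carrier_matD[OF W] by (simp add: mult_mat_assoc)
  finally show ?thesis by (simp only: WU)
qed

lemma herm_fun_spectral:
  fixes l :: "nat \<Rightarrow> real"
  assumes U: "unitary n U"
  shows "herm_fun f (U * mat_diag n (\<lambda>i. complex_of_real (l i)) * mat_adjoint U)
    = U * mat_diag n (\<lambda>i. complex_of_real (f (l i))) * mat_adjoint U"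
proof -
  let ?A = "U * mat_diag n (\<lambda>i. complex_of_real (l i)) * mat_adjoint U"
  have n: "dim_row ?A = n" using unitaryD[OF U] by simp
  show ?thesis
    unfolding herm_fun_def n
  proof (rule the_equality)
    show "\<exists>Ua la. unitary n Ua \<and> ?A = Ua * mat_diag n (\<lambda>i. complex_of_real (la i)) * mat_adjoint Ua \<and>
      U * mat_diag n (\<lambda>i. complex_of_real (f (l i))) * mat_adjoint U
      = Ua * mat_diag n (\<lambda>i. complex_of_real (f (la i))) * mat_adjoint Ua"
      using U by blast
  next
    fix B assume "\<exists>Ua la. unitary n Ua \<and> ?A = Ua * mat_diag n (\<lambda>i. complex_of_real (la i)) * mat_adjoint Ua \<and>
      B = Ua * mat_diag n (\<lambda>i. complex_of_real (f (la i))) * mat_adjoint Ua"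
    then show "B = U * mat_diag n (\<lambda>i. complex_of_real (f (l i))) * mat_adjoint U"
      using spectral_functional_unique[OF _ U] by metis
  qed
qed

lemma herm_fun_diag:
  fixes l :: "nat \<Rightarrow> real"
  shows "herm_fun f (mat_diag n (\<lambda>i. complex_of_real (l i))) = mat_diag n (\<lambda>i. complex_of_real (f (l i)))"
proof -
  have "unitary n (1\<^sub>m n)" by (simp add: unitary_def)
  from herm_fun_spectral[OF this, of f l] show ?thesis
    by (simp add: left_mult_one_mat[of _ n n] right_mult_one_mat[of _ n n])
qed

text \<open>Half of the duality between trace norm and operator norm, without polar decomposition:
  the eigenvectors \<open>u i\<close> of \<open>X^* X\<close> satisfy
  \<open>fnorm (X * u i) = sqrt (l i)\<close>, and the trace in this basis is the sum of the inner
  products of \<open>P^* u i\<close> with \<open>X * u i\<close>. So it is the adjoint of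
  \<open>P\<close> that has to be a contraction.\<close>

lemma cmod_tr_mult_le_trace_norm:
  assumes P: "P \<in> carrier_mat n n" and X: "X \<in> carrier_mat n n"
    and contr: "\<And>u. u \<in> carrier_mat n 1 \<Longrightarrow> fnorm (mat_adjoint P * u) \<le> fnorm u"
  shows "cmod (tr (P * X)) \<le> trace_norm X"
proof -
  note dims = carrier_matD[OF P] carrier_matD[OF X]
  let ?H = "mat_adjoint X * X"
  have "?H \<in> carrier_mat n n" "mat_adjoint ?H = ?H"
    using dims by (auto simp: mat_adjoint_mult)
  then obtain U l where U: "unitary n U"
    and H: "?H = U * mat_diag n (\<lambda>i. complex_of_real (l i)) * mat_adjoint U"
    using hermitian_spectral by blast
  note Ud = unitaryD[OF U]
  have D: "mat_diag n g \<in> carrier_mat n n" for g :: "nat \<Rightarrow> complex" by simp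
  have tn: "trace_norm X = (\<Sum>i<n. sqrt (l i))"
    unfolding trace_norm_def H herm_fun_spectral[OF U] tr_unitary_conj[OF U D] by (simp add: tr_diag)
  have UHU: "mat_adjoint U * ?H * U = mat_diag n (\<lambda>i. complex_of_real (l i))"
  proof -
    have "mat_adjoint U * ?H * U = (mat_adjoint U * U) * mat_diag n (\<lambda>i. complex_of_real (l i)) * (mat_adjoint U * U)"
      unfolding H using Ud(4,5) carrier_matD[OF D, of "\<lambda>i. complex_of_real (l i)"] by (simp add: mult_mat_assoc)
    then show ?thesis by (simp add: Ud left_mult_one_mat[of _ n n] right_mult_one_mat[of _ n n])
  qed
  define u where "u i = U * ket n i" for i
  have u: "u i \<in> carrier_mat n 1" for i using Ud by (auto simp: u_def)
  have udim: "dim_row (u i) = n" "dim_col (u i) = 1" for i using u[of i] by auto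
  have fu: "fnorm (u i) = 1" if "i < n" for i
    unfolding u_def using fnorm_mult_isometry[OF Ud(3,5)] fnorm_ket[OF that] by simp
  have fXu: "fnorm (X * u i) = sqrt (l i)" if i: "i < n" for i
  proof -
    have "mat_adjoint (X * u i) * (X * u i) = mat_adjoint (ket n i) * (mat_adjoint U * ?H * U * ket n i)"
      using dims Ud(4,5) by (simp add: u_def mat_adjoint_mult mult_mat_assoc)
    then have "complex_of_real ((fnorm (X * u i))\<^sup>2) = complex_of_real (l i)"
      unfolding tr_adjoint_mult_self[symmetric] UHU
      using ket_adjoint_mult[OF i D] i by (simp add: mat_diag_def)
    then have "(fnorm (X * u i))\<^sup>2 = l i" by (simp only: of_real_eq_iff)
    then show ?thesis by (metis fnorm_nonneg real_sqrt_unique)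
  qed
  have "tr (P * X) = tr (U * (mat_adjoint U * (P * X) * U) * mat_adjoint U)"
  proof -
    have "U * (mat_adjoint U * (P * X) * U) * mat_adjoint U = (U * mat_adjoint U) * (P * X) * (U * mat_adjoint U)"
      using dims Ud(4,5) by (simp add: mult_mat_assoc)
    then show ?thesis
      using P X by (simp add: Ud left_mult_one_mat[of _ n n] right_mult_one_mat[of _ n n])
  qed
  also have "\<dots> = tr (mat_adjoint U * (P * X) * U)"
    using Ud P X by (intro tr_unitary_conj[OF U]) auto
  also have "\<dots> = (\<Sum>i<n. tr (mat_adjoint (ket n i) * (mat_adjoint U * (P * X) * U * ket n i)))"
    using Ud P X by (intro tr_eq_sum_ket) auto
  also have "\<dots> = (\<Sum>i<n. tr (mat_adjoint (mat_adjoint P * u i) * (X * u i)))"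
    using dims Ud(4,5) by (simp add: u_def mat_adjoint_mult mult_mat_assoc)
  also have "cmod \<dots> \<le> (\<Sum>i<n. sqrt (l i))"
  proof (rule sum_norm_le)
    fix i assume "i \<in> {..<n}"
    then have i: "i < n" by simp
    have a: "fnorm (mat_adjoint P * u i) \<le> 1" using contr[OF u[of i]] fu[OF i] by simp
    have b: "0 \<le> sqrt (l i)" using fXu[OF i] fnorm_nonneg[of "X * u i"] by simp
    have "cmod (tr (mat_adjoint (mat_adjoint P * u i) * (X * u i))) \<le> fnorm (mat_adjoint P * u i) * fnorm (X * u i)"
      using mult_carrier_mat[OF mat_adjoint_carrier[OF P] u] mult_carrier_mat[OF X u]
      by (rule cmod_tr_adjoint_mult_le)
    also have "\<dots> \<le> 1 * sqrt (l i)"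
      unfolding fXu[OF i] by (rule mult_right_mono[OF a b])
    finally show "cmod (tr (mat_adjoint (mat_adjoint P * u i) * (X * u i))) \<le> sqrt (l i)" by simp
  qed
  finally show ?thesis by (simp add: tn)
qed

text \<open>The square root is taken in an eigenbasis; testing positivity on the eigenvectors shows
  that the eigenvalues are nonnegative.\<close>

lemma positive_factor:
  assumes "positive n A"
  shows "\<exists>Y\<in>carrier_mat n n. A = Y * mat_adjoint Y"
proof -
  have A: "A \<in> carrier_mat n n" "mat_adjoint A = A" and pos: "\<And>v. v \<in> carrier_vec n \<Longrightarrow> 0 \<le> Re ((A *\<^sub>v v) \<bullet>c v)"
    using assms by (auto simp: positive_def)
  obtain U l where U: "unitary n U"
    and H: "A = U * mat_diag n (\<lambda>i. complex_of_real (l i)) * mat_adjoint U"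
    using hermitian_spectral[OF A] by blast
  note Ud = unitaryD[OF U]
  have l: "0 \<le> l i" if i: "i < n" for i
  proof -
    have Dd: "dim_row (mat_diag n g) = n" "dim_col (mat_diag n g) = n" for g :: "nat \<Rightarrow> complex"
      by (simp_all add: mat_diag_def)
    have AU: "A * U = U * mat_diag n (\<lambda>i. complex_of_real (l i))"
      unfolding H using Ud Dd by (simp add: mult_mat_assoc right_mult_one_mat[of _ n n])
    have "A *\<^sub>v col U i = col (A * U) i"
      using col_mult2[OF A(1) Ud(1) i] by simp
    also have "\<dots> = complex_of_real (l i) \<cdot>\<^sub>v col U i"
      unfolding AU using i Ud by (intro eq_vecI) (auto simp: mat_diag_mult_right[of _ n n] mult.commute)
    finally have "(A *\<^sub>v col U i) \<bullet>c col U i = complex_of_real (l i) * (col U i \<bullet>c col U i)"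
      using Ud by simp
    also have "col U i \<bullet>c col U i = (mat_adjoint U * U) $$ (i, i)"
      using i Ud(4,5) by (auto simp: scalar_prod_def mult.commute intro!: sum.cong)
    also have "\<dots> = 1" using i by (simp add: Ud(3))
    finally have "(A *\<^sub>v col U i) \<bullet>c col U i = complex_of_real (l i)" by simp
    then show ?thesis using pos[of "col U i"] Ud by (metis col_carrier_vec Re_complex_of_real i)
  qed
  define Y where "Y = U * mat_diag n (\<lambda>i. complex_of_real (sqrt (l i)))"
  have Y: "Y \<in> carrier_mat n n" using Ud by (auto simp: Y_def)
  have Yi: "Y $$ (i, k) = U $$ (i, k) * complex_of_real (sqrt (l k))" if "i < n" "k < n" for i k
    using that Ud(1) by (simp add: Y_def mat_diag_mult_right[of _ n n])
  have "A = Y * mat_adjoint Y"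
  proof (rule eq_matI)
    fix i j assume "i < dim_row (Y * mat_adjoint Y)" "j < dim_col (Y * mat_adjoint Y)"
    then have i: "i < n" and j: "j < n" using Y by auto
    have "(Y * mat_adjoint Y) $$ (i, j) = (\<Sum>k<n. Y $$ (i, k) * cnj (Y $$ (j, k)))"
      using i j Y by (auto simp: scalar_prod_def atLeast0LessThan intro!: sum.cong)
    also have "\<dots> = (\<Sum>k<n. U $$ (i, k) * complex_of_real (l k) * cnj (U $$ (j, k)))"
      using i j l by (auto simp: Yi simp flip: of_real_mult intro!: sum.cong)
    also have "\<dots> = A $$ (i, j)" unfolding H using conj_diag_index[OF Ud(1) i j] by simp
    finally show "A $$ (i, j) = (Y * mat_adjoint Y) $$ (i, j)" ..
  qed (use Y A in auto)
  with Y show ?thesis by blast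
qed

section \<open>Merging Alice and Bob into one party\<close>

text \<open>The permutation behind \<open>charlie_first\<close> as an explicit unitary. Its
  commutation with local operators is what the merging of Alice and Bob rests on.\<close>

definition cswap :: "nat \<Rightarrow> nat \<Rightarrow> nat \<Rightarrow> complex mat" where
  "cswap a c b = swap_mat a c \<otimes>\<^sub>m 1\<^sub>m b"

lemma cswap_dim [simp]: "dim_row (cswap a c b) = c * a * b" "dim_col (cswap a c b) = a * c * b"
  by (simp_all add: cswap_def)

lemma cswap_carrier [simp]: "cswap a c b \<in> carrier_mat (c * a * b) (a * c * b)"
  by auto

lemma charlie_first_eq: "charlie_first a c b X = cswap a c b * X * mat_adjoint (cswap a c b)"
  by (simp add: charlie_first_def swap_middle_def cswap_def Let_def)

lemma charlie_first_carrier [simp]: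
  "charlie_first a c b X \<in> carrier_mat (c * a * b) (c * a * b)"
  by (auto simp: charlie_first_eq)

lemma cswap_unitary:
  "mat_adjoint (cswap a c b) * cswap a c b = 1\<^sub>m (a * c * b)"
  "cswap a c b * mat_adjoint (cswap a c b) = 1\<^sub>m (c * a * b)"
  by (simp_all add: cswap_def mat_adjoint_tensor tensor_mult swap_mat_unitary)

text \<open>A POVM has to agree with its protocol on all operators on \<open>C : AB\<close>, while
  the simulated protocol is described on rearranged operators. Surjectivity closes this gap.\<close>

lemma charlie_first_surj:
  assumes "Z \<in> carrier_mat (c * a * b) (c * a * b)"
  shows "\<exists>X\<in>carrier_mat (a * c * b) (a * c * b). Z = charlie_first a c b X"
proof
  let ?W = "cswap a c b"
  show "mat_adjoint ?W * Z * ?W \<in> carrier_mat (a * c * b) (a * c * b)" by auto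
  have "charlie_first a c b (mat_adjoint ?W * Z * ?W) = (?W * mat_adjoint ?W) * Z * (?W * mat_adjoint ?W)"
    using carrier_matD[OF assms] by (simp add: charlie_first_eq mult_mat_assoc)
  then show "Z = charlie_first a c b (mat_adjoint ?W * Z * ?W)"
    using assms by (simp add: cswap_unitary left_mult_one_mat[of _ "c * a * b" "c * a * b"]
        right_mult_one_mat[of _ "c * a * b" "c * a * b"])
qed

text \<open>Naturality of the swap, once for each of the three parties: a local operator passes
  through the rearrangement and becomes a local operator of Charlie or of AB. The permutations on
  the two sides differ since the operator may change a dimension.\<close>

lemma cswap_alice:
  assumes "K \<in> carrier_mat a' a"
  shows "cswap a' c b * (K \<otimes>\<^sub>m 1\<^sub>m c \<otimes>\<^sub>m 1\<^sub>m b) = (1\<^sub>m c \<otimes>\<^sub>m (K \<otimes>\<^sub>m 1\<^sub>m b)) * cswap a c b"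
proof -
  have "cswap a' c b * (K \<otimes>\<^sub>m 1\<^sub>m c \<otimes>\<^sub>m 1\<^sub>m b) = (swap_mat a' c * (K \<otimes>\<^sub>m 1\<^sub>m c)) \<otimes>\<^sub>m 1\<^sub>m b"
    using assms by (simp add: cswap_def tensor_mult)
  also have "swap_mat a' c * (K \<otimes>\<^sub>m 1\<^sub>m c) = (1\<^sub>m c \<otimes>\<^sub>m K) * swap_mat a c"
    using assms by (intro swap_mat_tensor) auto
  also have "((1\<^sub>m c \<otimes>\<^sub>m K) * swap_mat a c) \<otimes>\<^sub>m 1\<^sub>m b = (1\<^sub>m c \<otimes>\<^sub>m K \<otimes>\<^sub>m 1\<^sub>m b) * cswap a c b"
    using assms by (simp add: cswap_def tensor_mult)
  finally show ?thesis by (simp add: tensor_assoc)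
qed

lemma cswap_charlie:
  assumes "K \<in> carrier_mat c' c"
  shows "cswap a c' b * (1\<^sub>m a \<otimes>\<^sub>m K \<otimes>\<^sub>m 1\<^sub>m b) = (K \<otimes>\<^sub>m 1\<^sub>m (a * b)) * cswap a c b"
proof -
  have "cswap a c' b * (1\<^sub>m a \<otimes>\<^sub>m K \<otimes>\<^sub>m 1\<^sub>m b) = (swap_mat a c' * (1\<^sub>m a \<otimes>\<^sub>m K)) \<otimes>\<^sub>m 1\<^sub>m b"
    using assms by (simp add: cswap_def tensor_mult)
  also have "swap_mat a c' * (1\<^sub>m a \<otimes>\<^sub>m K) = (K \<otimes>\<^sub>m 1\<^sub>m a) * swap_mat a c"
    using assms by (intro swap_mat_tensor) auto
  also have "((K \<otimes>\<^sub>m 1\<^sub>m a) * swap_mat a c) \<otimes>\<^sub>m 1\<^sub>m b = (K \<otimes>\<^sub>m 1\<^sub>m a \<otimes>\<^sub>m 1\<^sub>m b) * cswap a c b"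
    using assms by (simp add: cswap_def tensor_mult)
  finally show ?thesis by (simp add: tensor_assoc)
qed

lemma cswap_bob:
  assumes "K \<in> carrier_mat b' b"
  shows "cswap a c b' * (1\<^sub>m a \<otimes>\<^sub>m 1\<^sub>m c \<otimes>\<^sub>m K) = (1\<^sub>m c \<otimes>\<^sub>m (1\<^sub>m a \<otimes>\<^sub>m K)) * cswap a c b"
proof -
  have "cswap a c b' * (1\<^sub>m a \<otimes>\<^sub>m 1\<^sub>m c \<otimes>\<^sub>m K) = swap_mat a c \<otimes>\<^sub>m K"
    using assms by (simp add: cswap_def tensor_mult left_mult_one_mat[of _ b' b]
        right_mult_one_mat[of _ "c * a" "a * c"])
  also have "\<dots> = (1\<^sub>m c \<otimes>\<^sub>m 1\<^sub>m a \<otimes>\<^sub>m K) * cswap a c b"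
    using assms by (simp add: cswap_def tensor_mult right_mult_one_mat[of _ b' b]
        left_mult_one_mat[of _ "c * a" "a * c"])
  finally show ?thesis by (simp only: tensor_assoc)
qed

lemma locc_carrier:
  assumes "locc S ds ds' \<Lambda>" "X \<in> carrier_mat (prod_list ds) (prod_list ds)"
  shows "\<Lambda> X \<in> carrier_mat (prod_list ds') (prod_list ds')"
  using locc_kraus[OF assms(1)] assms(2) by auto

lemma locc_msum:
  assumes "locc S ds ds' \<Lambda>" "finite I"
    "\<And>i. i \<in> I \<Longrightarrow> f i \<in> carrier_mat (prod_list ds) (prod_list ds)"
  shows "\<Lambda> (msum (prod_list ds) I f) = msum (prod_list ds') I (\<lambda>i. \<Lambda> (f i))"
proof -
  obtain Ks where Ks: "\<And>K. K \<in> set Ks \<Longrightarrow> local_op ds ds' K"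
    "\<And>X. X \<in> carrier_mat (prod_list ds) (prod_list ds) \<Longrightarrow> \<Lambda> X = kraus_map (prod_list ds') Ks X"
    using locc_kraus[OF assms(1)] by blast
  have Kc: "set Ks \<subseteq> carrier_mat (prod_list ds') (prod_list ds)" using Ks(1) local_op_carrier by blast
  have "\<Lambda> (msum (prod_list ds) I f) = msum (prod_list ds') I (\<lambda>i. kraus_map (prod_list ds') Ks (f i))"
    unfolding Ks(2)[OF msum_carrier] using assms(2) Kc assms(3) by (rule kraus_map_msum)
  also have "\<dots> = msum (prod_list ds') I (\<lambda>i. \<Lambda> (f i))"
    using Ks(2) assms(3) by (intro msum_cong) simp
  finally show ?thesis .
qed

lemma charlie_first_msum:
  assumes "finite I" "\<And>i. i \<in> I \<Longrightarrow> f i \<in> carrier_mat (a * c * b) (a * c * b)"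
  shows "charlie_first a c b (msum (a * c * b) I f) = msum (c * a * b) I (\<lambda>i. charlie_first a c b (f i))"
  unfolding charlie_first_eq using assms by (intro mult_msum_mult) auto

lemma list_of_length_three:
  assumes "length ds = 3"
  shows "ds = [ds ! 0, ds ! 1, ds ! 2]"
proof -
  obtain x y z where "ds = [x, y, z]"
    using assms by (auto simp: numeral_3_eq_3 length_Suc_conv)
  then show ?thesis by simp
qed

lemma prod_list_length_three:
  assumes "length ds = 3"
  shows "prod_list (ds :: nat list) = ds ! 0 * ds ! 1 * ds ! 2"
proof -
  obtain x y z where "ds = [x, y, z]"
    using assms by (auto simp: numeral_3_eq_3 length_Suc_conv)
  then show ?thesis by (simp add: mult.assoc)
qed

text \<open>
  Running a further protocol \<open>\<Phi>\<close> after the given one is what allows an induction that peels off the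
  first step, since a \<open>locc\<close> derivation cannot be extended at its end directly.
\<close>

lemma locc_merge_parties:
  fixes es :: "nat list"
  assumes "locc S ds ds' \<Lambda>" "length ds = 3" "length ds' = 3" "\<forall>d\<in>set ds. 0 < d"
    and S: "1 \<in> S \<Longrightarrow> 0 \<in> S'" "0 \<in> S \<or> 2 \<in> S \<Longrightarrow> 1 \<in> S'"
    and \<Phi>: "locc S' [ds' ! 1, ds' ! 0 * ds' ! 2] es \<Phi>"
  shows "\<exists>\<Lambda>'. locc S' [ds ! 1, ds ! 0 * ds ! 2] es \<Lambda>' \<and>
    (\<forall>X\<in>carrier_mat (prod_list ds) (prod_list ds).
      \<Lambda>' (charlie_first (ds ! 0) (ds ! 1) (ds ! 2) X)
      = \<Phi> (charlie_first (ds' ! 0) (ds' ! 1) (ds' ! 2) (\<Lambda> X)))"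
  using assms(1-4) \<Phi>
proof (induction rule: locc.induct)
  case (locc_done ds)
  then show ?case by blast
next
  case (locc_step p ds Es ds' \<Lambda>)
  note p = locc_step(1) and inst = locc_step(2) and len = locc_step.prems(1)
    and len' = locc_step.prems(2) and pos = locc_step.prems(3) and \<Phi> = locc_step.prems(4)
  let ?n = "length Es"
  define a c b where abc: "a = ds ! 0" "c = ds ! 1" "b = ds ! 2"
  define a' c' b' where abc': "a' = ds' ! 0" "c' = ds' ! 1" "b' = ds' ! 2"
  have ds: "ds = [a, c, b]" using list_of_length_three[OF len] by (simp add: abc)
  have pl: "prod_list ds = a * c * b" and pl': "prod_list ds' = a' * c' * b'"
    using prod_list_length_three[OF len] prod_list_length_three[OF len'] by (simp_all add: abc abc')
  have abpos: "0 < a" "0 < c" "0 < b" using pos ds by auto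
  let ?ds = "\<lambda>i. ds[p := fst (Es ! i)]"
  let ?cf = "\<lambda>ds. charlie_first (ds ! 0) (ds ! 1) (ds ! 2)"
  have IH: "\<forall>i<?n. \<exists>\<Lambda>'. locc S' [?ds i ! 1, ?ds i ! 0 * ?ds i ! 2] es \<Lambda>' \<and>
    (\<forall>X\<in>carrier_mat (prod_list (?ds i)) (prod_list (?ds i)). \<Lambda>' (?cf (?ds i) X) = \<Phi> (?cf ds' (\<Lambda> i X)))"
  proof (intro allI impI)
    fix i assume i: "i < ?n"
    have "\<forall>d\<in>set (?ds i). 0 < d"
      using pos instrument_nth(1)[OF inst i] set_update_subset_insert[of ds p] by blast
    then show "\<exists>\<Lambda>'. locc S' [?ds i ! 1, ?ds i ! 0 * ?ds i ! 2] es \<Lambda>' \<and>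
    (\<forall>X\<in>carrier_mat (prod_list (?ds i)) (prod_list (?ds i)). \<Lambda>' (?cf (?ds i) X) = \<Phi> (?cf ds' (\<Lambda> i X)))"
      using locc_step(4) i len len' \<Phi> by simp
  qed
  then obtain L where L: "\<And>i. i < ?n \<Longrightarrow> locc S' [?ds i ! 1, ?ds i ! 0 * ?ds i ! 2] es (L i)"
    and L': "\<And>i X. i < ?n \<Longrightarrow> X \<in> carrier_mat (prod_list (?ds i)) (prod_list (?ds i))
      \<Longrightarrow> L i (?cf (?ds i) X) = \<Phi> (?cf ds' (\<Lambda> i X))"
    by metis
  \<comment> \<open>The simulated step sums over the branches after \<open>\<Phi>\<close> has been
    applied to each of them, the original one before; linearity reconciles the two.\<close>
  have lin: "\<Phi> (?cf ds' (msum (prod_list ds') {..<?n} Y)) = msum (prod_list es) {..<?n} (\<lambda>i. \<Phi> (?cf ds' (Y i)))"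
    if "\<And>i. i < ?n \<Longrightarrow> Y i \<in> carrier_mat (prod_list ds') (prod_list ds')" for Y
  proof -
    have "?cf ds' (msum (prod_list ds') {..<?n} Y) = msum (prod_list [c', a' * b']) {..<?n} (\<lambda>i. ?cf ds' (Y i))"
      using charlie_first_msum[of "{..<?n}" Y a' c' b'] that
      by (simp add: pl' abc' mult.assoc)
    moreover have "?cf ds' (Y i) \<in> carrier_mat (prod_list [c', a' * b']) (prod_list [c', a' * b'])" for i
      using charlie_first_carrier[of a' c' b' "Y i"] by (simp add: abc' mult.assoc)
    ultimately show ?thesis
      using locc_msum[OF \<Phi>, of "{..<?n}" "\<lambda>i. ?cf ds' (Y i)"] by (simp add: abc')
  qed
  \<comment> \<open>One argument for all three parties: party \<open>p'\<close> of
    \<open>C : AB\<close> imitates party \<open>p\<close>, where \<open>f\<close> transforms output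
    dimensions and \<open>g\<close> Kraus operators. The premise on \<open>cswap\<close> carries the
    rearrangement past the step.\<close>
  have step: ?case
    if p': "p' < length [c, a * b]" "p' \<in> S' \<or> ?n = 1"
      and inst': "instrument ([c, a * b] ! p') (map (\<lambda>E. (f (fst E), map g (snd E))) Es)"
      and ds': "\<And>i. i < ?n \<Longrightarrow> [c, a * b][p' := f (fst (Es ! i))] = [?ds i ! 1, ?ds i ! 0 * ?ds i ! 2]"
      and W: "\<And>i K. i < ?n \<Longrightarrow> K \<in> set (snd (Es ! i)) \<Longrightarrow>
        cswap (?ds i ! 0) (?ds i ! 1) (?ds i ! 2) * on_party ds p K = on_party [c, a * b] p' (g K) * cswap a c b"
    for p' f g
  proof (intro exI conjI ballI)
    let ?Es = "map (\<lambda>E. (f (fst E), map g (snd E))) Es"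
    show "locc S' [ds ! 1, ds ! 0 * ds ! 2] es
      (\<lambda>X. msum (prod_list es) {..<length ?Es} (\<lambda>i. L i (local_map [c, a * b] p' (?Es ! i) X)))"
      unfolding abc[symmetric]
      by (rule locc.locc_step) (use p' inst' ds' L in auto)
    fix X :: "complex mat" assume X: "X \<in> carrier_mat (prod_list ds) (prod_list ds)"
    have cf: "local_map [c, a * b] p' (?Es ! i) (?cf ds X) = ?cf (?ds i) (local_map ds p (Es ! i) X)"
      if i: "i < ?n" for i
    proof -
      let ?W = "cswap (?ds i ! 0) (?ds i ! 1) (?ds i ! 2)"
      let ?e = "prod_list [?ds i ! 1, ?ds i ! 0 * ?ds i ! 2]"
      have Ks: "set (map (on_party ds p) (snd (Es ! i))) \<subseteq> carrier_mat (prod_list (?ds i)) (prod_list ds)"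
        using instrument_nth(2)[OF inst i] on_party_carrier[OF p] by auto
      have leni: "length (?ds i) = 3" using len by simp
      have Wc: "?W \<in> carrier_mat ?e (prod_list (?ds i))"
        using cswap_carrier[of "?ds i ! 0" "?ds i ! 1" "?ds i ! 2"] prod_list_length_three[OF leni]
        by (simp add: mult.assoc)
      have Cc: "cswap a c b \<in> carrier_mat (prod_list [c, a * b]) (prod_list ds)"
        using cswap_carrier[of a c b] by (simp add: pl mult.assoc)
      have Ks': "set (map (on_party [c, a * b] p') (map g (snd (Es ! i)))) \<subseteq> carrier_mat ?e (prod_list [c, a * b])"
      proof -
        have "set (map g (snd (Es ! i))) \<subseteq> carrier_mat (f (fst (Es ! i))) ([c, a * b] ! p')"
          using instrument_nth(2)[OF inst', of i] i by simp
        then have "on_party [c, a * b] p' K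
            \<in> carrier_mat (prod_list ([c, a * b][p' := f (fst (Es ! i))])) (prod_list [c, a * b])"
          if "K \<in> set (map g (snd (Es ! i)))" for K
          using that by (intro on_party_carrier[OF p'(1)]) blast
        then show ?thesis unfolding ds'[OF i] set_map[of "on_party _ _"] by blast
      qed
      have "?cf (?ds i) (local_map ds p (Es ! i) X)
          = kraus_map ?e (map ((*) ?W) (map (on_party ds p) (snd (Es ! i)))) X"
        unfolding charlie_first_eq local_map_def by (rule conj_kraus_map[OF Ks Wc X])
      also have "map ((*) ?W) (map (on_party ds p) (snd (Es ! i)))
          = map (\<lambda>K. K * cswap a c b) (map (on_party [c, a * b] p') (map g (snd (Es ! i))))"
        using W[OF i] by simp
      also have "kraus_map ?e \<dots> X = kraus_map ?e (map (on_party [c, a * b] p') (map g (snd (Es ! i)))) (?cf ds X)"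
        unfolding charlie_first_eq abc[symmetric] by (rule kraus_map_conj[OF Ks' Cc X, symmetric])
      finally show ?thesis using i ds'[OF i] by (simp add: local_map_def)
    qed
    have "msum (prod_list es) {..<length ?Es} (\<lambda>i. L i (local_map [c, a * b] p' (?Es ! i) (?cf ds X)))
        = msum (prod_list es) {..<?n} (\<lambda>i. \<Phi> (?cf ds' (\<Lambda> i (local_map ds p (Es ! i) X))))"
      unfolding length_map using cf L' by (intro msum_cong) simp
    also have "\<dots> = \<Phi> (?cf ds' (msum (prod_list ds') {..<?n} (\<lambda>i. \<Lambda> i (local_map ds p (Es ! i) X))))"
      using locc_step(4) by (intro lin[symmetric]) (auto intro: locc_carrier)
    finally show "msum (prod_list es) {..<length ?Es} (\<lambda>i. L i (local_map [c, a * b] p' (?Es ! i) (?cf ds X)))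
        = \<Phi> (?cf ds' (msum (prod_list ds') {..<?n} (\<lambda>i. \<Lambda> i (local_map ds p (Es ! i) X))))" .
  qed
  have nthK: "K \<in> carrier_mat (fst (Es ! i)) (ds ! p)" if "i < ?n" "K \<in> set (snd (Es ! i))" for i K
    using instrument_nth(2)[OF inst that(1)] that(2) by blast
  have party2: "on_party [c, a * b] 0 K = K \<otimes>\<^sub>m 1\<^sub>m (a * b)" "on_party [c, a * b] (Suc 0) K = 1\<^sub>m c \<otimes>\<^sub>m K" for K
    by (simp_all add: on_party_def)
  \<comment> \<open>Padding with identities keeps an instrument an instrument. Alice takes
    \<open>k = 1\<close>, \<open>k' = b\<close> and Bob \<open>k = a\<close>, \<open>k' = 1\<close>.
    The dimensions must be positive since an instrument demands positive output dimensions.\<close>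
  have inst_map: "instrument (k * (ds ! p) * k') (map (\<lambda>E. (k * fst E * k', map (\<lambda>K. 1\<^sub>m k \<otimes>\<^sub>m K \<otimes>\<^sub>m 1\<^sub>m k') (snd E))) Es)"
    if kk: "0 < k" "0 < k'" for k k'
  proof -
    let ?Ks = "concat (map snd Es)"
    have op: "on_party [k, ds ! p, k'] 1 = (\<lambda>K. 1\<^sub>m k \<otimes>\<^sub>m K \<otimes>\<^sub>m 1\<^sub>m k')"
      by (rule ext) (simp add: on_party_def)
    have "gram (prod_list [k, ds ! p, k']) (map (on_party [k, ds ! p, k'] 1) ?Ks)
      = 1\<^sub>m (prod_list (take 1 [k, ds ! p, k'])) \<otimes>\<^sub>m gram ([k, ds ! p, k'] ! 1) ?Ks \<otimes>\<^sub>m 1\<^sub>m (prod_list (drop (Suc 1) [k, ds ! p, k']))"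
      by (rule gram_on_party) (auto dest: instrument_dim_col[OF inst])
    then have "gram (k * (ds ! p) * k') (map (\<lambda>K. 1\<^sub>m k \<otimes>\<^sub>m K \<otimes>\<^sub>m 1\<^sub>m k') ?Ks) = 1\<^sub>m (k * (ds ! p) * k')"
      using inst unfolding op by (simp add: instrument_iff_gram mult.assoc)
    moreover have "concat (map (\<lambda>E. map (\<lambda>K. 1\<^sub>m k \<otimes>\<^sub>m K \<otimes>\<^sub>m 1\<^sub>m k') (snd E)) Es) = map (\<lambda>K. 1\<^sub>m k \<otimes>\<^sub>m K \<otimes>\<^sub>m 1\<^sub>m k') ?Ks"
      by (simp add: map_concat comp_def)
    ultimately show ?thesis
      using inst kk by (fastforce simp: instrument_iff_gram comp_def)
  qed
  have "p = 0 \<or> p = Suc 0 \<or> p = 2" using p ds by auto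
  then show ?case
  proof (elim disjE)
    \<comment> \<open>Alice's step is done by AB, party 1 of the merged protocol. If Alice may not
      speak, her instrument has one outcome and AB announces nothing either.\<close>
    assume p0: "p = 0"
    show ?case
    proof (rule step[of 1 "\<lambda>d. d * b" "\<lambda>K. K \<otimes>\<^sub>m 1\<^sub>m b"])
      show "instrument ([c, a * b] ! 1) (map (\<lambda>E. (fst E * b, map (\<lambda>K. K \<otimes>\<^sub>m 1\<^sub>m b) (snd E))) Es)"
        using inst_map[of 1 b] abpos by (simp add: p0 ds)
    qed (use locc_step(3) S p0 in \<open>auto simp: ds party2 on_party_three intro!: cswap_alice dest!: nthK\<close>)
  next
    assume p1: "p = Suc 0"
    show ?case
    proof (rule step[of 0 "\<lambda>d. d" "\<lambda>K. K"])
      show "instrument ([c, a * b] ! 0) (map (\<lambda>E. (fst E, map (\<lambda>K. K) (snd E))) Es)"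
        using inst by (simp add: p1 ds)
    qed (use locc_step(3) S p1 in \<open>auto simp: ds party2 on_party_three simp del: one_tensor_one intro!: cswap_charlie dest!: nthK\<close>)
  next
    assume p2: "p = 2"
    show ?case
    proof (rule step[of 1 "\<lambda>d. a * d" "\<lambda>K. 1\<^sub>m a \<otimes>\<^sub>m K"])
      show "instrument ([c, a * b] ! 1) (map (\<lambda>E. (a * fst E, map (\<lambda>K. 1\<^sub>m a \<otimes>\<^sub>m K) (snd E))) Es)"
        using inst_map[of a 1] abpos by (simp add: p2 ds)
    qed (use locc_step(3) S p2 in \<open>auto simp: ds party2 on_party_three simp del: one_tensor_one intro!: cswap_bob dest!: nthK\<close>)
  qed
qed

section \<open>LOCC measurements\<close>

text \<open>A channel announces nothing, so it is available to every party whatever \<open>S\<close>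
  is.\<close>

lemma locc_channel_step:
  assumes "p < length ds" "instrument (ds ! p) [(d', Ks)]" "locc S (ds[p := d']) ds' \<Lambda>"
  shows "\<exists>\<Phi>. locc S ds ds' \<Phi> \<and>
    (\<forall>X. \<Phi> X = \<Lambda> (local_map ds p (d', Ks) X))"
proof -
  let ?\<Phi> = "\<lambda>X. msum (prod_list ds') {..<length [(d', Ks)]} (\<lambda>i. \<Lambda> (local_map ds p ([(d', Ks)] ! i) X))"
  have "locc S ds ds' ?\<Phi>"
    by (rule locc.locc_step) (use assms in auto)
  moreover have "?\<Phi> X = \<Lambda> (local_map ds p (d', Ks) X)" for X
  proof -
    have "\<Lambda> (local_map ds p (d', Ks) X) \<in> carrier_mat (prod_list ds') (prod_list ds')"
      by (rule locc_carrier[OF assms(3)]) (use local_map_carrier[of ds p "(d', Ks)" X] in simp)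
    then show ?thesis by (intro eq_matI) auto
  qed
  ultimately show ?thesis by blast
qed

lemma gram_kets: "gram n (map (\<lambda>k. mat_adjoint (ket n k)) [0..<n]) = 1\<^sub>m n"
proof (rule eq_matI)
  fix i j assume "i < dim_row (1\<^sub>m n :: complex mat)" "j < dim_col (1\<^sub>m n :: complex mat)"
  then have ij: "i < n" "j < n" by auto
  have "gram n (map (\<lambda>k. mat_adjoint (ket n k)) [0..<n]) $$ (i, j)
      = (\<Sum>k<n. (if i = k then 1 else 0) * (if j = k then 1 else 0))"
    using ij by (auto simp: gram_def scalar_prod_def intro!: sum.cong)
  also have "\<dots> = (\<Sum>k<n. if k = i then (if j = k then 1 else 0) else 0)" by (intro sum.cong) auto
  also have "\<dots> = (1\<^sub>m n :: complex mat) $$ (i, j)" using ij by simp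
  finally show "gram n (map (\<lambda>k. mat_adjoint (ket n k)) [0..<n]) $$ (i, j) = (1\<^sub>m n :: complex mat) $$ (i, j)" .
qed auto

lemma trace_middle_eq:
  "trace_middle a c b = kraus_map (a * b) (map (\<lambda>k. 1\<^sub>m a \<otimes>\<^sub>m mat_adjoint (ket c k) \<otimes>\<^sub>m 1\<^sub>m b) [0..<c])"
proof -
  have "mat_of_row (unit_vec c k) = mat_adjoint (ket c k)" for k
    by (rule eq_matI) (auto simp: mat_of_row_def unit_vec_def)
  then show ?thesis by (simp add: trace_middle_def)
qed

text \<open>Charlie traces out his system with the Kraus operators \<open><k|\<close>, then AB
  writes the outcome into its own register. Both steps are channels, so the test can also follow a
  protocol with one-way communication from Charlie.\<close>

lemma locc_discard_and_measure:
  assumes Ms: "set Ms \<subseteq> carrier_mat l (a * b)" "gram (a * b) Ms = 1\<^sub>m (a * b)" and l: "0 < l"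
  shows "\<exists>\<Phi>. locc S [c, a * b] [1, l] \<Phi> \<and> (\<forall>Y\<in>carrier_mat (a * c * b) (a * c * b).
    \<Phi> (charlie_first a c b Y) = kraus_map l Ms (trace_middle a c b Y))"
proof -
  let ?N = "a * b" and ?ks = "map (\<lambda>k. mat_adjoint (ket c k)) [0..<c]"
  have "instrument ([1, ?N] ! 1) [(l, Ms)]" using Ms l by (simp add: instrument_iff_gram)
  then obtain \<Psi> where \<Psi>: "locc S [1, ?N] [1, l] \<Psi>" "\<And>X. \<Psi> X = local_map [1, ?N] 1 (l, Ms) X"
    using locc_channel_step[of 1 "[1, ?N]" l Ms S "[1, l]" "\<lambda>X. X"] locc_done[of S "[1, l]"] by auto
  have "instrument ([c, ?N] ! 0) [(1, ?ks)]" by (auto simp: instrument_iff_gram gram_kets)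
  then obtain \<Phi> where \<Phi>: "locc S [c, ?N] [1, l] \<Phi>" "\<And>X. \<Phi> X = \<Psi> (local_map [c, ?N] 0 (1, ?ks) X)"
    using locc_channel_step[of 0 "[c, ?N]" 1 ?ks S "[1, l]" \<Psi>] \<Psi>(1) by auto
  have "\<Phi> (charlie_first a c b Y) = kraus_map l Ms (trace_middle a c b Y)"
    if Y: "Y \<in> carrier_mat (a * c * b) (a * c * b)" for Y
  proof -
    let ?L = "map (\<lambda>k. mat_adjoint (ket c k) \<otimes>\<^sub>m 1\<^sub>m ?N) [0..<c]"
    have Lc: "set ?L \<subseteq> carrier_mat ?N (c * a * b)" by (auto simp: mult.assoc)
    have "local_map [c, ?N] 0 (1, ?ks) (charlie_first a c b Y) = kraus_map ?N ?L (charlie_first a c b Y)"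
      by (simp add: local_map_def on_party_def comp_def)
    also have "\<dots> = kraus_map ?N (map (\<lambda>L. L * cswap a c b) ?L) Y"
      unfolding charlie_first_eq by (rule kraus_map_conj[OF Lc _ Y]) simp
    also have "map (\<lambda>L. L * cswap a c b) ?L = map (\<lambda>k. 1\<^sub>m a \<otimes>\<^sub>m mat_adjoint (ket c k) \<otimes>\<^sub>m 1\<^sub>m b) [0..<c]"
    proof -
      have "(mat_adjoint (ket c k) \<otimes>\<^sub>m 1\<^sub>m ?N) * cswap a c b = 1\<^sub>m a \<otimes>\<^sub>m mat_adjoint (ket c k) \<otimes>\<^sub>m 1\<^sub>m b" for k
      proof -
        have "cswap a 1 b = 1\<^sub>m (a * b)" by (simp add: cswap_def)
        moreover have "1\<^sub>m a \<otimes>\<^sub>m mat_adjoint (ket c k) \<otimes>\<^sub>m 1\<^sub>m b \<in> carrier_mat (a * b) (a * c * b)"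
          by auto
        ultimately show ?thesis
          using cswap_charlie[of "mat_adjoint (ket c k)" 1 c a b] by (auto simp: left_mult_one_mat[of _ "a * b" "a * c * b"])
      qed
      then show ?thesis by simp
    qed
    finally have "local_map [c, ?N] 0 (1, ?ks) (charlie_first a c b Y) = trace_middle a c b Y"
      by (simp add: trace_middle_eq)
    moreover have "map (on_party [1, ?N] (Suc 0)) Ms = Ms"
      by (rule map_idI) (simp add: on_party_def)
    ultimately show ?thesis by (simp add: \<Phi>(2) \<Psi>(2) local_map_def)
  qed
  with \<Phi>(1) show ?thesis by blast
qed

lemma positive_gram:
  assumes "set Ks \<subseteq> carrier_mat e d"
  shows "positive d (gram d Ks)"
proof -
  have "mat_adjoint (gram d Ks) = gram d Ks"
  proof (rule eq_matI)
    fix i j assume "i < dim_row (gram d Ks)" "j < dim_col (gram d Ks)"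
    then have ij: "i < d" "j < d" by auto
    have "(mat_adjoint (Ks ! k) * Ks ! k) $$ (i, j) = cnj ((mat_adjoint (Ks ! k) * Ks ! k) $$ (j, i))"
      if "k < length Ks" for k
    proof -
      have "Ks ! k \<in> carrier_mat e d" using assms that by auto
      then show ?thesis using ij by (auto simp: scalar_prod_def mult.commute intro!: sum.cong)
    qed
    then show "mat_adjoint (gram d Ks) $$ (i, j) = gram d Ks $$ (i, j)"
      using ij by (simp add: gram_def del: index_mult_mat(1))
  qed auto
  moreover have "0 \<le> Re ((gram d Ks *\<^sub>v v) \<bullet>c v)" if v: "v \<in> carrier_vec d" for v
  proof -
    \<comment> \<open>The vector as a one-column matrix: the quadratic form becomes a sum of squared
      norms of \<open>K * ?X\<close>.\<close>
    let ?X = "mat d 1 (\<lambda>(i, j). v $ i)"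
    have X: "?X \<in> carrier_mat d 1" by simp
    have GX: "gram d Ks * ?X \<in> carrier_mat d 1" using X by auto
    have "(gram d Ks *\<^sub>v v) \<bullet>c v = tr (mat_adjoint ?X * (gram d Ks * ?X))"
    proof -
      have "(gram d Ks * ?X) $$ (i, 0) = (gram d Ks *\<^sub>v v) $ i" if "i < d" for i
        using that v by (auto simp: scalar_prod_def intro!: sum.cong)
      then show ?thesis
        unfolding tr_adjoint_mult[OF X GX] using v
        by (auto simp: scalar_prod_def atLeast0LessThan mult.commute simp del: index_mult_mat(1) index_mult_mat_vec intro!: sum.cong)
    qed
    also have "\<dots> = tr (gram d Ks * ?X * mat_adjoint ?X)"
      by (rule tr_mult_commute[OF mat_adjoint_carrier[OF X] GX])
    also have "\<dots> = tr (kraus_map e Ks (?X * mat_adjoint ?X))"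
      using X by (subst tr_kraus_map[OF assms]) (auto simp: mult_mat_assoc)
    also have "\<dots> = complex_of_real (\<Sum>K\<leftarrow>Ks. (fnorm (K * ?X))\<^sup>2)"
      by (rule tr_kraus_map_gram[OF assms X])
    finally show ?thesis by (auto intro!: sum_list_nonneg)
  qed
  ultimately show ?thesis by (simp add: positive_def)
qed

lemma gram_map_mult_left:
  assumes "set Ks \<subseteq> carrier_mat e d" "L \<in> carrier_mat e' e"
  shows "gram d (map ((*) L) Ks) = kraus_map d (map mat_adjoint Ks) (mat_adjoint L * L)"
  using assms(1)
proof (induction Ks)
  case (Cons K Ks)
  then have K: "K \<in> carrier_mat e d" by simp
  have "mat_adjoint (L * K) * (L * K) = mat_adjoint K * (mat_adjoint L * L) * mat_adjoint (mat_adjoint K)"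
    using carrier_matD[OF K] carrier_matD[OF assms(2)] by (simp add: mat_adjoint_mult mult_mat_assoc)
  with Cons show ?case
    by (simp add: gram_Cons[OF mult_carrier_mat[OF assms(2) K]] kraus_map_Cons[OF mat_adjoint_carrier[OF K]])
qed simp

text \<open>The effects are the basis projectors of the output register, pulled back through the
  Kraus operators. Reading out the register does not disturb an output that is already diagonal, so
  the POVM reproduces \<open>\<Lambda>\<close>.\<close>

lemma diagonal_locc_povm:
  assumes \<Lambda>: "locc S [dC, dAB] [1, n] \<Lambda>"
    and diag: "\<And>X. X \<in> carrier_mat (dC * dAB) (dC * dAB) \<Longrightarrow> \<exists>f. \<Lambda> X = mat_diag n f"
  shows "\<exists>Ms\<in>locc_povms S dC dAB. length Ms = n \<and>
    (\<forall>X\<in>carrier_mat (dC * dAB) (dC * dAB). measure_map Ms X = \<Lambda> X)"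
proof -
  let ?D = "dC * dAB"
  obtain Ks where "\<And>K. K \<in> set Ks \<Longrightarrow> local_op [dC, dAB] [1, n] K"
    "gram (prod_list [dC, dAB]) Ks = 1\<^sub>m (prod_list [dC, dAB])"
    "\<And>X. X \<in> carrier_mat (prod_list [dC, dAB]) (prod_list [dC, dAB]) \<Longrightarrow> \<Lambda> X = kraus_map (prod_list [1, n]) Ks X"
    using locc_kraus[OF \<Lambda>] by blast
  then have Ks: "set Ks \<subseteq> carrier_mat n ?D" "gram ?D Ks = 1\<^sub>m ?D"
    "\<And>X. X \<in> carrier_mat ?D ?D \<Longrightarrow> \<Lambda> X = kraus_map n Ks X"
    using local_op_carrier[of "[dC, dAB]" "[1, n]"] by auto
  define M where "M i = gram ?D (map ((*) (mat_adjoint (ket n i))) Ks)" for i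
  define Ms where "Ms = map M [0..<n]"
  have lc: "set (map ((*) (mat_adjoint (ket n i))) Ks) \<subseteq> carrier_mat 1 ?D" for i
    using Ks(1) mult_carrier_mat[of "mat_adjoint (ket n i)" 1 n] by auto
  have povm: "povm ?D Ms"
  proof -
    \<comment> \<open>The projectors add up to the identity, and the pull-back of the identity is
      \<open>gram ?D Ks\<close>.\<close>
    have "msum ?D {..<n} M = kraus_map ?D (map mat_adjoint Ks) (msum n {..<n} (\<lambda>i. ket n i * mat_adjoint (ket n i)))"
    proof (subst kraus_map_msum)
      show "set (map mat_adjoint Ks) \<subseteq> carrier_mat ?D n" using Ks(1) by auto
      show "msum ?D {..<n} M = msum ?D {..<n} (\<lambda>i. kraus_map ?D (map mat_adjoint Ks) (ket n i * mat_adjoint (ket n i)))"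
        unfolding M_def using gram_map_mult_left[OF Ks(1), of "mat_adjoint (ket n _)" 1]
        by (intro msum_cong) simp
    qed auto
    also have "msum n {..<n} (\<lambda>i. ket n i * mat_adjoint (ket n i)) = gram n (map (\<lambda>k. mat_adjoint (ket n k)) [0..<n])"
      unfolding gram_def by (simp, intro msum_cong) simp
    also have "kraus_map ?D (map mat_adjoint Ks) \<dots> = 1\<^sub>m ?D"
      unfolding gram_kets gram_eq_kraus_map[OF Ks(1), symmetric] by (rule Ks(2))
    finally have "msum ?D {..<n} M = 1\<^sub>m ?D" .
    moreover have "msum ?D {..<length Ms} (\<lambda>i. Ms ! i) = msum ?D {..<n} M"
      unfolding Ms_def length_map length_upt by (rule trans[OF msum_cong[of _ _ "M"]]) auto
    ultimately show ?thesis
      using positive_gram[OF lc] by (auto simp: povm_def Ms_def M_def)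
  qed
  have meas: "measure_map Ms X = \<Lambda> X" if X: "X \<in> carrier_mat ?D ?D" for X
  proof -
    obtain f where f: "\<Lambda> X = mat_diag n f" using diag[OF X] by blast
    have tr: "tr (M i * X) = f i" if i: "i < n" for i
    proof -
      have "tr (M i * X) = tr (kraus_map 1 (map ((*) (mat_adjoint (ket n i))) Ks) X)"
        unfolding M_def by (rule tr_kraus_map[OF lc X, symmetric])
      also have "\<dots> = tr (mat_adjoint (ket n i) * kraus_map n Ks X * mat_adjoint (mat_adjoint (ket n i)))"
        by (subst conj_kraus_map[OF Ks(1) _ X]) auto
      also have "\<dots> = tr (mat_adjoint (ket n i) * (\<Lambda> X * ket n i))"
        unfolding Ks(3)[OF X] by (simp add: mult_mat_assoc)
      also have "\<dots> = f i" unfolding f using i by (subst ket_adjoint_mult) (auto simp: mat_diag_def)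
      finally show ?thesis .
    qed
    show ?thesis unfolding f measure_map_def
      by (rule eq_matI) (auto simp: mat_diag_def Ms_def tr)
  qed
  have "Ms \<in> locc_povms S dC dAB"
    using povm \<Lambda> meas by (auto simp: locc_povms_def Ms_def)
  with meas show ?thesis by (intro bexI[of _ Ms]) (auto simp: Ms_def)
qed

section \<open>Private states as twisted maximally entangled states\<close>

text \<open>The rectangular counterpart of \<open>msum\<close>: the isometry behind a private state
  maps between spaces of different dimensions.\<close>

definition rsum :: "nat \<Rightarrow> nat \<Rightarrow> 'i set \<Rightarrow> ('i \<Rightarrow> complex mat) \<Rightarrow> complex mat" where
  "rsum n m I f = mat n m (\<lambda>(r, c). \<Sum>i\<in>I. f i $$ (r, c))"

lemma rsum_carrier [simp]: "rsum n m I f \<in> carrier_mat n m"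
  by (simp add: rsum_def)

lemma rsum_dim [simp]: "dim_row (rsum n m I f) = n" "dim_col (rsum n m I f) = m"
  by (simp_all add: rsum_def)

lemma rsum_index [simp]: "r < n \<Longrightarrow> c < m \<Longrightarrow> rsum n m I f $$ (r, c) = (\<Sum>i\<in>I. f i $$ (r, c))"
  by (simp add: rsum_def)

lemma rsum_cong: "(\<And>i. i \<in> I \<Longrightarrow> f i = g i) \<Longrightarrow> rsum n m I f = rsum n m I g"
  by (auto simp: rsum_def intro!: cong_mat sum.cong)

lemma mult_rsum:
  assumes "L \<in> carrier_mat k n" "\<And>i. i \<in> I \<Longrightarrow> f i \<in> carrier_mat n m"
  shows "L * rsum n m I f = rsum k m I (\<lambda>i. L * f i)"
proof (rule eq_matI)
  fix r c assume "r < dim_row (rsum k m I (\<lambda>i. L * f i))" "c < dim_col (rsum k m I (\<lambda>i. L * f i))"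
  then have rc: "r < k" "c < m" by auto
  have "(L * rsum n m I f) $$ (r, c) = (\<Sum>s<n. \<Sum>i\<in>I. L $$ (r, s) * f i $$ (s, c))"
    using rc assms by (auto simp: scalar_prod_def atLeast0LessThan sum_distrib_left intro!: sum.cong)
  also have "\<dots> = (\<Sum>i\<in>I. \<Sum>s<n. L $$ (r, s) * f i $$ (s, c))" by (rule sum.swap)
  also have "\<dots> = rsum k m I (\<lambda>i. L * f i) $$ (r, c)"
  proof -
    have "(L * f i) $$ (r, c) = (\<Sum>s<n. L $$ (r, s) * f i $$ (s, c))" if "i \<in> I" for i
      using assms(1) assms(2)[OF that] rc by (auto simp: scalar_prod_def atLeast0LessThan intro!: sum.cong)
    then show ?thesis using rc by simp
  qed
  finally show "(L * rsum n m I f) $$ (r, c) = rsum k m I (\<lambda>i. L * f i) $$ (r, c)" .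
qed (use assms in auto)

lemma rsum_adjoint:
  assumes "\<And>i. i \<in> I \<Longrightarrow> f i \<in> carrier_mat n m"
  shows "mat_adjoint (rsum n m I f) = rsum m n I (\<lambda>i. mat_adjoint (f i))"
proof (rule eq_matI)
  fix r c assume "r < dim_row (rsum m n I (\<lambda>i. mat_adjoint (f i)))" "c < dim_col (rsum m n I (\<lambda>i. mat_adjoint (f i)))"
  then have rc: "r < m" "c < n" by auto
  have "cnj (f i $$ (c, r)) = mat_adjoint (f i) $$ (r, c)" if "i \<in> I" for i
    using assms[OF that] rc by simp
  then show "mat_adjoint (rsum n m I f) $$ (r, c) = rsum m n I (\<lambda>i. mat_adjoint (f i)) $$ (r, c)"
    using rc by simp
qed auto

text \<open>Obtained from \<open>mult_rsum\<close> by taking adjoints.\<close>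

lemma rsum_mult:
  assumes "\<And>i. i \<in> I \<Longrightarrow> f i \<in> carrier_mat n m" "L \<in> carrier_mat m k"
  shows "rsum n m I f * L = rsum n k I (\<lambda>i. f i * L)"
proof -
  have "mat_adjoint L * mat_adjoint (rsum n m I f) = rsum k n I (\<lambda>i. mat_adjoint L * mat_adjoint (f i))"
    using assms by (simp add: rsum_adjoint[of I f n m] mult_rsum[of _ k m])
  also have "\<dots> = rsum k n I (\<lambda>i. mat_adjoint (f i * L))"
    using carrier_matD(2)[OF assms(1)] carrier_matD(1)[OF assms(2)]
    by (intro rsum_cong) (simp add: mat_adjoint_mult)
  also have "\<dots> = mat_adjoint (rsum n k I (\<lambda>i. f i * L))"
    by (intro rsum_adjoint[symmetric] mult_carrier_mat[OF assms])
  finally have "mat_adjoint (mat_adjoint (rsum n m I f * L)) = rsum n k I (\<lambda>i. f i * L)"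
    using assms by (subst mat_adjoint_mult) auto
  then show ?thesis by simp
qed

lemma conj_smult:
  fixes W X :: "complex mat"
  assumes "W \<in> carrier_mat n m" "X \<in> carrier_mat m m"
  shows "W * (c \<cdot>\<^sub>m X) * mat_adjoint W = c \<cdot>\<^sub>m (W * X * mat_adjoint W)"
  using assms by (simp add: mult_smult_distrib[OF assms] mult_smult_assoc_mat[of _ n m _ n])

lemma rsum_empty [simp]: "rsum n m {} f = 0\<^sub>m n m"
  by (rule eq_matI) auto

lemma rsum_insert:
  assumes "finite I" "i \<notin> I" "f i \<in> carrier_mat n m"
  shows "rsum n m (insert i I) f = f i + rsum n m I f"
  using assms by (intro eq_matI) auto

lemma fnorm_triangle:
  assumes "A \<in> carrier_mat n m" "B \<in> carrier_mat n m"
  shows "fnorm (A + B) \<le> fnorm A + fnorm B"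
proof -
  let ?I = "{..<n} \<times> {..<m}"
  have "fnorm (A + B) \<le> L2_set (\<lambda>x. (\<lambda>(i, j). cmod (A $$ (i, j))) x + (\<lambda>(i, j). cmod (B $$ (i, j))) x) ?I"
    unfolding fnorm_def using assms by (auto intro!: L2_set_mono norm_triangle_ineq)
  also have "\<dots> \<le> fnorm A + fnorm B"
    unfolding fnorm_def using assms L2_set_triangle_ineq[of "\<lambda>(i, j). cmod (A $$ (i, j))" "\<lambda>(i, j). cmod (B $$ (i, j))" ?I]
    by simp
  finally show ?thesis .
qed

lemma fnorm_zero [simp]: "fnorm (0\<^sub>m n m) = 0"
  by (auto simp: fnorm_def L2_set_def intro!: sum.neutral)

lemma fnorm_rsum_le:
  assumes "finite I" "\<And>i. i \<in> I \<Longrightarrow> f i \<in> carrier_mat n m"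
  shows "fnorm (rsum n m I f) \<le> (\<Sum>i\<in>I. fnorm (f i))"
  using assms
proof (induction I rule: finite_induct)
  case (insert i I)
  then have "fnorm (rsum n m (insert i I) f) \<le> fnorm (f i) + fnorm (rsum n m I f)"
    by (simp add: rsum_insert fnorm_triangle[of _ n m])
  with insert show ?case by simp
qed simp

text \<open>The vectors \<open>|i\<rangle>\<^sub>A |i\<rangle>\<^sub>B\<close> tensored with the identity on the shield, in the order \<open>A A' B B'\<close>.\<close>

definition key_ket :: "nat \<Rightarrow> nat \<Rightarrow> nat \<Rightarrow> nat \<Rightarrow> complex mat" where
  "key_ket d a b i = (ket d i \<otimes>\<^sub>m 1\<^sub>m a) \<otimes>\<^sub>m (ket d i \<otimes>\<^sub>m 1\<^sub>m b)"

lemma key_ket_dim [simp]: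
  "dim_row (key_ket d a b i) = (d * a) * (d * b)" "dim_col (key_ket d a b i) = a * b"
  by (simp_all add: key_ket_def)

lemma key_ket_carrier [simp]: "key_ket d a b i \<in> carrier_mat ((d * a) * (d * b)) (a * b)"
  by auto

lemma ket_adjoint_mult_ket:
  assumes "i < n" "j < n"
  shows "mat_adjoint (ket n i) * ket n j = (if i = j then 1\<^sub>m 1 else 0\<^sub>m 1 1)"
proof (rule eq_matI)
  fix r c assume "r < dim_row (if i = j then 1\<^sub>m 1 else 0\<^sub>m 1 1 :: complex mat)"
    "c < dim_col (if i = j then 1\<^sub>m 1 else 0\<^sub>m 1 1 :: complex mat)"
  then have rc: "r = 0" "c = 0" by (auto split: if_splits)
  have "(mat_adjoint (ket n i) * ket n j) $$ (0, 0) = (\<Sum>k<n. (if k = i then 1 else 0) * (if k = j then 1 else 0))"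
    by (auto simp: scalar_prod_def atLeast0LessThan intro!: sum.cong)
  also have "\<dots> = (\<Sum>k<n. if k = i then (if k = j then 1 else 0) else 0)" by (intro sum.cong) auto
  also have "\<dots> = (if i = j then 1 else 0)" using assms by simp
  finally show "(mat_adjoint (ket n i) * ket n j) $$ (r, c) = (if i = j then 1\<^sub>m 1 else 0\<^sub>m 1 1 :: complex mat) $$ (r, c)"
    using rc by simp
qed auto

lemma key_ket_orthonormal:
  assumes "i < d" "j < d"
  shows "mat_adjoint (key_ket d a b i) * key_ket d a b j = (if i = j then 1\<^sub>m (a * b) else 0\<^sub>m (a * b) (a * b))"
  using ket_adjoint_mult_ket[OF assms]
  by (simp add: key_ket_def mat_adjoint_tensor tensor_mult)

text \<open>A column \<open>|i>\<close> is an operator from a one-dimensional space, so moving it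
  past the shield \<open>A'\<close> is naturality of the swap with one trivial system. This
  translates the order \<open>A B A' B'\<close> of the defining formula to
  \<open>A A' B B'\<close>.\<close>

lemma swap_key_kets:
  "(1\<^sub>m d \<otimes>\<^sub>m swap_mat d a \<otimes>\<^sub>m 1\<^sub>m b) * (ket d i \<otimes>\<^sub>m ket d i \<otimes>\<^sub>m 1\<^sub>m (a * b)) = key_ket d a b i"
proof -
  have s: "swap_mat d a * (ket d i \<otimes>\<^sub>m 1\<^sub>m a) = 1\<^sub>m a \<otimes>\<^sub>m ket d i"
    using swap_mat_tensor[of "ket d i" d 1 "1\<^sub>m a" a a]
    by (simp add: right_mult_one_mat[of _ "a * d" a])
  have "ket d i \<otimes>\<^sub>m ket d i \<otimes>\<^sub>m 1\<^sub>m (a * b) = ket d i \<otimes>\<^sub>m (ket d i \<otimes>\<^sub>m 1\<^sub>m a) \<otimes>\<^sub>m 1\<^sub>m b"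
    by (simp only: tensor_assoc one_tensor_one)
  then have "(1\<^sub>m d \<otimes>\<^sub>m swap_mat d a \<otimes>\<^sub>m 1\<^sub>m b) * (ket d i \<otimes>\<^sub>m ket d i \<otimes>\<^sub>m 1\<^sub>m (a * b))
      = ket d i \<otimes>\<^sub>m (swap_mat d a * (ket d i \<otimes>\<^sub>m 1\<^sub>m a)) \<otimes>\<^sub>m 1\<^sub>m b"
    by (simp add: tensor_mult left_mult_one_mat[of _ d 1])
  also have "\<dots> = key_ket d a b i" by (simp only: s key_ket_def tensor_assoc)
  finally show ?thesis .
qed

text \<open>
  The isometry \<open>R = d\<^sup>-\<^sup>1\<^sup>/\<^sup>2 \<Sum>\<^sub>i |ii\<rangle> \<otimes> U\<^sub>i\<close>: the private state is \<open>R \<sigma> R\<^sup>*\<close>, and \<open>R R\<^sup>*\<close> is the projector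
  onto the twisted maximally entangled state.
\<close>

definition twist :: "nat \<Rightarrow> nat \<Rightarrow> nat \<Rightarrow> (nat \<Rightarrow> complex mat) \<Rightarrow> complex mat" where
  "twist d a b U = complex_of_real (1 / sqrt d) \<cdot>\<^sub>m
     rsum ((d * a) * (d * b)) (a * b) {..<d} (\<lambda>i. key_ket d a b i * U i)"

lemma twist_carrier [simp]: "twist d a b U \<in> carrier_mat ((d * a) * (d * b)) (a * b)"
  by (simp add: twist_def)

lemma twist_dim [simp]:
  "dim_row (twist d a b U) = (d * a) * (d * b)" "dim_col (twist d a b U) = a * b"
  by (simp_all add: twist_def)

context
  fixes d a b :: nat and U :: "nat \<Rightarrow> complex mat"
  assumes d: "0 < d" and U: "\<And>i. i < d \<Longrightarrow> unitary (a * b) (U i)"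
begin

lemma key_unitary_carrier: "i < d \<Longrightarrow> key_ket d a b i * U i \<in> carrier_mat ((d * a) * (d * b)) (a * b)"
  using unitaryD(1)[OF U] by (intro mult_carrier_mat[of _ _ "a * b"]) auto

lemma twist_adjoint:
  "mat_adjoint (twist d a b U) = complex_of_real (1 / sqrt d) \<cdot>\<^sub>m
     rsum (a * b) ((d * a) * (d * b)) {..<d} (\<lambda>i. mat_adjoint (U i) * mat_adjoint (key_ket d a b i))"
proof -
  have "mat_adjoint (rsum ((d * a) * (d * b)) (a * b) {..<d} (\<lambda>i. key_ket d a b i * U i))
    = rsum (a * b) ((d * a) * (d * b)) {..<d} (\<lambda>i. mat_adjoint (key_ket d a b i * U i))"
    by (intro rsum_adjoint key_unitary_carrier) simp
  also have "\<dots> = rsum (a * b) ((d * a) * (d * b)) {..<d} (\<lambda>i. mat_adjoint (U i) * mat_adjoint (key_ket d a b i))"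
    using unitaryD(4)[OF U] by (intro rsum_cong mat_adjoint_mult) simp
  finally show ?thesis by (simp add: twist_def mat_adjoint_smult)
qed

text \<open>The vectors \<open>|ii>\<close> are orthonormal, so the cross terms vanish; each of the
  \<open>d\<close> remaining terms is \<open>U_i^* U_i = 1\<close>, and the prefactors contribute
  \<open>1 / d\<close>.\<close>

lemma twist_isometry: "mat_adjoint (twist d a b U) * twist d a b U = 1\<^sub>m (a * b)"
proof -
  let ?n = "(d * a) * (d * b)" and ?F = "\<lambda>i. key_ket d a b i * U i"
  let ?G = "rsum ?n (a * b) {..<d} ?F"
  have FF: "mat_adjoint (?F i) * ?F j = (if i = j then 1\<^sub>m (a * b) else 0\<^sub>m (a * b) (a * b))"
    if ij: "i < d" "j < d" for i j
  proof -
    note Ui = unitaryD[OF U[OF ij(1)]] and Uj = unitaryD[OF U[OF ij(2)]]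
    have "mat_adjoint (?F i) * ?F j
      = mat_adjoint (U i) * (mat_adjoint (key_ket d a b i) * key_ket d a b j) * U j"
      using Ui(4,5) Uj(4,5) by (simp add: mat_adjoint_mult mult_mat_assoc)
    then show ?thesis
      using key_ket_orthonormal[OF ij] Ui Uj
      by (simp add: right_mult_one_mat[of _ "a * b" "a * b"] right_mult_zero_mat[of _ "a * b" "a * b"]
          left_mult_zero_mat[of _ "a * b"])
  qed
  have "mat_adjoint ?G * ?G = rsum (a * b) (a * b) {..<d} (\<lambda>j. mat_adjoint ?G * ?F j)"
    by (intro mult_rsum key_unitary_carrier) auto
  also have "\<dots> = rsum (a * b) (a * b) {..<d} (\<lambda>j. 1\<^sub>m (a * b))"
  proof (rule rsum_cong)
    fix j assume "j \<in> {..<d}"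
    then have j: "j < d" by simp
    have "mat_adjoint ?G * ?F j = rsum (a * b) ?n {..<d} (\<lambda>i. mat_adjoint (?F i)) * ?F j"
      by (subst rsum_adjoint) (auto intro: key_unitary_carrier)
    also have "\<dots> = rsum (a * b) (a * b) {..<d} (\<lambda>i. mat_adjoint (?F i) * ?F j)"
      using key_unitary_carrier j by (intro rsum_mult) auto
    also have "\<dots> = rsum (a * b) (a * b) {..<d} (\<lambda>i. if i = j then 1\<^sub>m (a * b) else 0\<^sub>m (a * b) (a * b))"
      by (intro rsum_cong FF) (use j in auto)
    also have "\<dots> = 1\<^sub>m (a * b)"
    proof (rule eq_matI)
      fix r c assume "r < dim_row (1\<^sub>m (a * b) :: complex mat)" "c < dim_col (1\<^sub>m (a * b) :: complex mat)"
      moreover have "(\<Sum>i<d. (if i = j then 1\<^sub>m (a * b) else 0\<^sub>m (a * b) (a * b)) $$ (r, c))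
        = (\<Sum>i<d. if i = j then (1\<^sub>m (a * b) :: complex mat) $$ (r, c) else 0)"
        using calculation by (intro sum.cong) auto
      ultimately show "rsum (a * b) (a * b) {..<d} (\<lambda>i. if i = j then 1\<^sub>m (a * b) else 0\<^sub>m (a * b) (a * b)) $$ (r, c)
        = (1\<^sub>m (a * b) :: complex mat) $$ (r, c)"
        using j by simp
    qed auto
    finally show "mat_adjoint ?G * ?F j = 1\<^sub>m (a * b)" .
  qed
  also have "\<dots> = complex_of_real d \<cdot>\<^sub>m 1\<^sub>m (a * b)" by (rule eq_matI) auto
  finally have GG: "mat_adjoint ?G * ?G = complex_of_real d \<cdot>\<^sub>m 1\<^sub>m (a * b)" .
  have "mat_adjoint (twist d a b U) * twist d a b U
    = (complex_of_real (1 / sqrt d) * complex_of_real (1 / sqrt d)) \<cdot>\<^sub>m (mat_adjoint ?G * ?G)"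
    by (simp add: twist_def mat_adjoint_smult mult_smult_distrib[of _ "a * b" ?n] mult_smult_assoc_mat[of _ "a * b" ?n])
       (rule eq_matI, auto)
  also have "\<dots> = 1\<^sub>m (a * b)"
    unfolding GG using d by (intro eq_matI) (auto simp flip: of_real_mult)
  finally show ?thesis .
qed

text \<open>For \<open>w = R^* u\<close>, the square of \<open>fnorm w\<close> is the inner product
  of \<open>R w\<close> with \<open>u\<close>, which by Cauchy-Schwarz and the isometry property is
  at most \<open>fnorm w\<close> times \<open>fnorm u\<close>.\<close>

lemma fnorm_twist_adjoint_le:
  assumes "u \<in> carrier_mat ((d * a) * (d * b)) k"
  shows "fnorm (mat_adjoint (twist d a b U) * u) \<le> fnorm u"
proof -
  let ?R = "twist d a b U"
  let ?w = "mat_adjoint ?R * u"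
  have u: "dim_row u = (d * a) * (d * b)" "dim_col u = k" using assms by auto
  have w: "?R * ?w \<in> carrier_mat ((d * a) * (d * b)) k" using u by auto
  have "mat_adjoint ?w * ?w = mat_adjoint (?R * ?w) * u"
    using u by (simp add: mat_adjoint_mult mult_mat_assoc)
  then have "(fnorm ?w)\<^sup>2 = cmod (tr (mat_adjoint (?R * ?w) * u))"
    using tr_adjoint_mult_self[of ?w] by (simp add: norm_power)
  also have "\<dots> \<le> fnorm (?R * ?w) * fnorm u" using w assms by (rule cmod_tr_adjoint_mult_le)
  also have "fnorm (?R * ?w) = fnorm ?w"
    using twist_isometry by (rule fnorm_mult_isometry) auto
  finally have "fnorm ?w * fnorm ?w \<le> fnorm ?w * fnorm u" by (simp add: power2_eq_square)
  then show ?thesis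
    using fnorm_nonneg[of ?w] fnorm_nonneg[of u] by (cases "fnorm ?w = 0") (auto simp: mult_le_cancel_left)
qed

text \<open>The amplitude is \<open>d^(-1/2)\<close> times the sum over \<open>i\<close> of
  \<open>U_i^*\<close> applied to the tensor product of the slices \<open><i| x\<close> and
  \<open><i| y\<close>. The unitaries may entangle the shields, but after the triangle inequality
  each stands alone inside a norm and drops out; the norms of the slices then factorise.\<close>

lemma fnorm_twist_product_le:
  assumes x: "x \<in> carrier_mat (d * a) k" and y: "y \<in> carrier_mat (d * b) k'"
  shows "(fnorm (mat_adjoint (twist d a b U) * (x \<otimes>\<^sub>m y)))\<^sup>2 \<le> 1 / d * (fnorm (x \<otimes>\<^sub>m y))\<^sup>2"
proof -
  let ?n = "(d * a) * (d * b)"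
  define \<alpha> where "\<alpha> i = fnorm ((mat_adjoint (ket d i) \<otimes>\<^sub>m 1\<^sub>m a) * x)" for i
  define \<beta> where "\<beta> i = fnorm ((mat_adjoint (ket d i) \<otimes>\<^sub>m 1\<^sub>m b) * y)" for i
  \<comment> \<open>The projections on the key basis resolve the identity, so the slices of
    \<open>z\<close> carry its whole squared norm.\<close>
  have slices: "(\<Sum>i<d. (fnorm ((mat_adjoint (ket d i) \<otimes>\<^sub>m 1\<^sub>m c) * z))\<^sup>2) = (fnorm z)\<^sup>2"
    if z: "z \<in> carrier_mat (d * c) l" for z c l
  proof -
    let ?Ks = "map (\<lambda>K. K \<otimes>\<^sub>m 1\<^sub>m c) (map (\<lambda>i. mat_adjoint (ket d i)) [0..<d])"
    have Ks: "set ?Ks \<subseteq> carrier_mat (1 * c) (d * c)" by auto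
    have zz: "z * mat_adjoint z \<in> carrier_mat (d * c) (d * c)" using z by auto
    have "complex_of_real (\<Sum>K\<leftarrow>?Ks. (fnorm (K * z))\<^sup>2) = tr (kraus_map (1 * c) ?Ks (z * mat_adjoint z))"
      by (rule tr_kraus_map_gram[OF Ks z, symmetric])
    also have "\<dots> = tr (gram (d * c) ?Ks * (z * mat_adjoint z))" by (rule tr_kraus_map[OF Ks zz])
    also have "gram (d * c) ?Ks = 1\<^sub>m (d * c)"
      by (subst gram_tensor_one[of _ 1]) (auto simp: gram_kets)
    also have "tr (1\<^sub>m (d * c) * (z * mat_adjoint z)) = complex_of_real ((fnorm z)\<^sup>2)"
      by (simp only: left_mult_one_mat[OF zz] tr_mult_adjoint_self)
    finally have "(\<Sum>K\<leftarrow>?Ks. (fnorm (K * z))\<^sup>2) = (fnorm z)\<^sup>2" by (simp only: of_real_eq_iff)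
    then show ?thesis by (simp add: comp_def interv_sum_list_conv_sum_set_nat atLeast0LessThan)
  qed
  have F: "mat_adjoint (U i) * mat_adjoint (key_ket d a b i) \<in> carrier_mat (a * b) ?n" if "i < d" for i
    using unitaryD(1)[OF U[OF that]] by (intro mult_carrier_mat[of _ _ "a * b"]) auto
  have xy: "x \<otimes>\<^sub>m y \<in> carrier_mat ?n (k * k')" using x y by auto
  have term_le: "fnorm (mat_adjoint (U i) * mat_adjoint (key_ket d a b i) * (x \<otimes>\<^sub>m y)) = \<alpha> i * \<beta> i"
    if i: "i < d" for i
  proof -
    note Ui = unitaryD[OF U[OF i]]
    have "mat_adjoint (U i) * mat_adjoint (key_ket d a b i) * (x \<otimes>\<^sub>m y)
      = mat_adjoint (U i) * (mat_adjoint (key_ket d a b i) * (x \<otimes>\<^sub>m y))"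
      using Ui x y by (intro mult_mat_assoc) auto
    also have "fnorm \<dots> = fnorm (mat_adjoint (key_ket d a b i) * (x \<otimes>\<^sub>m y))"
      using Ui by (intro fnorm_mult_isometry[of _ "a * b"]) auto
    also have "mat_adjoint (key_ket d a b i) * (x \<otimes>\<^sub>m y)
      = ((mat_adjoint (ket d i) \<otimes>\<^sub>m 1\<^sub>m a) * x) \<otimes>\<^sub>m ((mat_adjoint (ket d i) \<otimes>\<^sub>m 1\<^sub>m b) * y)"
      using x y by (simp add: key_ket_def mat_adjoint_tensor tensor_mult)
    finally show ?thesis by (simp add: fnorm_tensor \<alpha>_def \<beta>_def)
  qed
  let ?G = "rsum (a * b) ?n {..<d} (\<lambda>i. mat_adjoint (U i) * mat_adjoint (key_ket d a b i))"
  have "fnorm (?G * (x \<otimes>\<^sub>m y)) \<le> (\<Sum>i<d. \<alpha> i * \<beta> i)"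
  proof -
    have "?G * (x \<otimes>\<^sub>m y) = rsum (a * b) (k * k') {..<d} (\<lambda>i. mat_adjoint (U i) * mat_adjoint (key_ket d a b i) * (x \<otimes>\<^sub>m y))"
      using F xy by (intro rsum_mult) auto
    also have "fnorm \<dots> \<le> (\<Sum>i<d. fnorm (mat_adjoint (U i) * mat_adjoint (key_ket d a b i) * (x \<otimes>\<^sub>m y)))"
      by (intro fnorm_rsum_le mult_carrier_mat[OF F xy]) auto
    also have "\<dots> = (\<Sum>i<d. \<alpha> i * \<beta> i)" using term_le by (intro sum.cong) auto
    finally show ?thesis .
  qed
  \<comment> \<open>Cauchy-Schwarz over the key index. The bound has no factor \<open>d\<close>, so
    the squared prefactor of the twist survives as \<open>1 / d\<close>.\<close>
  also have "\<dots> \<le> L2_set \<alpha> {..<d} * L2_set \<beta> {..<d}"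
    using L2_set_mult_ineq[of \<alpha> \<beta> "{..<d}"] by (simp add: \<alpha>_def \<beta>_def)
  also have "L2_set \<alpha> {..<d} = fnorm x"
    unfolding L2_set_def \<alpha>_def slices[OF x] by simp
  also have "L2_set \<beta> {..<d} = fnorm y"
    unfolding L2_set_def \<beta>_def slices[OF y] by simp
  finally have G: "fnorm (?G * (x \<otimes>\<^sub>m y)) \<le> fnorm (x \<otimes>\<^sub>m y)" by (simp add: fnorm_tensor)
  have "mat_adjoint (twist d a b U) * (x \<otimes>\<^sub>m y) = complex_of_real (1 / sqrt d) \<cdot>\<^sub>m (?G * (x \<otimes>\<^sub>m y))"
    unfolding twist_adjoint using xy by (intro mult_smult_assoc_mat[of _ _ ?n]) auto
  then have "(fnorm (mat_adjoint (twist d a b U) * (x \<otimes>\<^sub>m y)))\<^sup>2 = 1 / d * (fnorm (?G * (x \<otimes>\<^sub>m y)))\<^sup>2"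
    by (simp add: fnorm_smult power_mult_distrib power_divide norm_divide)
  also have "\<dots> \<le> 1 / d * (fnorm (x \<otimes>\<^sub>m y))\<^sup>2"
    using G by (intro mult_left_mono power_mono) auto
  finally show ?thesis .
qed

end

lemma ketbra_eq: "ketbra n i j = ket n i * mat_adjoint (ket n j)"
  by (rule eq_matI) (auto simp: ketbra_def scalar_prod_def)

text \<open>Expanding \<open>R \<sigma> R^*\<close> gives the double sum of the definition; what
  takes work is the reordering of the systems.\<close>

lemma private_state_eq_twist:
  assumes "\<gamma> \<in> private_states m a b"
  shows "\<exists>\<sigma> U. density (a * b) \<sigma> \<and> (\<forall>i<2 ^ m. unitary (a * b) (U i)) \<and>
    \<gamma> = twist (2 ^ m) a b U * \<sigma> * mat_adjoint (twist (2 ^ m) a b U)"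
proof -
  define d :: nat where "d = 2 ^ m"
  have d0: "0 < d" by (simp add: d_def)
  obtain \<sigma> U where \<sigma>: "density (a * b) \<sigma>" and U: "\<And>i. i < d \<Longrightarrow> unitary (a * b) (U i)"
    and \<gamma>: "\<gamma> = swap_middle d d a b
              ((1 / 2 ^ m) \<cdot>\<^sub>m msum (d * d * a * b) ({..<d} \<times> {..<d})
                (\<lambda>(i, j). ketbra d i j \<otimes>\<^sub>m ketbra d i j \<otimes>\<^sub>m (U i * \<sigma> * mat_adjoint (U j))))"
    using assms unfolding private_states_def d_def by blast
  have \<sigma>c: "\<sigma> \<in> carrier_mat (a * b) (a * b)" using \<sigma> by (simp add: density_def positive_def)
  let ?n = "(d * a) * (d * b)" and ?I = "{..<d} \<times> {..<d}"
  let ?W = "1\<^sub>m d \<otimes>\<^sub>m swap_mat d a \<otimes>\<^sub>m 1\<^sub>m b"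
  let ?f = "\<lambda>(i, j). ketbra d i j \<otimes>\<^sub>m ketbra d i j \<otimes>\<^sub>m (U i * \<sigma> * mat_adjoint (U j))"
  let ?F = "\<lambda>i. key_ket d a b i * U i"
  have dims: "d * d * a * b = d * (a * d) * b" "?n = d * (a * d) * b" by (simp_all add: ac_simps)
  have Wc: "?W \<in> carrier_mat ?n (d * d * a * b)" by (auto simp: ac_simps)
  have Uc: "i < d \<Longrightarrow> U i \<in> carrier_mat (a * b) (a * b)" for i using unitaryD(1)[OF U] .
  have Fc: "i < d \<Longrightarrow> ?F i \<in> carrier_mat ?n (a * b)" for i by (rule key_unitary_carrier[OF d0 U])
  have conj: "?W * ?f (i, j) * mat_adjoint ?W = ?F i * \<sigma> * mat_adjoint (?F j)" if ij: "i < d" "j < d" for i j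
  proof -
    \<comment> \<open>The summand is factored as \<open>E_i M E_j^*\<close> with
      \<open>E_i = |i>|i> \<otimes> 1\<close>, so the permutation meets only \<open>E_i\<close> and
      turns it into \<open>key_ket\<close>.\<close>
    let ?E = "\<lambda>i. ket d i \<otimes>\<^sub>m ket d i \<otimes>\<^sub>m 1\<^sub>m (a * b)"
    let ?M = "U i * \<sigma> * mat_adjoint (U j)"
    note dd = carrier_matD[OF Uc[OF ij(1)]] carrier_matD[OF Uc[OF ij(2)]] carrier_matD[OF \<sigma>c]
    have M: "?M \<in> carrier_mat (a * b) (a * b)" using dd by auto
    have "?f (i, j) = ?E i * ?M * mat_adjoint (?E j)"
    proof -
      have "1\<^sub>m 1 \<otimes>\<^sub>m 1\<^sub>m 1 \<otimes>\<^sub>m ?M = ?M" by simp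
      then have "?E i * ?M * mat_adjoint (?E j) = ?E i * (1\<^sub>m 1 \<otimes>\<^sub>m 1\<^sub>m 1 \<otimes>\<^sub>m ?M) * mat_adjoint (?E j)" by simp
      also have "\<dots> = (ket d i * 1\<^sub>m 1 * mat_adjoint (ket d j)) \<otimes>\<^sub>m (ket d i * 1\<^sub>m 1 * mat_adjoint (ket d j))
        \<otimes>\<^sub>m (1\<^sub>m (a * b) * ?M * 1\<^sub>m (a * b))"
        using dd by (simp only: mat_adjoint_tensor mat_adjoint_one)
          (simp add: tensor_mult del: one_tensor_one one_one_tensor)
      also have "\<dots> = ?f (i, j)"
        using M by (simp add: ketbra_eq left_mult_one_mat[of _ "a * b" "a * b"]
            right_mult_one_mat[of _ "a * b" "a * b"] right_mult_one_mat[of _ d 1])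
      finally show ?thesis by simp
    qed
    then have "?W * ?f (i, j) * mat_adjoint ?W = (?W * ?E i) * ?M * mat_adjoint (?W * ?E j)"
      using dd by (simp add: mat_adjoint_mult mult_mat_assoc dims mult.assoc)
    also have "\<dots> = key_ket d a b i * ?M * mat_adjoint (key_ket d a b j)"
      by (simp only: swap_key_kets)
    also have "\<dots> = ?F i * \<sigma> * mat_adjoint (?F j)"
      using dd by (simp add: mat_adjoint_mult mult_mat_assoc)
    finally show ?thesis .
  qed
  let ?G = "rsum ?n (a * b) {..<d} ?F"
  have GG: "?G * \<sigma> * mat_adjoint ?G = msum ?n ?I (\<lambda>(i, j). ?F i * \<sigma> * mat_adjoint (?F j))"
  proof -
    have G\<sigma>: "?G * \<sigma> = rsum ?n (a * b) {..<d} (\<lambda>i. ?F i * \<sigma>)"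
      using Fc \<sigma>c by (intro rsum_mult) auto
    have adj: "mat_adjoint ?G = rsum (a * b) ?n {..<d} (\<lambda>j. mat_adjoint (?F j))"
      using Fc by (intro rsum_adjoint) auto
    have "?G * \<sigma> * mat_adjoint ?G = rsum ?n ?n {..<d} (\<lambda>i. ?F i * \<sigma> * mat_adjoint ?G)"
      unfolding G\<sigma> using Fc \<sigma>c by (intro rsum_mult) auto
    also have "\<dots> = rsum ?n ?n {..<d} (\<lambda>i. rsum ?n ?n {..<d} (\<lambda>j. ?F i * \<sigma> * mat_adjoint (?F j)))"
      unfolding adj using Fc \<sigma>c by (intro rsum_cong mult_rsum) auto
    also have "\<dots> = msum ?n ?I (\<lambda>(i, j). ?F i * \<sigma> * mat_adjoint (?F j))"
      by (rule eq_matI) (simp_all add: sum.cartesian_product case_prod_beta del: index_mult_mat(1))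
    finally show ?thesis .
  qed
  have "\<gamma> = ?W * ((1 / 2 ^ m) \<cdot>\<^sub>m msum (d * d * a * b) ?I ?f) * mat_adjoint ?W"
    unfolding \<gamma> swap_middle_def Let_def ..
  also have "\<dots> = (1 / 2 ^ m) \<cdot>\<^sub>m (?W * msum (d * d * a * b) ?I ?f * mat_adjoint ?W)"
    by (rule conj_smult[OF Wc msum_carrier])
  also have "?W * msum (d * d * a * b) ?I ?f * mat_adjoint ?W = msum ?n ?I (\<lambda>x. ?W * ?f x * mat_adjoint ?W)"
  proof (rule mult_msum_mult[OF _ Wc])
    fix x assume "x \<in> ?I"
    then obtain i j where x: "x = (i, j)" "i < d" "j < d" by auto
    have "U i * \<sigma> * mat_adjoint (U j) \<in> carrier_mat (a * b) (a * b)" 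
      by (intro mult_carrier_mat[OF mult_carrier_mat[OF Uc[OF x(2)] \<sigma>c]] mat_adjoint_carrier Uc[OF x(3)])
    moreover have "ketbra d i j \<in> carrier_mat d d" by (simp add: ketbra_def)
    ultimately have "ketbra d i j \<otimes>\<^sub>m ketbra d i j \<otimes>\<^sub>m (U i * \<sigma> * mat_adjoint (U j)) \<in> carrier_mat (d * d * (a * b)) (d * d * (a * b))"
      by (intro tensor_carrier) auto
    then show "?f x \<in> carrier_mat (d * d * a * b) (d * d * a * b)" by (simp add: x mult.assoc)
  qed (use Wc in auto)
  also have "\<dots> = ?G * \<sigma> * mat_adjoint ?G"
    unfolding GG by (intro msum_cong) (auto simp: conj[unfolded prod.case])
  also have "(1 / 2 ^ m) \<cdot>\<^sub>m (?G * \<sigma> * mat_adjoint ?G) = twist d a b U * \<sigma> * mat_adjoint (twist d a b U)"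
  proof -
    have "twist d a b U * \<sigma> * mat_adjoint (twist d a b U)
      = (complex_of_real (1 / sqrt d) * complex_of_real (1 / sqrt d)) \<cdot>\<^sub>m (?G * \<sigma> * mat_adjoint ?G)"
      using \<sigma>c by (simp add: twist_def mat_adjoint_smult mult_smult_assoc_mat[of _ ?n "a * b"]
          mult_smult_distrib[of _ ?n "a * b"]) (rule eq_matI, auto)
    also have "complex_of_real (1 / sqrt d) * complex_of_real (1 / sqrt d) = 1 / 2 ^ m"
      by (simp add: d_def flip: of_real_mult)
    finally show ?thesis by simp
  qed
  finally show ?thesis using \<sigma> U unfolding d_def by blast
qed

section \<open>Binary tests and relative entropy\<close>

text \<open>The Kraus operators are \<open>|0><k| R^*\<close> and \<open>|1><k| Q\<close> with
  \<open>Q = 1 - R R^*\<close>. The Gram matrices of the two blocks are \<open>R R^*\<close> and,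
  because this is a projector, \<open>Q\<close>. The output is a classical bit, diagonal by
  construction.\<close>

lemma two_outcome_measurement:
  assumes R: "R \<in> carrier_mat n k" and iso: "mat_adjoint R * R = 1\<^sub>m k"
  shows "\<exists>Ms. set Ms \<subseteq> carrier_mat 2 n \<and> gram n Ms = 1\<^sub>m n \<and> (\<forall>X\<in>carrier_mat n n.
    kraus_map 2 Ms X = mat_diag 2 (\<lambda>i. if i = 0 then tr (R * mat_adjoint R * X)
      else tr X - tr (R * mat_adjoint R * X)))"
proof -
  let ?P = "R * mat_adjoint R"
  define Q where "Q = 1\<^sub>m n - ?P"
  let ?kets = "\<lambda>n. map (\<lambda>k. mat_adjoint (ket n k)) [0..<n]"
  define L0 where "L0 = map (\<lambda>L. L * mat_adjoint R) (?kets k)"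
  define L1 where "L1 = map (\<lambda>L. L * Q) (?kets n)"
  define Ms where "Ms = map ((*) (ket 2 0)) L0 @ map ((*) (ket 2 1)) L1"
  note Rd = carrier_matD[OF R]
  have P: "?P \<in> carrier_mat n n" using R by auto
  have Q: "Q \<in> carrier_mat n n" unfolding Q_def using P by (rule minus_carrier_mat)
  have kets: "set (?kets j) \<subseteq> carrier_mat 1 j" for j by auto
  have L0: "set L0 \<subseteq> carrier_mat 1 n" using R by (auto simp: L0_def)
  have L1: "set L1 \<subseteq> carrier_mat 1 n" using Q by (auto simp: L1_def)
  have gL0: "gram n L0 = ?P"
    unfolding L0_def gram_map_mult_right[OF kets mat_adjoint_carrier[OF R]] gram_kets
    using R by (simp add: right_mult_one_mat[of _ n k])
  have PP: "?P * ?P = ?P"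
  proof -
    have "?P * ?P = R * (mat_adjoint R * R) * mat_adjoint R" using Rd by (simp add: mult_mat_assoc)
    then show ?thesis using R by (simp add: iso right_mult_one_mat[of _ n k])
  qed
  have adjQ: "mat_adjoint Q = Q"
    using mat_adjoint_minus[OF one_carrier_mat P] Rd by (simp add: Q_def mat_adjoint_mult)
  have QQ: "Q * Q = Q"
  proof -
    have "Q * Q = Q * (1\<^sub>m n - ?P)" by (simp only: Q_def)
    also have "\<dots> = Q * 1\<^sub>m n - Q * ?P" by (rule mult_minus_distrib_mat[OF Q one_carrier_mat P])
    also have "Q * ?P = ?P - ?P * ?P"
      unfolding Q_def minus_mult_distrib_mat[OF one_carrier_mat P P] using P by (simp add: left_mult_one_mat[of _ n n])
    also have "\<dots> = 0\<^sub>m n n" using P by (simp add: PP)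
    finally show ?thesis using Q by (auto intro!: eq_matI)
  qed
  have gL1: "gram n L1 = Q"
    unfolding L1_def gram_map_mult_right[OF kets Q] gram_kets
    using Q by (simp add: adjQ QQ right_mult_one_mat[of _ n n])
  have kk: "mat_adjoint (ket 2 i) * ket 2 i = 1\<^sub>m 1" if "i < 2" for i
    using ket_adjoint_mult_ket[OF that that] by simp
  have gk: "gram n (map ((*) (ket 2 i)) L) = gram n L" if "i < 2" "set L \<subseteq> carrier_mat 1 n" for i L
    using gram_map_mult_left[OF that(2) ket_carrier(1), of 2 i] gram_eq_kraus_map[OF that(2)] kk[OF that(1)]
    by simp
  have ck: "set (map ((*) (ket 2 i)) L) \<subseteq> carrier_mat 2 n" if "set L \<subseteq> carrier_mat 1 n" for i L
    using that mult_carrier_mat[OF ket_carrier(1)[of 2 i]] by auto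
  have "set Ms \<subseteq> carrier_mat 2 n" using ck[OF L0] ck[OF L1] by (simp add: Ms_def)
  moreover have "gram n Ms = 1\<^sub>m n"
  proof -
    have "gram n Ms = gram n (map ((*) (ket 2 0)) L0) + gram n (map ((*) (ket 2 1)) L1)"
      unfolding Ms_def using L0 by (intro gram_append) auto
    also have "\<dots> = ?P + Q" using gk[OF _ L0, of 0] gk[OF _ L1, of 1] by (simp add: gL0 gL1)
    also have "\<dots> = 1\<^sub>m n" unfolding Q_def using P Rd by (intro eq_matI) auto
    finally show ?thesis .
  qed
  moreover have "kraus_map 2 Ms X = mat_diag 2 (\<lambda>i. if i = 0 then tr (?P * X) else tr X - tr (?P * X))"
    if X: "X \<in> carrier_mat n n" for X
  proof -
    have block: "kraus_map 2 (map ((*) (ket 2 i)) L) X = mat 2 2 (\<lambda>(r, c). if r = i \<and> c = i then tr (gram n L * X) else 0)"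
      if L: "set L \<subseteq> carrier_mat 1 n" for i L
    proof -
      have "tr (gram n L * X) = kraus_map 1 L X $$ (0, 0)"
        using tr_kraus_map[OF L X] by (simp add: tr_def)
      moreover have "kraus_map 2 (map ((*) (ket 2 i)) L) X = ket 2 i * kraus_map 1 L X * mat_adjoint (ket 2 i)"
        by (rule conj_kraus_map[OF L ket_carrier(1) X, symmetric])
      ultimately show ?thesis by (intro eq_matI) (auto simp: scalar_prod_def)
    qed
    have "Q * X = X - ?P * X"
      unfolding Q_def minus_mult_distrib_mat[OF one_carrier_mat P X] using X by simp
    then have trQ: "tr (Q * X) = tr X - tr (?P * X)"
      using tr_minus[OF X, of "?P * X"] P X by auto
    have "kraus_map 2 Ms X = kraus_map 2 (map ((*) (ket 2 0)) L0) X + kraus_map 2 (map ((*) (ket 2 1)) L1) X"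
      unfolding Ms_def by (rule kraus_map_append[OF ck[OF L0] X])
    then show ?thesis
      unfolding block[OF L0] block[OF L1] gL0 gL1 trQ
      by (auto simp: mat_diag_def less_2_cases_iff intro!: eq_matI)
  qed
  ultimately show ?thesis by blast
qed

text \<open>The operator is the sum of the \<open>V V^*\<close>, so the value is the sum of the
  squared norms of \<open>R^* V\<close>: it is real, and the bound can be checked for each
  \<open>V\<close>. It serves with \<open>c = 1\<close> for the protocol's output and with
  \<open>c = 1 / d\<close> for the image of a separable state.\<close>

lemma isometry_effect_value:
  assumes R: "R \<in> carrier_mat n k" and Vs: "set Vs \<subseteq> carrier_mat n l"
    and le: "\<And>V. V \<in> set Vs \<Longrightarrow> (fnorm (mat_adjoint R * V))\<^sup>2 \<le> c * (fnorm V)\<^sup>2"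
    and tr1: "tr (kraus_map n Vs (1\<^sub>m l)) = 1"
  shows "\<exists>p. tr (R * mat_adjoint R * kraus_map n Vs (1\<^sub>m l)) = complex_of_real p \<and> 0 \<le> p \<and> p \<le> c"
proof -
  let ?X = "kraus_map n Vs (1\<^sub>m l)"
  note Rd = carrier_matD[OF R]
  have sum: "tr (kraus_map e Ws (1\<^sub>m l)) = complex_of_real (\<Sum>V\<leftarrow>Ws. (fnorm V)\<^sup>2)"
    if "set Ws \<subseteq> carrier_mat e l" for e Ws
  proof -
    have "V * 1\<^sub>m l = V" if "V \<in> set Ws" for V
      using \<open>set Ws \<subseteq> carrier_mat e l\<close> that by (intro right_mult_one_mat) auto
    then have "(\<Sum>V\<leftarrow>Ws. (fnorm (V * 1\<^sub>m l))\<^sup>2) = (\<Sum>V\<leftarrow>Ws. (fnorm V)\<^sup>2)"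
      by (intro arg_cong[of _ _ sum_list] map_cong) auto
    then show ?thesis using tr_kraus_map_gram[OF that, of "1\<^sub>m l" l] by simp
  qed
  have RVs: "set (map ((*) (mat_adjoint R)) Vs) \<subseteq> carrier_mat k l"
    using Vs mult_carrier_mat[OF mat_adjoint_carrier[OF R]] by auto
  have "tr (R * mat_adjoint R * ?X) = tr (R * (mat_adjoint R * ?X))"
    using Rd by (simp add: mult_mat_assoc)
  also have "\<dots> = tr (mat_adjoint R * ?X * mat_adjoint (mat_adjoint R))"
    using R mult_carrier_mat[OF mat_adjoint_carrier[OF R] kraus_map_carrier] by (simp add: tr_mult_commute[of R n k])
  also have "\<dots> = tr (kraus_map k (map ((*) (mat_adjoint R)) Vs) (1\<^sub>m l))"
    using R by (subst conj_kraus_map[OF Vs]) auto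
  also have "\<dots> = complex_of_real (\<Sum>V\<leftarrow>Vs. (fnorm (mat_adjoint R * V))\<^sup>2)"
    unfolding sum[OF RVs] by (simp add: comp_def)
  finally have e: "tr (R * mat_adjoint R * ?X) = complex_of_real (\<Sum>V\<leftarrow>Vs. (fnorm (mat_adjoint R * V))\<^sup>2)" .
  have "(\<Sum>V\<leftarrow>Vs. (fnorm (mat_adjoint R * V))\<^sup>2) \<le> (\<Sum>V\<leftarrow>Vs. c * (fnorm V)\<^sup>2)"
    by (rule sum_list_mono) (rule le)
  also have "\<dots> = c * (\<Sum>V\<leftarrow>Vs. (fnorm V)\<^sup>2)" by (rule sum_list_const_mult)
  also have "(\<Sum>V\<leftarrow>Vs. (fnorm V)\<^sup>2) = 1"
    using sum[OF Vs] tr1 by (metis of_real_eq_1_iff)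
  finally show ?thesis using e by (intro exI[of _ "\<Sum>V\<leftarrow>Vs. (fnorm (mat_adjoint R * V))\<^sup>2"]) (auto intro!: sum_list_nonneg)
qed

section \<open>Relative entropy of binary distributions\<close>

lemma x_log_x_ge:
  fixes x :: real
  assumes "0 \<le> x" "x \<le> 1"
  shows "(x - 1) / ln 2 \<le> x * (if 0 < x then log 2 x else 0)"
proof (cases "x = 0")
  case False
  with assms have x: "0 < x" by simp
  have "ln (1 / x) \<le> 1 / x - 1" using x by (intro ln_le_minus_one) simp
  then have "x * (1 - 1 / x) \<le> x * ln x" using x by (intro mult_left_mono) (simp_all add: ln_div)
  then have "x - 1 \<le> x * ln x" using x by (simp add: algebra_simps)
  then show ?thesis using x by (simp add: log_def divide_right_mono)
qed simp

text \<open>The relative entropy is \<open>- p log q - (1 - p) log (1 - q)\<close> minus the binary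
  entropy of \<open>p\<close>. The first term is at least \<open>(1 - \<epsilon>) m\<close>, the
  second is nonnegative, and the entropy is estimated by 2.\<close>

lemma rel_entropy_binary_ge:
  fixes p q \<epsilon> :: real and m :: nat
  assumes p: "0 \<le> p" "p \<le> 1" "1 - \<epsilon> \<le> p" and q: "0 \<le> q" "q \<le> 1 / 2 ^ m" and \<epsilon>: "\<epsilon> < 1"
  shows "ereal ((1 - \<epsilon>) * m - 2) \<le> rel_entropy
    (mat_diag 2 (\<lambda>i. complex_of_real (if i = 0 then p else 1 - p)))
    (mat_diag 2 (\<lambda>i. complex_of_real (if i = 0 then q else 1 - q)))"
    (is "_ \<le> rel_entropy ?\<rho> ?\<sigma>")
proof (cases "mat_kernel ?\<sigma> \<subseteq> mat_kernel ?\<rho>")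
  case False
  then show ?thesis by (simp add: rel_entropy_def)
next
  case True
  let ?g = "\<lambda>x::real. if 0 < x then log 2 x else 0"
  have q1: "q \<le> 1" using q(2) by (rule order_trans) simp
  have diag_e0: "mat_diag 2 f *\<^sub>v unit_vec 2 0 = vec 2 (\<lambda>i. if i = 0 then f 0 else 0)" for f :: "nat \<Rightarrow> complex"
    by (rule eq_vecI) (auto simp: mat_diag_def scalar_prod_def numeral_2_eq_2)
  \<comment> \<open>For \<open>q = 0\<close> the first basis vector lies in the kernel of the second
    matrix, hence by the support condition in that of the first, although \<open>p\<close> is
    positive.\<close>
  have "0 < q"
  proof (rule ccontr)
    assume "\<not> 0 < q"
    with q have "q = 0" by simp
    have "vec 2 (\<lambda>i. if i = 0 then complex_of_real q else 0) = 0\<^sub>v 2"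
      using \<open>q = 0\<close> by (intro eq_vecI) auto
    then have "unit_vec 2 0 \<in> mat_kernel ?\<sigma>"
      by (intro mat_kernelI[of _ 2 2]) (auto simp: diag_e0)
    with True have "unit_vec 2 0 \<in> mat_kernel ?\<rho>" by blast
    then have "?\<rho> *\<^sub>v unit_vec 2 0 = 0\<^sub>v 2" by (rule mat_kernelD(2)[OF mat_diag_dim])
    then have "(?\<rho> *\<^sub>v unit_vec 2 0) $ 0 = 0" by simp
    then have "p = 0" unfolding diag_e0 by simp
    with p \<epsilon> show False by simp
  qed
  have minus: "mat_diag 2 f - mat_diag 2 h = mat_diag 2 (\<lambda>i. f i - h i)" for f h :: "nat \<Rightarrow> complex"
    by (rule eq_matI) (auto simp: mat_diag_def)
  have "Re (tr (?\<rho> * (mlog ?\<rho> - mlog ?\<sigma>))) = p * (?g p - ?g q) + (1 - p) * (?g (1 - p) - ?g (1 - q))"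
    unfolding mlog_def herm_fun_diag minus mat_diag_diag tr_diag
    by (simp add: numeral_2_eq_2)
  moreover have "(1 - \<epsilon>) * m - 2 \<le> p * (?g p - ?g q) + (1 - p) * (?g (1 - p) - ?g (1 - q))"
  proof -
    \<comment> \<open>The bounds for \<open>p\<close> and \<open>1 - p\<close> add up to
      \<open>- 1 / ln 2\<close>; with \<open>1 / 2 \<le> ln 2\<close> this yields the constant
      -2.\<close>
    have l2: "(1::real) / 2 \<le> ln 2" using ln_le_minus_one[of "1 / 2 :: real"] by (simp add: ln_div)
    have "-2 \<le> (p - 1) / ln 2 + ((1 - p) - 1) / ln 2"
      using l2 by (simp add: field_simps)
    also have "\<dots> \<le> p * ?g p + (1 - p) * ?g (1 - p)"
      using x_log_x_ge[of p] x_log_x_ge[of "1 - p"] p by (intro add_mono) auto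
    finally have a: "-2 \<le> p * ?g p + (1 - p) * ?g (1 - p)" .
    have "log 2 q \<le> log 2 (1 / 2 ^ m)" using \<open>0 < q\<close> q by simp
    also have "\<dots> = - real m" by (simp add: log_divide log_nat_power)
    finally have "real m \<le> - ?g q" using \<open>0 < q\<close> by simp
    then have "(1 - \<epsilon>) * m \<le> p * (- ?g q)" using p by (intro mult_mono) auto
    \<comment> \<open>For \<open>m = 0\<close> the value \<open>q = 1\<close> can occur; the
      convention \<open>?g 0 = 0\<close> covers it.\<close>
    moreover have "?g (1 - q) \<le> 0" using \<open>0 < q\<close> q1 by simp
    then have "0 \<le> (1 - p) * (- ?g (1 - q))" using p by (intro mult_nonneg_nonneg) auto
    ultimately have "(1 - \<epsilon>) * m - 2 \<le> (p * ?g p + (1 - p) * ?g (1 - p)) + p * (- ?g q) + (1 - p) * (- ?g (1 - q))"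
      using a by linarith
    also have "\<dots> = p * (?g p - ?g q) + (1 - p) * (?g (1 - p) - ?g (1 - q))"
      by (simp only: algebra_simps)
    finally show ?thesis .
  qed
  ultimately show ?thesis using True by (simp only: rel_entropy_def if_True ereal_less_eq)
qed

section \<open>Copies and separable states\<close>

text \<open>Reordering is conjugation by a unitary, so it acts on the factor \<open>Y\<close> from
  the left and preserves its norm.\<close>

lemma swap_middle_trace_and_factor:
  assumes Y: "Y \<in> carrier_mat (a * b * c * d) k"
  shows "\<exists>Z\<in>carrier_mat (a * c * (b * d)) k. swap_middle a b c d (Y * mat_adjoint Y) = Z * mat_adjoint Z"
    and "tr (swap_middle a b c d (Y * mat_adjoint Y)) = tr (Y * mat_adjoint Y)"
proof -
  let ?W = "1\<^sub>m a \<otimes>\<^sub>m swap_mat b c \<otimes>\<^sub>m 1\<^sub>m d"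
  have W: "dim_row ?W = a * c * (b * d)" "dim_col ?W = a * b * c * d" by simp_all
  have WY: "?W * Y \<in> carrier_mat (a * c * (b * d)) k" using Y W by (intro mult_carrier_mat[of _ _ "a * b * c * d"]) auto
  have e: "swap_middle a b c d (Y * mat_adjoint Y) = (?W * Y) * mat_adjoint (?W * Y)"
    unfolding swap_middle_def Let_def using W carrier_matD[OF Y] by (simp only: mat_adjoint_mult mult_mat_assoc
        mat_adjoint_dim index_mult_mat)
  with WY show "\<exists>Z\<in>carrier_mat (a * c * (b * d)) k. swap_middle a b c d (Y * mat_adjoint Y) = Z * mat_adjoint Z"
    by blast
  have "mat_adjoint ?W * ?W = 1\<^sub>m (a * b * c * d)"
    by (simp add: mat_adjoint_tensor tensor_mult swap_mat_unitary mult.assoc)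
  then have "fnorm (?W * Y) = fnorm Y" by (rule fnorm_mult_isometry[OF _ W(2) carrier_matD(1)[OF Y]])
  then show "tr (swap_middle a b c d (Y * mat_adjoint Y)) = tr (Y * mat_adjoint Y)"
    unfolding e tr_mult_adjoint_self by simp
qed

lemma tensor_factor:
  assumes "Y \<in> carrier_mat n k" "Z \<in> carrier_mat n' k'"
  shows "(Y * mat_adjoint Y) \<otimes>\<^sub>m (Z * mat_adjoint Z) = (Y \<otimes>\<^sub>m Z) * mat_adjoint (Y \<otimes>\<^sub>m Z)"
  using assms by (simp add: mat_adjoint_tensor tensor_mult)

lemma density_factor:
  assumes "density d \<rho>"
  obtains Y where "Y \<in> carrier_mat d d" "\<rho> = Y * mat_adjoint Y" "tr \<rho> = 1"
  using assms positive_factor by (auto simp: density_def)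

lemma density_dim_pos: "density d \<rho> \<Longrightarrow> 0 < d"
  by (rule ccontr) (auto simp: density_def positive_def tr_def)

text \<open>The factor is built along the recursion, by tensoring with a factor of
  \<open>\<rho>\<close> and permuting. Its number of columns never matters and stays
  existential.\<close>

lemma bipartite_power_factor:
  assumes "density (p * q) \<rho>"
  shows "\<exists>k. \<exists>Y\<in>carrier_mat (p ^ n * q ^ n) k. bipartite_power p q \<rho> n = Y * mat_adjoint Y"
    and "tr (bipartite_power p q \<rho> n) = 1"
proof -
  obtain R where R: "R \<in> carrier_mat (p * q) (p * q)" "\<rho> = R * mat_adjoint R" "tr \<rho> = 1"
    using assms by (rule density_factor)
  have "(\<exists>k. \<exists>Y\<in>carrier_mat (p ^ n * q ^ n) k. bipartite_power p q \<rho> n = Y * mat_adjoint Y)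
    \<and> tr (bipartite_power p q \<rho> n) = 1"
  proof (induction n)
    case 0
    have "(1\<^sub>m 1 :: complex mat) = 1\<^sub>m 1 * mat_adjoint (1\<^sub>m 1)" by simp
    moreover have "tr (1\<^sub>m 1) = 1" by (simp add: tr_def)
    ultimately show ?case by (auto intro!: exI[of _ 1] bexI[of _ "1\<^sub>m 1"])
  next
    case (Suc n)
    then obtain k Y where Y: "Y \<in> carrier_mat (p ^ n * q ^ n) k" "bipartite_power p q \<rho> n = Y * mat_adjoint Y"
      and t: "tr (bipartite_power p q \<rho> n) = 1" by blast
    have YR: "Y \<otimes>\<^sub>m R \<in> carrier_mat (p ^ n * q ^ n * p * q) (k * (p * q))"
      using tensor_carrier[OF Y(1) R(1)] by (simp add: mult.assoc)
    have e: "bipartite_power p q \<rho> (Suc n)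
      = swap_middle (p ^ n) (q ^ n) p q ((Y \<otimes>\<^sub>m R) * mat_adjoint (Y \<otimes>\<^sub>m R))"
      by (simp only: bipartite_power.simps Y(2) tensor_factor[OF Y(1) R(1), symmetric] R(2)[symmetric])
    have "tr ((Y \<otimes>\<^sub>m R) * mat_adjoint (Y \<otimes>\<^sub>m R)) = 1"
      unfolding tensor_factor[OF Y(1) R(1), symmetric]
      using t R(3) Y R by (subst tr_tensor[of _ "p ^ n * q ^ n" _ "p * q"]) auto
    moreover have "p ^ n * p * (q ^ n * q) = p ^ Suc n * q ^ Suc n" by simp
    ultimately show ?case
      using swap_middle_trace_and_factor[OF YR] unfolding e by metis
  qed
  then show "\<exists>k. \<exists>Y\<in>carrier_mat (p ^ n * q ^ n) k. bipartite_power p q \<rho> n = Y * mat_adjoint Y"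
    and "tr (bipartite_power p q \<rho> n) = 1" by blast+
qed

lemma copies_factor:
  assumes "density (dA * dCA) \<rho>" "density (dCB * dB) \<tau>"
  shows "\<exists>k. \<exists>Y\<in>carrier_mat (dA ^ n * (dCA ^ n * dCB ^ n) * dB ^ n) k.
      copies dA dCA dCB dB \<rho> \<tau> n = Y * mat_adjoint Y"
    and "tr (copies dA dCA dCB dB \<rho> \<tau> n) = 1"
proof -
  obtain k Y where Y: "Y \<in> carrier_mat (dA ^ n * dCA ^ n) k" "bipartite_power dA dCA \<rho> n = Y * mat_adjoint Y"
    using bipartite_power_factor(1)[OF assms(1)] by blast
  obtain l Z where Z: "Z \<in> carrier_mat (dCB ^ n * dB ^ n) l" "bipartite_power dCB dB \<tau> n = Z * mat_adjoint Z"
    using bipartite_power_factor(1)[OF assms(2)] by blast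
  have "Y \<otimes>\<^sub>m Z \<in> carrier_mat (dA ^ n * (dCA ^ n * dCB ^ n) * dB ^ n) (k * l)"
    using tensor_carrier[OF Y(1) Z(1)] by (simp add: mult.assoc)
  then show "\<exists>k. \<exists>Y\<in>carrier_mat (dA ^ n * (dCA ^ n * dCB ^ n) * dB ^ n) k.
      copies dA dCA dCB dB \<rho> \<tau> n = Y * mat_adjoint Y"
    unfolding copies_def Y(2) Z(2) tensor_factor[OF Y(1) Z(1)] by blast
  have "bipartite_power dA dCA \<rho> n \<in> carrier_mat (dA ^ n * dCA ^ n) (dA ^ n * dCA ^ n)"
    "bipartite_power dCB dB \<tau> n \<in> carrier_mat (dCB ^ n * dB ^ n) (dCB ^ n * dB ^ n)"
    unfolding Y(2) Z(2) using Y(1) Z(1) by auto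
  then show "tr (copies dA dCA dCB dB \<rho> \<tau> n) = 1"
    unfolding copies_def
    by (simp add: tr_tensor[of _ "dA ^ n * dCA ^ n" _ "dCB ^ n * dB ^ n"] bipartite_power_factor(2)[OF assms(1)]
        bipartite_power_factor(2)[OF assms(2)])
qed

text \<open>Each product term is factored system by system, with Charlie's two systems joined into
  one to match the parties of the protocol.\<close>

lemma separable4_factor:
  assumes "\<sigma> \<in> separable4 a c1 c2 b"
  defines "D \<equiv> a * (c1 * c2) * b"
  shows "tr \<sigma> = 1" "\<exists>Vs. \<sigma> = kraus_map D Vs (1\<^sub>m D) \<and> (\<forall>V\<in>set Vs.
    \<exists>x\<in>carrier_mat a a. \<exists>y\<in>carrier_mat (c1 * c2) (c1 * c2). \<exists>z\<in>carrier_mat b b. V = x \<otimes>\<^sub>m y \<otimes>\<^sub>m z)"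
proof -
  obtain r :: nat and p \<alpha> \<kappa> \<kappa>' \<beta> where *: "\<And>k. k < r \<Longrightarrow> 0 \<le> p k \<and> density a (\<alpha> k) \<and> density c1 (\<kappa> k) \<and>
               density c2 (\<kappa>' k) \<and> density b (\<beta> k)"
    and sum1: "(\<Sum>k<r. p k) = (1::real)"
    and \<sigma>: "\<sigma> = msum (a * c1 * c2 * b) {..<r} (\<lambda>k. complex_of_real (p k) \<cdot>\<^sub>m (\<alpha> k \<otimes>\<^sub>m \<kappa> k \<otimes>\<^sub>m \<kappa>' k \<otimes>\<^sub>m \<beta> k))"
    using assms(1) unfolding separable4_def by blast
  have D: "a * c1 * c2 * b = D" by (simp add: D_def mult.assoc)
  have "\<exists>V. (\<exists>x\<in>carrier_mat a a. \<exists>y\<in>carrier_mat (c1 * c2) (c1 * c2). \<exists>z\<in>carrier_mat b b. V = x \<otimes>\<^sub>m y \<otimes>\<^sub>m z) \<and>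
      complex_of_real (p k) \<cdot>\<^sub>m (\<alpha> k \<otimes>\<^sub>m \<kappa> k \<otimes>\<^sub>m \<kappa>' k \<otimes>\<^sub>m \<beta> k) = V * mat_adjoint V \<and>
      tr (V * mat_adjoint V) = complex_of_real (p k)" if k: "k < r" for k
  proof -
    obtain A where A: "A \<in> carrier_mat a a" "\<alpha> k = A * mat_adjoint A" "tr (\<alpha> k) = 1"
      using *[OF k] density_factor by blast
    obtain C where C: "C \<in> carrier_mat c1 c1" "\<kappa> k = C * mat_adjoint C" "tr (\<kappa> k) = 1"
      using *[OF k] density_factor by blast
    obtain C' where C': "C' \<in> carrier_mat c2 c2" "\<kappa>' k = C' * mat_adjoint C'" "tr (\<kappa>' k) = 1"
      using *[OF k] density_factor by blast
    obtain B where B: "B \<in> carrier_mat b b" "\<beta> k = B * mat_adjoint B" "tr (\<beta> k) = 1"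
      using *[OF k] density_factor by blast
    \<comment> \<open>The weight \<open>p k\<close> is absorbed into Alice's factor, which enters
      twice, hence the square root.\<close>
    let ?x = "complex_of_real (sqrt (p k)) \<cdot>\<^sub>m A"
    let ?V = "?x \<otimes>\<^sub>m (C \<otimes>\<^sub>m C') \<otimes>\<^sub>m B"
    have x: "?x \<in> carrier_mat a a" using A by simp
    have f1: "(fnorm A)\<^sup>2 = 1" "(fnorm C)\<^sup>2 = 1" "(fnorm C')\<^sup>2 = 1" "(fnorm B)\<^sup>2 = 1"
      using A(2,3) C(2,3) C'(2,3) B(2,3) by (simp_all only: tr_mult_adjoint_self of_real_eq_1_iff)
    have "?x * mat_adjoint ?x = complex_of_real (p k) \<cdot>\<^sub>m \<alpha> k"
    proof -
      have "?x * mat_adjoint ?x = (complex_of_real (sqrt (p k)) * complex_of_real (sqrt (p k))) \<cdot>\<^sub>m \<alpha> k"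
        using A by (simp add: mat_adjoint_smult mult_smult_distrib[of _ a a] mult_smult_assoc_mat[of _ a a])
          (rule eq_matI, auto)
      then show ?thesis using *[OF k] by (simp flip: of_real_mult)
    qed
    then have "?V * mat_adjoint ?V = (complex_of_real (p k) \<cdot>\<^sub>m \<alpha> k) \<otimes>\<^sub>m (\<kappa> k \<otimes>\<^sub>m \<kappa>' k) \<otimes>\<^sub>m \<beta> k"
      unfolding C(2) C'(2) B(2) using x A C C' B
      by (simp add: mat_adjoint_tensor tensor_mult)
    also have "\<dots> = complex_of_real (p k) \<cdot>\<^sub>m (\<alpha> k \<otimes>\<^sub>m \<kappa> k \<otimes>\<^sub>m \<kappa>' k \<otimes>\<^sub>m \<beta> k)"
      unfolding tensor_assoc by (rule eq_matI) (auto simp: tensor_index div_mod_less_mult)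
    finally have V: "?V * mat_adjoint ?V = complex_of_real (p k) \<cdot>\<^sub>m (\<alpha> k \<otimes>\<^sub>m \<kappa> k \<otimes>\<^sub>m \<kappa>' k \<otimes>\<^sub>m \<beta> k)" .
    have "tr (?V * mat_adjoint ?V) = complex_of_real (p k)"
      unfolding tr_mult_adjoint_self using *[OF k]
      by (simp add: fnorm_tensor fnorm_smult power_mult_distrib f1)
    note trV = this
    have prod: "\<exists>x\<in>carrier_mat a a. \<exists>y\<in>carrier_mat (c1 * c2) (c1 * c2). \<exists>z\<in>carrier_mat b b. ?V = x \<otimes>\<^sub>m y \<otimes>\<^sub>m z"
      by (rule bexI[OF bexI[OF bexI[OF refl B(1)] tensor_carrier[OF C(1) C'(1)]] x])
    show ?thesis by (rule exI[of _ ?V]) (intro conjI prod V[symmetric] trV)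
  qed
  then obtain V where V: "\<And>k. k < r \<Longrightarrow> \<exists>x\<in>carrier_mat a a. \<exists>y\<in>carrier_mat (c1 * c2) (c1 * c2). \<exists>z\<in>carrier_mat b b. V k = x \<otimes>\<^sub>m y \<otimes>\<^sub>m z"
    and V': "\<And>k. k < r \<Longrightarrow> complex_of_real (p k) \<cdot>\<^sub>m (\<alpha> k \<otimes>\<^sub>m \<kappa> k \<otimes>\<^sub>m \<kappa>' k \<otimes>\<^sub>m \<beta> k) = V k * mat_adjoint (V k)"
    and trV: "\<And>k. k < r \<Longrightarrow> tr (V k * mat_adjoint (V k)) = complex_of_real (p k)" by metis
  have Vc: "V k \<in> carrier_mat D D" if "k < r" for k
    using V[OF that] by (auto simp: D_def)
  have \<sigma>': "\<sigma> = msum D {..<r} (\<lambda>k. V k * mat_adjoint (V k))"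
    unfolding \<sigma> D using V' by (intro msum_cong) simp
  have "\<sigma> = kraus_map D (map V [0..<r]) (1\<^sub>m D)"
    unfolding \<sigma>' kraus_map_def length_map length_upt
    using Vc by (simp, intro msum_cong) (simp add: right_mult_one_mat[of _ D D])
  with V show "\<exists>Vs. \<sigma> = kraus_map D Vs (1\<^sub>m D) \<and> (\<forall>V\<in>set Vs.
    \<exists>x\<in>carrier_mat a a. \<exists>y\<in>carrier_mat (c1 * c2) (c1 * c2). \<exists>z\<in>carrier_mat b b. V = x \<otimes>\<^sub>m y \<otimes>\<^sub>m z)"
    by (intro exI[of _ "map V [0..<r]"]) auto
  have "tr \<sigma> = (\<Sum>k<r. tr (V k * mat_adjoint (V k)))"
    unfolding \<sigma>' tr_msum
  proof (rule sum.cong)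
    fix k assume "k \<in> {..<r}"
    then have "dim_row (V k) = D" using Vc[of k] by auto
    then show "(\<Sum>r<D. (V k * mat_adjoint (V k)) $$ (r, r)) = tr (V k * mat_adjoint (V k))"
      by (simp add: tr_def del: index_mult_mat(1))
  qed simp
  also have "\<dots> = complex_of_real (\<Sum>k<r. p k)" using trV by simp
  finally show "tr \<sigma> = 1" by (simp add: sum1)
qed

section \<open>The bound on the key rate\<close>

text \<open>The bound for a single block of copies. The premises on \<open>S\<close> say that
  everyone who speaks in the protocol is represented, in \<open>C : AB\<close>, by a party that may
  speak. The POVM constructed is the same for every separable \<open>\<sigma>\<close>.\<close>

lemma restricted_rel_entropy_ge:
  fixes \<epsilon> :: real
  assumes pos: "0 < a" "0 < c1" "0 < c2" "0 < b"
    and Y: "Y \<in> carrier_mat (a * (c1 * c2) * b) k" and \<omega>: "\<omega> = Y * mat_adjoint Y" "tr \<omega> = 1"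
    and \<Lambda>: "locc S [a, c1 * c2, b] [2 ^ m * a', c', 2 ^ m * b'] \<Lambda>"
    and S: "1 \<in> S \<Longrightarrow> 0 \<in> S'" "0 \<in> S \<or> 2 \<in> S \<Longrightarrow> 1 \<in> S'"
    and \<gamma>: "\<gamma> \<in> private_states m a' b'"
    and close: "trace_norm (trace_middle (2 ^ m * a') c' (2 ^ m * b') (\<Lambda> \<omega>) - \<gamma>) \<le> \<epsilon>"
    and \<epsilon>: "\<epsilon> < 1"
  shows "ereal ((1 - \<epsilon>) * m - 2) \<le> restricted_rel_entropy S' a c1 c2 b \<omega>"
  unfolding restricted_rel_entropy_def
proof (rule INF_greatest)
  fix \<sigma> assume \<sigma>: "\<sigma> \<in> separable4 a c1 c2 b"
  define d :: nat where "d = 2 ^ m"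
  define c where "c = c1 * c2"
  let ?A = "d * a'" and ?B = "d * b'"
  let ?n = "?A * ?B" and ?D = "a * c * b"
  have d0: "0 < d" by (simp add: d_def)
  have c0: "0 < c" using pos by (simp add: c_def)
  note Y = Y[folded c_def] and \<Lambda> = \<Lambda>[folded c_def d_def] and close = close[folded d_def]
  have \<omega>c: "\<omega> \<in> carrier_mat ?D ?D" unfolding \<omega>(1) using Y by auto
  obtain \<sigma>0 U where \<sigma>0: "density (a' * b') \<sigma>0" and U: "\<And>i. i < d \<Longrightarrow> unitary (a' * b') (U i)"
    and \<gamma>R: "\<gamma> = twist d a' b' U * \<sigma>0 * mat_adjoint (twist d a' b' U)"
    using private_state_eq_twist[OF \<gamma>] unfolding d_def by blast
  have \<sigma>0c: "\<sigma>0 \<in> carrier_mat (a' * b') (a' * b')" using \<sigma>0 by (simp add: density_def positive_def)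
  define R where "R = twist d a' b' U"
  have R: "R \<in> carrier_mat ?n (a' * b')" by (simp add: R_def)
  note Rd = carrier_matD[OF R]
  have iso: "mat_adjoint R * R = 1\<^sub>m (a' * b')" unfolding R_def by (rule twist_isometry[OF d0 U])
  let ?P = "R * mat_adjoint R"
  have P: "?P \<in> carrier_mat ?n ?n" using R by auto
  let ?T = "\<lambda>X. trace_middle ?A c' ?B (\<Lambda> X)"
  let ?f = "\<lambda>X i. if i = 0 then tr (?P * ?T X) else tr (?T X) - tr (?P * ?T X)"
  have Tc: "?T X \<in> carrier_mat ?n ?n" for X by (simp add: trace_middle_def)

  obtain Ls where Ls: "\<And>L. L \<in> set Ls \<Longrightarrow> local_op [a, c, b] [?A, c', ?B] L"
    and gLs: "gram (prod_list [a, c, b]) Ls = 1\<^sub>m (prod_list [a, c, b])"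
    and \<Lambda>Ls: "\<And>X. X \<in> carrier_mat (prod_list [a, c, b]) (prod_list [a, c, b])
      \<Longrightarrow> \<Lambda> X = kraus_map (prod_list [?A, c', ?B]) Ls X"
    using locc_kraus[OF \<Lambda>] by blast
  have pl: "prod_list [a, c, b] = ?D" "prod_list [?A, c', ?B] = ?A * c' * ?B" by (simp_all add: mult.assoc)
  note gLs = gLs[unfolded pl] and \<Lambda>Ls = \<Lambda>Ls[unfolded pl]
  have Lsc: "set Ls \<subseteq> carrier_mat (?A * c' * ?B) ?D" using Ls local_op_carrier unfolding pl[symmetric] by blast
  \<comment> \<open>The Kraus operators of the partial trace over Charlie. Composed with those of
    the protocol they remain products, with a single row in Charlie's factor.\<close>
  define Ts where "Ts = map (\<lambda>k. 1\<^sub>m ?A \<otimes>\<^sub>m mat_adjoint (ket c' k) \<otimes>\<^sub>m 1\<^sub>m ?B) [0..<c']"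
  have Tsc: "set Ts \<subseteq> carrier_mat ?n (?A * c' * ?B)" by (auto simp: Ts_def)
  define Ks where "Ks = kraus_comp Ts Ls"
  have Ksc: "set Ks \<subseteq> carrier_mat ?n ?D"
    using Tsc Lsc by (force simp: Ks_def set_kraus_comp)
  have TKs: "?T X = kraus_map ?n Ks X" if X: "X \<in> carrier_mat ?D ?D" for X
    unfolding Ks_def kraus_map_kraus_comp[OF Tsc Lsc X] \<Lambda>Ls[OF X] by (simp add: trace_middle_eq Ts_def)
  have gTs: "gram (?A * c' * ?B) Ts = 1\<^sub>m (?A * c' * ?B)"
  proof -
    have "gram (?A * c' * ?B) (map (\<lambda>K. K \<otimes>\<^sub>m 1\<^sub>m ?B) (map (\<lambda>K. 1\<^sub>m ?A \<otimes>\<^sub>m K) (map (\<lambda>k. mat_adjoint (ket c' k)) [0..<c'])))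
      = gram (?A * c') (map (\<lambda>K. 1\<^sub>m ?A \<otimes>\<^sub>m K) (map (\<lambda>k. mat_adjoint (ket c' k)) [0..<c'])) \<otimes>\<^sub>m 1\<^sub>m ?B"
      by (rule gram_tensor_one[of _ "?A * 1"]) (auto intro!: carrier_matI)
    also have "gram (?A * c') (map (\<lambda>K. 1\<^sub>m ?A \<otimes>\<^sub>m K) (map (\<lambda>k. mat_adjoint (ket c' k)) [0..<c']))
      = 1\<^sub>m ?A \<otimes>\<^sub>m gram c' (map (\<lambda>k. mat_adjoint (ket c' k)) [0..<c'])"
      by (rule gram_one_tensor[of _ 1]) auto
    finally show ?thesis by (simp add: Ts_def gram_kets comp_def)
  qed
  have gKs: "gram ?D Ks = 1\<^sub>m ?D" unfolding Ks_def by (simp add: gram_kraus_comp[OF Tsc gTs Lsc] gLs)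
  have trT: "tr (?T X) = tr X" if X: "X \<in> carrier_mat ?D ?D" for X
    unfolding TKs[OF X] tr_kraus_map[OF Ksc X] gKs using X by simp
  have Ks_prod: "\<exists>x\<in>carrier_mat ?A a. \<exists>y\<in>carrier_mat 1 c. \<exists>z\<in>carrier_mat ?B b. K = x \<otimes>\<^sub>m y \<otimes>\<^sub>m z"
    if KKs: "K \<in> set Ks" for K
  proof -
    obtain j L where K: "K = (1\<^sub>m ?A \<otimes>\<^sub>m mat_adjoint (ket c' j) \<otimes>\<^sub>m 1\<^sub>m ?B) * L" and L: "L \<in> set Ls"
      using KKs by (auto simp: Ks_def set_kraus_comp Ts_def)
    obtain x y z where xyz: "x \<in> carrier_mat ?A a" "y \<in> carrier_mat c' c" "z \<in> carrier_mat ?B b" "L = x \<otimes>\<^sub>m y \<otimes>\<^sub>m z"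
      using local_op_three[OF Ls[OF L] refl refl] by blast
    have "K = x \<otimes>\<^sub>m (mat_adjoint (ket c' j) * y) \<otimes>\<^sub>m z"
      using xyz by (simp add: K tensor_mult left_mult_one_mat[of _ ?A a] left_mult_one_mat[of _ ?B b])
    moreover have "mat_adjoint (ket c' j) * y \<in> carrier_mat 1 c" using xyz(2) by auto
    ultimately show ?thesis using xyz by blast
  qed

  obtain Ms where Ms: "set Ms \<subseteq> carrier_mat 2 ?n" "gram ?n Ms = 1\<^sub>m ?n"
    and MsX: "\<And>X. X \<in> carrier_mat ?n ?n \<Longrightarrow>
      kraus_map 2 Ms X = mat_diag 2 (\<lambda>i. if i = 0 then tr (?P * X) else tr X - tr (?P * X))"
    using two_outcome_measurement[OF R iso] by blast
  obtain \<Phi> where \<Phi>: "locc S' [c', ?n] [1, 2] \<Phi>"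
    and \<Phi>X: "\<And>X. X \<in> carrier_mat (?A * c' * ?B) (?A * c' * ?B) \<Longrightarrow>
      \<Phi> (charlie_first ?A c' ?B X) = kraus_map 2 Ms (trace_middle ?A c' ?B X)"
    using locc_discard_and_measure[OF Ms, of S' c'] by auto
  \<comment> \<open>The test is passed as the continuation of the protocol, already formulated for
    the merged parties.\<close>
  obtain \<Lambda>' where \<Lambda>': "locc S' [c, a * b] [1, 2] \<Lambda>'"
    and \<Lambda>'X: "\<And>X. X \<in> carrier_mat ?D ?D \<Longrightarrow> \<Lambda>' (charlie_first a c b X) = \<Phi> (charlie_first ?A c' ?B (\<Lambda> X))"
    using locc_merge_parties[OF \<Lambda> _ _ _ S, of "[1, 2]" \<Phi>] \<Phi> pos c0
    by (auto simp: mult.assoc numeral_2_eq_2)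
  have meas: "\<Lambda>' (charlie_first a c b X) = mat_diag 2 (?f X)" if X: "X \<in> carrier_mat ?D ?D" for X
  proof -
    have "\<Lambda> X \<in> carrier_mat (?A * c' * ?B) (?A * c' * ?B)"
      using locc_carrier[OF \<Lambda>] X unfolding pl by blast
    then show ?thesis by (simp only: \<Lambda>'X[OF X] \<Phi>X MsX[OF Tc])
  qed
  have "\<exists>f. \<Lambda>' Z = mat_diag 2 f" if Z: "Z \<in> carrier_mat (c * (a * b)) (c * (a * b))" for Z
  proof -
    obtain X where "X \<in> carrier_mat ?D ?D" "Z = charlie_first a c b X"
      using charlie_first_surj[of Z c a b] Z by (auto simp: mult.assoc)
    then show ?thesis using meas by blast
  qed
  from diagonal_locc_povm[OF \<Lambda>' this]
  obtain Qs where Qs: "Qs \<in> locc_povms S' c (a * b)"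
    and QsX: "\<And>Z. Z \<in> carrier_mat (c * (a * b)) (c * (a * b)) \<Longrightarrow> measure_map Qs Z = \<Lambda>' Z" by blast
  have QX: "measure_map Qs (charlie_first a c b X) = mat_diag 2 (?f X)" if X: "X \<in> carrier_mat ?D ?D" for X
    using QsX[of "charlie_first a c b X"] charlie_first_carrier[of a c b X] meas[OF X] by (simp add: mult.assoc)

  \<comment> \<open>Through the factor \<open>Y\<close> the output becomes a sum of terms
    \<open>V V^*\<close> with \<open>V = L * Y\<close>, the form in which the effect's value can be
    estimated.\<close>
  have \<omega>T: "?T \<omega> = kraus_map ?n (map (\<lambda>L. L * Y) Ks) (1\<^sub>m k)"
  proof -
    have "\<omega> = Y * 1\<^sub>m k * mat_adjoint Y"
      unfolding \<omega>(1) using Y by (simp add: right_mult_one_mat[of _ ?D k])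
    then have "?T \<omega> = kraus_map ?n Ks (Y * 1\<^sub>m k * mat_adjoint Y)" using TKs[OF \<omega>c] by metis
    also have "\<dots> = kraus_map ?n (map (\<lambda>L. L * Y) Ks) (1\<^sub>m k)" by (rule kraus_map_conj[OF Ksc Y]) simp
    finally show ?thesis .
  qed
  have tr\<omega>: "tr (?T \<omega>) = 1" by (simp add: trT[OF \<omega>c] \<omega>(2))
  have "\<exists>p. tr (?P * ?T \<omega>) = complex_of_real p \<and> 0 \<le> p \<and> p \<le> 1"
    unfolding \<omega>T
  proof (rule isometry_effect_value[OF R])
    show KY: "set (map (\<lambda>L. L * Y) Ks) \<subseteq> carrier_mat ?n k" using Ksc Y by auto
    fix V assume "V \<in> set (map (\<lambda>L. L * Y) Ks)"
    then have "V \<in> carrier_mat ?n k" using KY by blast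
    from power_mono[OF fnorm_twist_adjoint_le[OF d0 U this] fnorm_nonneg, where n = 2]
    show "(fnorm (mat_adjoint R * V))\<^sup>2 \<le> 1 * (fnorm V)\<^sup>2" by (simp add: R_def)
  qed (use tr\<omega> \<omega>T in simp)
  then obtain p where p: "tr (?P * ?T \<omega>) = complex_of_real p" "0 \<le> p" "p \<le> 1" by blast
  have "1 - \<epsilon> \<le> p"
  proof -
    have \<gamma>c: "\<gamma> \<in> carrier_mat ?n ?n" unfolding \<gamma>R R_def[symmetric] using R \<sigma>0c by auto
    have "?P * \<gamma> = R * (mat_adjoint R * R) * \<sigma>0 * mat_adjoint R"
      unfolding \<gamma>R R_def[symmetric] using Rd carrier_matD[OF \<sigma>0c] by (simp add: mult_mat_assoc)
    also have "\<dots> = R * (\<sigma>0 * mat_adjoint R)"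
      using R \<sigma>0c by (simp add: iso right_mult_one_mat[of _ ?n "a' * b'"] mult_mat_assoc)
    also have "tr \<dots> = tr (\<sigma>0 * mat_adjoint R * R)"
      using R \<sigma>0c by (intro tr_mult_commute[of _ ?n "a' * b'"]) auto
    also have "\<sigma>0 * mat_adjoint R * R = \<sigma>0"
      using Rd \<sigma>0c by (simp add: mult_mat_assoc iso right_mult_one_mat[of _ "a' * b'" "a' * b'"])
    finally have "tr (?P * \<gamma>) = 1" using \<sigma>0 by (simp add: density_def)
    moreover have "?P * (?T \<omega> - \<gamma>) = ?P * ?T \<omega> - ?P * \<gamma>"
      using P Tc \<gamma>c by (rule mult_minus_distrib_mat)
    moreover have "tr (?P * ?T \<omega> - ?P * \<gamma>) = tr (?P * ?T \<omega>) - tr (?P * \<gamma>)"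
      using P Tc \<gamma>c by (intro tr_minus[of _ ?n]) (auto intro: mult_carrier_mat)
    ultimately have "tr (?P * (?T \<omega> - \<gamma>)) = complex_of_real (p - 1)" by (simp add: p)
    \<comment> \<open>The projector is a contraction, so its expectation differs from that in
      \<open>\<gamma>\<close>, which is 1, by at most the trace norm of the difference.\<close>
    moreover have "cmod (tr (?P * (?T \<omega> - \<gamma>))) \<le> trace_norm (?T \<omega> - \<gamma>)"
    proof (rule cmod_tr_mult_le_trace_norm[OF P])
      show "?T \<omega> - \<gamma> \<in> carrier_mat ?n ?n" using \<gamma>c by (rule minus_carrier_mat)
      fix u :: "complex mat" assume u: "u \<in> carrier_mat ?n 1"
      have "mat_adjoint ?P * u = R * (mat_adjoint R * u)"
        using Rd carrier_matD[OF u] by (simp add: mat_adjoint_mult mult_mat_assoc)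
      also have "fnorm \<dots> = fnorm (mat_adjoint R * u)"
        using iso Rd by (intro fnorm_mult_isometry) auto
      also have "\<dots> \<le> fnorm u" unfolding R_def by (rule fnorm_twist_adjoint_le[OF d0 U u])
      finally show "fnorm (mat_adjoint ?P * u) \<le> fnorm u" .
    qed
    ultimately have "\<bar>p - 1\<bar> \<le> \<epsilon>" using close by (simp only: norm_of_real)
    then show ?thesis by simp
  qed

  obtain Vs where Vs: "\<sigma> = kraus_map ?D Vs (1\<^sub>m ?D)" and Vs_prod: "\<And>V. V \<in> set Vs \<Longrightarrow>
      \<exists>x\<in>carrier_mat a a. \<exists>y\<in>carrier_mat c c. \<exists>z\<in>carrier_mat b b. V = x \<otimes>\<^sub>m y \<otimes>\<^sub>m z"
    and tr\<sigma>: "tr \<sigma> = 1"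
    using separable4_factor[OF \<sigma>] unfolding c_def by blast
  have Vsc: "set Vs \<subseteq> carrier_mat ?D ?D" using Vs_prod by fastforce
  have \<sigma>c: "\<sigma> \<in> carrier_mat ?D ?D" unfolding Vs by simp
  have \<sigma>T: "?T \<sigma> = kraus_map ?n (kraus_comp Ks Vs) (1\<^sub>m ?D)"
    unfolding TKs[OF \<sigma>c] kraus_map_kraus_comp[OF Ksc Vsc one_carrier_mat] by (simp only: Vs[symmetric])
  have tr\<sigma>T: "tr (?T \<sigma>) = 1" by (simp add: trT[OF \<sigma>c] tr\<sigma>)
  have "\<exists>q. tr (?P * ?T \<sigma>) = complex_of_real q \<and> 0 \<le> q \<and> q \<le> 1 / d"
    unfolding \<sigma>T
  proof (rule isometry_effect_value[OF R])
    show "set (kraus_comp Ks Vs) \<subseteq> carrier_mat ?n ?D" using Ksc Vsc by (force simp: set_kraus_comp)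
    fix V assume "V \<in> set (kraus_comp Ks Vs)"
    then obtain K W where V: "V = K * W" and K: "K \<in> set Ks" and W: "W \<in> set Vs"
      by (auto simp: set_kraus_comp)
    obtain x y z where xyz: "x \<in> carrier_mat ?A a" "y \<in> carrier_mat 1 c" "z \<in> carrier_mat ?B b" "K = x \<otimes>\<^sub>m y \<otimes>\<^sub>m z"
      using Ks_prod[OF K] by blast
    obtain x' y' z' where xyz': "x' \<in> carrier_mat a a" "y' \<in> carrier_mat c c" "z' \<in> carrier_mat b b" "W = x' \<otimes>\<^sub>m y' \<otimes>\<^sub>m z'"
      using Vs_prod[OF W] by blast
    have V': "V = ((x * x') \<otimes>\<^sub>m (y * y')) \<otimes>\<^sub>m (z * z')"
      using xyz xyz' by (simp add: V tensor_mult)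
    have "(x * x') \<otimes>\<^sub>m (y * y') \<in> carrier_mat (?A * 1) (a * c)"
      by (rule tensor_carrier[OF mult_carrier_mat[OF xyz(1) xyz'(1)] mult_carrier_mat[OF xyz(2) xyz'(2)]])
    \<comment> \<open>Charlie's factor has a single row after the trace, so it only adds columns to
      Alice's operator: the whole is a product across Alice and Bob, as the product estimate
      demands.\<close>
    then have 1: "(x * x') \<otimes>\<^sub>m (y * y') \<in> carrier_mat ?A (a * c)" by simp
    show "(fnorm (mat_adjoint R * V))\<^sup>2 \<le> 1 / d * (fnorm V)\<^sup>2"
      unfolding R_def V' by (rule fnorm_twist_product_le[OF d0 U 1 mult_carrier_mat[OF xyz(3) xyz'(3)]])
  qed (use tr\<sigma>T \<sigma>T in simp)
  then obtain q where q: "tr (?P * ?T \<sigma>) = complex_of_real q" "0 \<le> q" "q \<le> 1 / 2 ^ m" by (auto simp: d_def)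

  \<comment> \<open>Trace preservation turns the probabilities of the second outcome into
    \<open>1 - p\<close> and \<open>1 - q\<close>.\<close>
  have "measure_map Qs (charlie_first a c b \<omega>) = mat_diag 2 (\<lambda>i. complex_of_real (if i = 0 then p else 1 - p))"
    "measure_map Qs (charlie_first a c b \<sigma>) = mat_diag 2 (\<lambda>i. complex_of_real (if i = 0 then q else 1 - q))"
    unfolding QX[OF \<omega>c] QX[OF \<sigma>c] p(1) q(1) tr\<omega> tr\<sigma>T
    by (intro arg_cong[where f = "mat_diag 2"] ext, simp)+
  then have "ereal ((1 - \<epsilon>) * m - 2) \<le> rel_entropy
      (measure_map Qs (charlie_first a c b \<omega>)) (measure_map Qs (charlie_first a c b \<sigma>))"
    using rel_entropy_binary_ge[OF p(2,3) \<open>1 - \<epsilon> \<le> p\<close> q(2,3) \<epsilon>] by simp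
  also have "\<dots> \<le> (SUP Ms\<in>locc_povms S' (c1 * c2) (a * b).
      rel_entropy (measure_map Ms (charlie_first a (c1 * c2) b \<omega>)) (measure_map Ms (charlie_first a (c1 * c2) b \<sigma>)))"
    using Qs unfolding c_def by (rule SUP_upper)
  finally show "ereal ((1 - \<epsilon>) * m - 2) \<le> (SUP Ms\<in>locc_povms S' (c1 * c2) (a * b).
      rel_entropy (measure_map Ms (charlie_first a (c1 * c2) b \<omega>)) (measure_map Ms (charlie_first a (c1 * c2) b \<sigma>)))" .
qed

text \<open>It suffices to bound the rate by each \<open>y\<close> above the regularised entropy.
  The gap leaves room for both losses, the factor \<open>1 - \<epsilon>\<close> and the term
  \<open>2 / n\<close>.\<close>

lemma repeater_rate_le_regularised:
  assumes \<rho>: "density (dA * dCA) \<rho>" and \<tau>: "density (dCB * dB) \<tau>"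
    and S: "1 \<in> S \<Longrightarrow> 0 \<in> S'" "0 \<in> S \<or> 2 \<in> S \<Longrightarrow> 1 \<in> S'"
  shows "repeater_rate S dA dCA dCB dB \<rho> \<tau> \<le> regularised_rel_entropy S' dA dCA dCB dB \<rho> \<tau>"
proof (rule dense_ge)
  have pos: "0 < dA" "0 < dCA" "0 < dCB" "0 < dB"
    using density_dim_pos[OF \<rho>] density_dim_pos[OF \<tau>] by auto
  fix y assume y: "regularised_rel_entropy S' dA dCA dCB dB \<rho> \<tau> < y"
  show "repeater_rate S dA dCA dCB dB \<rho> \<tau> \<le> y"
  proof (cases "y = \<infinity>")
    case False
    then obtain z where z: "y = ereal z" using y by (cases y) auto
    \<comment> \<open>The entropy rates are eventually below \<open>v\<close>, because their limit
      superior is; the distance from \<open>v\<close> to \<open>z\<close> is spent on the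
      losses.\<close>
    obtain v where v: "regularised_rel_entropy S' dA dCA dCB dB \<rho> \<tau> < ereal v" "v < z"
      using ereal_dense2[OF y] z by auto
    define \<delta> where "\<delta> = (z - v) / 2"
    have \<delta>: "0 < \<delta>" using v by (simp add: \<delta>_def)
    \<comment> \<open>One half \<open>\<delta>\<close> of the gap pays for
      \<open>\<epsilon> * z\<close>, the other for \<open>2 / n\<close>. The absolute value allows a
      negative \<open>z\<close>, the summand 1 avoids division by zero, and \<open>1 / 2\<close>
      keeps \<open>1 - \<epsilon>\<close> positive.\<close>
    define \<epsilon> where "\<epsilon> = min (1 / 2) (\<delta> / (\<bar>z\<bar> + 1))"
    have \<epsilon>: "0 < \<epsilon>" "\<epsilon> < 1" using \<delta> by (auto simp: \<epsilon>_def)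
    have "\<epsilon> * z \<le> \<delta>"
    proof -
      have "\<epsilon> * z \<le> \<delta> / (\<bar>z\<bar> + 1) * (\<bar>z\<bar> + 1)"
        using \<epsilon> by (intro order_trans[OF mult_left_mono[of z "\<bar>z\<bar> + 1"] mult_right_mono]) (auto simp: \<epsilon>_def)
      then show ?thesis by simp
    qed
    moreover have "v + \<delta> = z - \<delta>" by (simp add: \<delta>_def field_simps)
    ultimately have vz: "v + \<delta> \<le> (1 - \<epsilon>) * z" by (simp add: algebra_simps)
    define F where "F n = Sup {ereal (real m / real n) |m. \<exists>a b c \<Lambda> \<gamma>.
        locc S [dA ^ n, dCA ^ n * dCB ^ n, dB ^ n] [2 ^ m * a, c, 2 ^ m * b] \<Lambda> \<and>
        \<gamma> \<in> private_states m a b \<and>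
        trace_norm
          (trace_middle (2 ^ m * a) c (2 ^ m * b) (\<Lambda> (copies dA dCA dCB dB \<rho> \<tau> n)) - \<gamma>) \<le> \<epsilon>}" for n
    have "eventually (\<lambda>n. entropy_rate S' dA dCA dCB dB \<rho> \<tau> n < ereal v) sequentially"
      using v(1) unfolding regularised_rel_entropy_def by (rule Limsup_lessD)
    moreover have "eventually (\<lambda>n. 2 / real n < \<delta>) sequentially"
    proof -
      have "(\<lambda>n. 2 / real n) \<longlonglongrightarrow> 0" by (rule lim_const_over_n)
      then show ?thesis using \<delta> by (rule order_tendstoD)
    qed
    ultimately have "eventually (\<lambda>n. F n \<le> ereal z) sequentially"
      \<comment> \<open>Excludes \<open>n = 0\<close>, where the rates divide by zero.\<close>
      using eventually_gt_at_top[of 0]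
    proof eventually_elim
      case (elim n)
      show ?case
        unfolding F_def
      proof (rule Sup_least)
        fix x assume "x \<in> {ereal (real m / real n) |m. \<exists>a b c \<Lambda> \<gamma>.
          locc S [dA ^ n, dCA ^ n * dCB ^ n, dB ^ n] [2 ^ m * a, c, 2 ^ m * b] \<Lambda> \<and>
          \<gamma> \<in> private_states m a b \<and>
          trace_norm
            (trace_middle (2 ^ m * a) c (2 ^ m * b) (\<Lambda> (copies dA dCA dCB dB \<rho> \<tau> n)) - \<gamma>) \<le> \<epsilon>}"
        then obtain m a b c \<Lambda> \<gamma> where x: "x = ereal (real m / real n)"
          and \<Lambda>: "locc S [dA ^ n, dCA ^ n * dCB ^ n, dB ^ n] [2 ^ m * a, c, 2 ^ m * b] \<Lambda>"
          and \<gamma>: "\<gamma> \<in> private_states m a b"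
          and close: "trace_norm (trace_middle (2 ^ m * a) c (2 ^ m * b) (\<Lambda> (copies dA dCA dCB dB \<rho> \<tau> n)) - \<gamma>) \<le> \<epsilon>"
          by blast
        obtain k Y where Y: "Y \<in> carrier_mat (dA ^ n * (dCA ^ n * dCB ^ n) * dB ^ n) k"
          "copies dA dCA dCB dB \<rho> \<tau> n = Y * mat_adjoint Y"
          using copies_factor(1)[OF \<rho> \<tau>] by blast
        have "ereal ((1 - \<epsilon>) * m - 2)
          \<le> restricted_rel_entropy S' (dA ^ n) (dCA ^ n) (dCB ^ n) (dB ^ n) (copies dA dCA dCB dB \<rho> \<tau> n)"
          by (rule restricted_rel_entropy_ge[OF _ _ _ _ Y copies_factor(2)[OF \<rho> \<tau>] \<Lambda> S \<gamma> close \<epsilon>(2)])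
            (use pos in auto)
        then have "ereal (1 / real n) * ereal ((1 - \<epsilon>) * m - 2) \<le> entropy_rate S' dA dCA dCB dB \<rho> \<tau> n"
          unfolding entropy_rate_def by (rule ereal_mult_left_mono) simp
        also have "\<dots> < ereal v" by (rule elim(1))
        finally have "1 / real n * ((1 - \<epsilon>) * m - 2) < v" by simp
        then have "(1 - \<epsilon>) * m < v * n + 2" using elim(3) by (simp add: field_simps)
        then have "(1 - \<epsilon>) * m / n < (v * n + 2) / n"
          using elim(3) by (intro divide_strict_right_mono) auto
        then have "(1 - \<epsilon>) * (m / n) < v + 2 / n" using elim(3) by (simp add: add_divide_distrib)
        also have "\<dots> < v + \<delta>" using elim(2) by simp
        also note vz
        finally have "m / n < z" using \<epsilon>(2) by (simp only: mult_less_cancel_left_pos diff_gt_0_iff_gt)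
        then show "x \<le> ereal z" by (simp add: x)
      qed
    qed
    then have "limsup F \<le> ereal z" by (rule Limsup_bounded)
    moreover have "repeater_rate S dA dCA dCB dB \<rho> \<tau> \<le> limsup F"
      unfolding repeater_rate_def F_def using \<epsilon>(1) by (intro INF_lower) simp
    ultimately show ?thesis using z by simp
  qed simp
qed

text \<open>Charlie is party 1 of the repeater and party 0 of the cut \<open>C : AB\<close>, so
  one-way communication from Charlie is \<open>{1}\<close> in the key rate and \<open>{0}\<close> in
  the entropy.\<close>

theorem theorem4:
  fixes dA dCA dCB dB :: nat and \<rho> \<tau> :: "complex mat"
  assumes "density (dA * dCA) \<rho>" and "density (dCB * dB) \<tau>"
  shows "key_rate_two_way dA dCA dCB dB \<rho> \<tau> \<le> rel_entropy_reg_two_way dA dCA dCB dB \<rho> \<tau> \<and>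
         key_rate_one_way dA dCA dCB dB \<rho> \<tau> \<le> rel_entropy_reg_one_way dA dCA dCB dB \<rho> \<tau>"
  unfolding key_rate_two_way_def key_rate_one_way_def rel_entropy_reg_two_way_def rel_entropy_reg_one_way_def
  using assms by (auto intro!: repeater_rate_le_regularised)

end
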